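(* Let $$\widetilde\Phi^k = \mathbb{E}\left[\frac{1}{\gamma}\left(f(\overline{y}^{k}) - f(x^* )\right) + \Phi_{\rm U}^{k} + \frac{1+\beta}{2\eta}\|\overline{z}^{k} - x^*\|^2 + c_4\widetilde\Phi_{\rm C}^{k}\right],\quad \delta = \min\left\{\frac{\gamma}{4},\ \frac{\alpha p}{2\tau+\alpha},\ \frac{\beta}{1+\beta},\ \frac{p}{2},\ \tau,\ \frac{\widetilde\theta_{\rm w}}{2}\right\}.$$ Suppose the parameters and stepsize of the OGT iteration satisfy all of the following: (i) $\frac{2(1 - \tau)}{2 - \tau} + \frac{192c_5 (1 - \tau)\gamma^2\beta^2}{\tau\widetilde\theta_{\rm w}^2} + \frac{\tau}{4} + \frac{16 c_5 p}{\widetilde\theta_{\rm w}} \leq 1 - \frac{\tau}{8}$, $\quad\frac{\alpha^2}{(1 - \tau)\gamma^2} \leq 1$, $\quad\frac{192c_5(1 - \tau)\gamma^2\eta^2 L^2}{\tau\widetilde\theta_{\rm w}} \leq \frac{\widetilde\theta_{\rm w}}{2}$; (ii) $\frac{2\eta L^2}{qn} \leq \frac{c_3}{2}$, $\quad c_5c_3\widetilde c_2 \leq \frac{\eta}{2qn}$, $\quad\frac{8\eta L}{q} \leq \frac{\tau}{\alpha}$; (iii) $L\gamma \leq \frac{1}{4\eta}$, $\quad\frac{\beta}{2\eta} \leq \frac{\mu}{4}$, $\quad\frac{1}{\gamma} - \frac{1 - \alpha - \tau}{\alpha} - \frac{1}{2} \leq 0$, $\quad\frac{1 - \alpha - \tau}{\alpha}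 \leq \frac{1}{\gamma} - \frac{1}{4}$. Then $\widetilde\Phi^k$ converges linearly, with $$\widetilde\Phi^{k+1} \leq (1 - \delta)\widetilde\Phi^k\qquad\text{for all }k\ge0.$$ Specifically, one can choose $$\tau = \tfrac{1}{2},\quad p = q = \frac{\widetilde\theta_{\rm w}}{60750},\quad \alpha = \frac{1}{45\sqrt{\kappa}},\quad \gamma = \frac{4\alpha}{4 - 4\tau - 3\alpha},\quad \eta = \frac{\widetilde\theta_{\rm w}\sqrt{\kappa}}{50000 L},\quad \beta = \frac{\mu\eta}{2}.$$ In this case, to have $\widetilde\Phi^K \leq \epsilon\widetilde\Phi^0$, the gradient computation complexity is $O\left(\sqrt{\kappa}\log\frac{1}{\epsilon}\right)$ and the communication complexity is $O\left(\sqrt{\frac{\kappa}{\theta}}\log\frac{1}{\epsilon}\right)$.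
   Context: Problem. There are $n$ agents $\mathcal N=\{1,\dots,n\}$; each $f_i:\mathbb R^d\to\mathbb R$ is differentiable, $\mu$-strongly convex and $L$-smooth, $L\ge\mu>0$: for all $x,y$, $\langle x-y,\nabla f_i(x)-\nabla f_i(y)\rangle\ge\mu\|x-y\|^2$ and $\|\nabla f_i(x)-\nabla f_i(y)\|\le L\|x-y\|$. Let $f=\frac1n\sum_i f_i$, with unique minimizer $x^*$, and $\kappa=L/\mu$. The gossip matrix $W\in\mathbb R^{n\times n}$ (compatible with the undirected connected communication graph) is symmetric and positive semidefinite and satisfies $W\mathbf 1=\mathbf 1$, $W^\top\mathbf 1=\mathbf 1$ and $\|W-\frac{\mathbf 1\mathbf 1^\top}{n}\|_2=1-\theta$ with $\theta\in(0,1]$. Let $\Pi=I-\frac{\mathbf 1\mathbf 1^\top}{n}$. $\|\cdot\|$ is the Euclidean norm of vectors, $\|\cdot\|_F$ the Frobenius norm. Points of $\mathbb R^d$ are row vectors; for $X\in\mathbb R^{n\times d}$ with rows $x_i$, $\nabla F(X)\in\mathbb R^{n\times d}$ has $i$-th row $\nabla f_i(x_i)$. An overlined lower-case letter denotes the row average of the corresponding $n\times d$ matrix: $\overline x^k=\frac1n\mathbf 1^\top X^k$, and similarly $\overline y^k,\overline z^k,\overline u^k,\overline q^k,\overline g^k$. Notation for OGT. $\eta_{\rm root}=\frac{1-\sqrt{1-(1-\theta)^2}}{1+\sqrt{1-(1-\theta)^2}}$, $\widetilde\eta_{\rm w}=\frac{1+\eta_{\rm root}}{2}$, $\widetilde\rho_{\rm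 w}=\sqrt{\widetilde\eta_{\rm w}}$, $\widetilde\theta_{\rm w}=1-\widetilde\rho_{\rm w}$. For $A\in\mathbb R^{n\times d}$, $A_\#=\begin{pmatrix}A\\ A\end{pmatrix}\in\mathbb R^{2n\times d}$; $\nabla F(X)_\#$ is $\nabla F(X)$ stacked twice. $\widetilde W=\begin{pmatrix}(1+\widetilde\eta_{\rm w})W&-\widetilde\eta_{\rm w}I\\ I&0\end{pmatrix}\in\mathbb R^{2n\times 2n}$. For $\widetilde Z^k,\widetilde U^k,\widetilde G^k\in\mathbb R^{2n\times d}$, the matrices $Z^k,U^k,G^k\in\mathbb R^{n\times d}$ denote their first $n$ rows. OGT iteration. Parameters $\alpha,\beta,\gamma,\tau,p,q\in(0,1)$, stepsize $\eta>0$. Start with $Y^0=Z^0=U^0=Q^0=X^0$, $\widetilde Z^0=\widetilde U^0=X^0_\#$, $\widetilde G^0=\nabla F(X^0)_\#$. With independent random variables $\xi^k\sim Bernoulli(p)$ and $\zeta^k$ ($\Pr[\zeta^k=1/q]=q$, $\Pr[\zeta^k=0]=1-q$), for $k=0,1,2,\dots$: $X^k=(1-\alpha-\tau)Y^k+\alpha Z^k+\tau U^k$; $\widetilde Z^{k+1}=(1+\beta)^{-1}\widetilde W\big(\widetilde Z^k+\beta X^k_\#-\eta G^k_\#+\eta\zeta^k(\nabla F(Q^k)_\#-\nabla F(X^k)_\#)\big)$; $Y^{k+1}=X^k+\gamma(Z^{k+1}-Z^k)$; $Q^{k+1}=(1-\xi^k)Q^k+\xi^kX^k$; $\widetilde U^{k+1}=\widetilde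 W\big((1-\xi^k)\widetilde U^k+\xi^kX^k_\#\big)$; $\widetilde G^{k+1}=\widetilde W\widetilde G^k+\xi^k\big(\nabla F(X^k)_\#-\nabla F(Q^k)_\#\big)$. Constants and Lyapunov quantities. $c_5=14$; write $D^k=\mathbb E\|\nabla F(X^k)-\nabla F(Q^k)\|_F^2$ and define the deterministic sequences $\mathcal C_{\rm G}^k=\sum_{i=0}^{k-1}2c_5p(1-\widetilde\theta_{\rm w})^{k-1-i}D^i+c_5(1-\widetilde\theta_{\rm w})^k\|\Pi G^0\|_F^2$; $\mathcal C_{\rm U}^k=c_5p\sum_{i=0}^{k-1}(1-\widetilde\theta_{\rm w})^{2(k-i)}\mathbb E\|\Pi X^i\|_F^2+c_5(1-\widetilde\theta_{\rm w})^{2k}\|\Pi U^0\|_F^2$; $\mathcal C_{\rm Z}^k=\sum_{i=0}^{k-1}(1-\widetilde\theta_{\rm w})^{k-i}\Big(\frac{4c_5\beta^2}{\widetilde\theta_{\rm w}}\mathbb E\|\Pi X^i\|_F^2+\frac{4c_5\eta^2}{\widetilde\theta_{\rm w}}\mathcal C_{\rm G}^i\Big)+c_5\sum_{i=0}^{k-1}(1-\widetilde\theta_{\rm w})^{k-i}\Big(\frac{\eta^2}{q}+\frac{2\eta^2}{\widetilde\theta_{\rm w}}\Big)D^i+c_5(1-\widetilde\theta_{\rm w})^k\|\Pi Z^0\|_F^2$. Then $\widetilde\Phi_{\rm C}^k=\frac8\tau\Big(\mathbb E\big[\frac{\tau}{4p}\|\Pi Q^k\|_F^2+\frac{4(1-\tau)}{4-\tau}\|\Pi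 Y^k\|_F^2\big]+\frac{16}{\widetilde\theta_{\rm w}}\mathcal C_{\rm U}^k+\big(1-\frac{\widetilde\theta_{\rm w}}{6}\big)\frac{48(1-\tau)\gamma^2}{\tau\widetilde\theta_{\rm w}}\mathcal C_{\rm Z}^k+\frac{1}{\widetilde\theta_{\rm w}L^2}\mathcal C_{\rm G}^k\Big)$; $\Phi_{\rm U}^k=\frac{2\tau+\alpha}{2\alpha p}\left(f(\overline u^k)-f(x^* )\right)$; $\widetilde c_2=\frac{384(1-\tau)\gamma^2}{\tau^2\widetilde\theta_{\rm w}}\left(\frac{\eta^2}{q}+\frac{2\eta^2}{\widetilde\theta_{\rm w}}\right)+\frac{16p}{\tau\widetilde\theta_{\rm w}L^2}$; $c_3=\left(\frac{1-\alpha-\tau}{\alpha n}+\frac{1}{n\gamma}+\frac1n\right)L$; $c_4=\frac{c_3\tau q}{4\alpha\eta L}$. Complexities. The communication complexity is the number of communication rounds performed by each agent (in one round each agent may broadcast $O(1)$ vectors of length $O(d)$ to its neighbors; each OGT iteration uses one round). The gradient computation complexity is the number of local gradients $\nabla f_i(\cdot)$ each agent computes; a new gradient (at $x_i^k$) is computed in iteration $k$ only when $\xi^k\ne0$ or $\zeta^k\neq0$, and the random number of gradient computations is counted in expectation. *)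

theory Defs
  imports "HOL-Analysis.Analysis" "HOL-Probability.Probability"
begin

section \<open>Matrices\<close>

text \<open>
  The index type \<open>'n\<close> is the set of agents and \<open>real^'d\<close> is the space of decision variables.
  An \<open>n \<times> d\<close> matrix is an element of \<open>real^'d^'n\<close>, with \<open>X $ i\<close> the row of agent \<open>i\<close>; the library
  norm of this type is the Frobenius norm. Matrices with \<open>2n\<close> rows are indexed by the sum type
  \<open>'n + 'n\<close>: \<open>Inl\<close> is the upper block and \<open>Inr\<close> the lower one.
\<close>

definition avg_matrix :: "real^'n^'n::finite" where
  "avg_matrix = (\<chi> i j. 1 / real CARD('n))"

definition proj_matrix :: "real^'n^'n::finite" where
  "proj_matrix = mat 1 - avg_matrix"

definition row_avg :: "real^'d^'n \<Rightarrow> real^'d" where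
  "row_avg A = (1 / real CARD('n)) *\<^sub>R (\<Sum>i\<in>UNIV. A $ i)"

definition stack2 :: "real^'d^'n \<Rightarrow> real^'d^('n + 'n)" where
  "stack2 A = (\<chi> i. case i of Inl a \<Rightarrow> A $ a | Inr a \<Rightarrow> A $ a)"

definition upper :: "real^'d^('n + 'n) \<Rightarrow> real^'d^'n" where
  "upper A = (\<chi> a. A $ Inl a)"

definition block_matrix ::
  "real^'n^'n \<Rightarrow> real^'n^'n \<Rightarrow> real^'n^'n \<Rightarrow> real^'n^'n \<Rightarrow> real^('n + 'n)^('n + 'n)" where
  "block_matrix A B C D =
     (\<chi> i j. case i of
        Inl a \<Rightarrow> (case j of Inl b \<Rightarrow> A $ a $ b | Inr b \<Rightarrow> B $ a $ b)
      | Inr a \<Rightarrow> (case j of Inl b \<Rightarrow> C $ a $ b | Inr b \<Rightarrow> D $ a $ b))"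


section \<open>The optimization problem and the network\<close>

definition obj_avg :: "('n::finite \<Rightarrow> real^'d \<Rightarrow> real) \<Rightarrow> real^'d \<Rightarrow> real" where
  "obj_avg f x = (1 / real CARD('n)) * (\<Sum>i\<in>UNIV. f i x)"

definition smooth_strongly_convex ::
  "real \<Rightarrow> real \<Rightarrow> (real^'d \<Rightarrow> real) \<Rightarrow> (real^'d \<Rightarrow> real^'d) \<Rightarrow> bool" where
  "smooth_strongly_convex \<mu> L h grad \<longleftrightarrow>
     (\<forall>x. GDERIV h x :> grad x) \<and>
     (\<forall>x y. (x - y) \<bullet> (grad x - grad y) \<ge> \<mu> * (norm (x - y))\<^sup>2) \<and>
     (\<forall>x y. norm (grad x - grad y) \<le> L * norm (x - y))"

definition unique_minimizer :: "(real^'d \<Rightarrow> real) \<Rightarrow> real^'d \<Rightarrow> bool" where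
  "unique_minimizer h xs \<longleftrightarrow> (\<forall>x. x \<noteq> xs \<longrightarrow> h xs < h x)"

text \<open>\<open>Edges\<close> contains both orientations of each edge of the undirected communication graph.\<close>

definition gossip_matrix :: "('n \<times> 'n) set \<Rightarrow> real^'n^'n::finite \<Rightarrow> real \<Rightarrow> bool" where
  "gossip_matrix Edges W \<theta> \<longleftrightarrow>
     sym Edges \<and> (\<forall>i j. (i, j) \<in> Edges\<^sup>*) \<and>
     (\<forall>i j. i \<noteq> j \<longrightarrow> (i, j) \<notin> Edges \<longrightarrow> W $ i $ j = 0) \<and>
     transpose W = W \<and>
     (\<forall>x. 0 \<le> x \<bullet> (W *v x)) \<and>
     W *v (\<chi> i. 1) = (\<chi> i. 1) \<and>
     transpose W *v (\<chi> i. 1) = (\<chi> i. 1) \<and>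
     onorm ((*v) (W - avg_matrix)) = 1 - \<theta> \<and>
     0 < \<theta> \<and> \<theta> \<le> 1"


section \<open>Randomness\<close>

text \<open>
  The whole family, consisting of all \<open>\<xi> k\<close> (summand \<open>Inl\<close>) and all \<open>\<zeta> k\<close> (summand \<open>Inr\<close>),
  is mutually independent.
\<close>

definition ogt_noise ::
  "real \<Rightarrow> real \<Rightarrow> 'w measure \<Rightarrow> (nat \<Rightarrow> 'w \<Rightarrow> real) \<Rightarrow> (nat \<Rightarrow> 'w \<Rightarrow> real) \<Rightarrow> bool" where
  "ogt_noise p q M \<xi> \<zeta> \<longleftrightarrow>
     prob_space M \<and>
     prob_space.indep_vars M (\<lambda>_. borel) (case_sum \<xi> \<zeta>) UNIV \<and>
     (\<forall>k. measure M {\<omega> \<in> space M. \<xi> k \<omega> = 1} = p \<and>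
          measure M {\<omega> \<in> space M. \<xi> k \<omega> = 0} = 1 - p \<and>
          measure M {\<omega> \<in> space M. \<zeta> k \<omega> = 1 / q} = q \<and>
          measure M {\<omega> \<in> space M. \<zeta> k \<omega> = 0} = 1 - q)"


section \<open>Constants\<close>

definition eta_root :: "real \<Rightarrow> real" where
  "eta_root \<theta> = (1 - sqrt (1 - (1 - \<theta>)\<^sup>2)) / (1 + sqrt (1 - (1 - \<theta>)\<^sup>2))"

definition eta_w :: "real \<Rightarrow> real" where
  "eta_w \<theta> = (1 + eta_root \<theta>) / 2"

definition rho_w :: "real \<Rightarrow> real" where
  "rho_w \<theta> = sqrt (eta_w \<theta>)"

definition theta_w :: "real \<Rightarrow> real" where
  "theta_w \<theta> = 1 - rho_w \<theta>"

definition W_tilde :: "real \<Rightarrow> real^'n^'n::finite \<Rightarrow> real^('n + 'n)^('n + 'n)" where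
  "W_tilde \<theta> W =
     block_matrix ((1 + eta_w \<theta>) *\<^sub>R W) (- eta_w \<theta> *\<^sub>R mat 1) (mat 1) 0"

definition c5 :: real where
  "c5 = 14"

definition c2_tilde :: "real \<Rightarrow> real \<Rightarrow> real \<Rightarrow> real \<Rightarrow> real \<Rightarrow> real \<Rightarrow> real \<Rightarrow> real" where
  "c2_tilde \<theta> L \<gamma> \<tau> p q \<eta> =
     384 * (1 - \<tau>) * \<gamma>\<^sup>2 / (\<tau>\<^sup>2 * theta_w \<theta>) * (\<eta>\<^sup>2 / q + 2 * \<eta>\<^sup>2 / theta_w \<theta>)
     + 16 * p / (\<tau> * theta_w \<theta> * L\<^sup>2)"

definition c3 :: "nat \<Rightarrow> real \<Rightarrow> real \<Rightarrow> real \<Rightarrow> real \<Rightarrow> real" where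
  "c3 n L \<alpha> \<gamma> \<tau> =
     ((1 - \<alpha> - \<tau>) / (\<alpha> * real n) + 1 / (real n * \<gamma>) + 1 / real n) * L"

definition c4 :: "nat \<Rightarrow> real \<Rightarrow> real \<Rightarrow> real \<Rightarrow> real \<Rightarrow> real \<Rightarrow> real \<Rightarrow> real" where
  "c4 n L \<alpha> \<gamma> \<tau> q \<eta> = c3 n L \<alpha> \<gamma> \<tau> * \<tau> * q / (4 * \<alpha> * \<eta> * L)"

definition ogt_rate :: "real \<Rightarrow> real \<Rightarrow> real \<Rightarrow> real \<Rightarrow> real \<Rightarrow> real \<Rightarrow> real" where
  "ogt_rate \<theta> \<alpha> \<beta> \<gamma> \<tau> p =
     Min {\<gamma> / 4, \<alpha> * p / (2 * \<tau> + \<alpha>), \<beta> / (1 + \<beta>), p / 2, \<tau>, theta_w \<theta> / 2}"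

definition ogt_params_range ::
  "real \<Rightarrow> real \<Rightarrow> real \<Rightarrow> real \<Rightarrow> real \<Rightarrow> real \<Rightarrow> real \<Rightarrow> bool" where
  "ogt_params_range \<alpha> \<beta> \<gamma> \<tau> p q \<eta> \<longleftrightarrow> {\<alpha>, \<beta>, \<gamma>, \<tau>, p, q} \<subseteq> {0<..<1} \<and> 0 < \<eta>"

definition ogt_conditions ::
  "nat \<Rightarrow> real \<Rightarrow> real \<Rightarrow> real \<Rightarrow> real \<Rightarrow> real \<Rightarrow> real \<Rightarrow> real \<Rightarrow> real \<Rightarrow> real \<Rightarrow> real \<Rightarrow> bool" where
  "ogt_conditions n \<mu> L \<theta> \<alpha> \<beta> \<gamma> \<tau> p q \<eta> \<longleftrightarrow>
     2 * (1 - \<tau>) / (2 - \<tau>)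
       + 192 * c5 * (1 - \<tau>) * \<gamma>\<^sup>2 * \<beta>\<^sup>2 / (\<tau> * (theta_w \<theta>)\<^sup>2)
       + \<tau> / 4 + 16 * c5 * p / theta_w \<theta> \<le> 1 - \<tau> / 8 \<and>
     \<alpha>\<^sup>2 / ((1 - \<tau>) * \<gamma>\<^sup>2) \<le> 1 \<and>
     192 * c5 * (1 - \<tau>) * \<gamma>\<^sup>2 * \<eta>\<^sup>2 * L\<^sup>2 / (\<tau> * theta_w \<theta>) \<le> theta_w \<theta> / 2 \<and>
     2 * \<eta> * L\<^sup>2 / (q * real n) \<le> c3 n L \<alpha> \<gamma> \<tau> / 2 \<and>
     c5 * c3 n L \<alpha> \<gamma> \<tau> * c2_tilde \<theta> L \<gamma> \<tau> p q \<eta> \<le> \<eta> / (2 * q * real n) \<and>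
     8 * \<eta> * L / q \<le> \<tau> / \<alpha> \<and>
     L * \<gamma> \<le> 1 / (4 * \<eta>) \<and>
     \<beta> / (2 * \<eta>) \<le> \<mu> / 4 \<and>
     1 / \<gamma> - (1 - \<alpha> - \<tau>) / \<alpha> - 1 / 2 \<le> 0 \<and>
     (1 - \<alpha> - \<tau>) / \<alpha> \<le> 1 / \<gamma> - 1 / 4"


section \<open>The OGT iteration and its Lyapunov function\<close>

locale ogt =
  fixes f :: "'n::finite \<Rightarrow> real^'d \<Rightarrow> real"
    and gradf :: "'n \<Rightarrow> real^'d \<Rightarrow> real^'d"
    and W :: "real^'n^'n"
    and L \<theta> :: real
    and xs :: "real^'d"
    and X0 :: "real^'d^'n"
    and \<alpha> \<beta> \<gamma> \<tau> p q \<eta> :: real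
    and M :: "'w measure"
    and \<xi> \<zeta> :: "nat \<Rightarrow> 'w \<Rightarrow> real"
begin

definition gradF :: "real^'d^'n \<Rightarrow> real^'d^'n" where
  "gradF A = (\<chi> i. gradf i (A $ i))"

text \<open>
  \<open>Zt\<close>, \<open>Ut\<close>, \<open>Gt\<close> are the iterates with \<open>2n\<close> rows; the argument \<open>\<omega>\<close> is a point of the sample space.
\<close>

function (sequential)
      X :: "nat \<Rightarrow> 'w \<Rightarrow> real^'d^'n"
  and Y :: "nat \<Rightarrow> 'w \<Rightarrow> real^'d^'n"
  and Q :: "nat \<Rightarrow> 'w \<Rightarrow> real^'d^'n"
  and Zt :: "nat \<Rightarrow> 'w \<Rightarrow> real^'d^('n + 'n)"
  and Ut :: "nat \<Rightarrow> 'w \<Rightarrow> real^'d^('n + 'n)"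
  and Gt :: "nat \<Rightarrow> 'w \<Rightarrow> real^'d^('n + 'n)"
where
  "X k \<omega> = (1 - \<alpha> - \<tau>) *\<^sub>R Y k \<omega> + \<alpha> *\<^sub>R upper (Zt k \<omega>) + \<tau> *\<^sub>R upper (Ut k \<omega>)"
| "Y 0 \<omega> = X0"
| "Y (Suc k) \<omega> = X k \<omega> + \<gamma> *\<^sub>R (upper (Zt (Suc k) \<omega>) - upper (Zt k \<omega>))"
| "Q 0 \<omega> = X0"
| "Q (Suc k) \<omega> = (1 - \<xi> k \<omega>) *\<^sub>R Q k \<omega> + \<xi> k \<omega> *\<^sub>R X k \<omega>"
| "Zt 0 \<omega> = stack2 X0"
| "Zt (Suc k) \<omega> = (1 / (1 + \<beta>)) *\<^sub>R (W_tilde \<theta> W **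
     (Zt k \<omega> + \<beta> *\<^sub>R stack2 (X k \<omega>) - \<eta> *\<^sub>R stack2 (upper (Gt k \<omega>))
      + (\<eta> * \<zeta> k \<omega>) *\<^sub>R (stack2 (gradF (Q k \<omega>)) - stack2 (gradF (X k \<omega>)))))"
| "Ut 0 \<omega> = stack2 X0"
| "Ut (Suc k) \<omega> = W_tilde \<theta> W ** ((1 - \<xi> k \<omega>) *\<^sub>R Ut k \<omega> + \<xi> k \<omega> *\<^sub>R stack2 (X k \<omega>))"
| "Gt 0 \<omega> = stack2 (gradF X0)"
| "Gt (Suc k) \<omega> = W_tilde \<theta> W ** Gt k \<omega>
     + \<xi> k \<omega> *\<^sub>R (stack2 (gradF (X k \<omega>)) - stack2 (gradF (Q k \<omega>)))"
  by pat_completeness auto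
termination
  by (relation "Wellfounded.measure (\<lambda>s. case s of
        Inl (Inl (k, _)) \<Rightarrow> 3 * k + 2
      | Inl (Inr (Inl (k, _))) \<Rightarrow> 3 * k + 1
      | Inl (Inr (Inr (k, _))) \<Rightarrow> 3 * k
      | Inr (Inl (k, _)) \<Rightarrow> 3 * k
      | Inr (Inr (Inl (k, _))) \<Rightarrow> 3 * k
      | Inr (Inr (Inr (k, _))) \<Rightarrow> 3 * k)") auto

definition Z :: "nat \<Rightarrow> 'w \<Rightarrow> real^'d^'n" where
  "Z k \<omega> = upper (Zt k \<omega>)"

definition U :: "nat \<Rightarrow> 'w \<Rightarrow> real^'d^'n" where
  "U k \<omega> = upper (Ut k \<omega>)"

definition consensus_err :: "real^'d^'n \<Rightarrow> real" where
  "consensus_err A = (norm (proj_matrix ** A))\<^sup>2"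

definition D :: "nat \<Rightarrow> real" where
  "D k = (\<integral>\<omega>. (norm (gradF (X k \<omega>) - gradF (Q k \<omega>)))\<^sup>2 \<partial>M)"

definition PX :: "nat \<Rightarrow> real" where
  "PX k = (\<integral>\<omega>. consensus_err (X k \<omega>) \<partial>M)"

text \<open>
  In the next three definitions, the upper blocks of the initial matrices \<open>Gt 0\<close>, \<open>Ut 0\<close>, \<open>Zt 0\<close>
  are deterministic: they are \<open>gradF X0\<close>, \<open>X0\<close> and \<open>X0\<close>.
\<close>

definition C_G :: "nat \<Rightarrow> real" where
  "C_G k = (\<Sum>i<k. 2 * c5 * p * (1 - theta_w \<theta>) ^ (k - 1 - i) * D i)
           + c5 * (1 - theta_w \<theta>) ^ k * consensus_err (gradF X0)"

definition C_U :: "nat \<Rightarrow> real" where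
  "C_U k = c5 * p * (\<Sum>i<k. (1 - theta_w \<theta>) ^ (2 * (k - i)) * PX i)
           + c5 * (1 - theta_w \<theta>) ^ (2 * k) * consensus_err X0"

definition C_Z :: "nat \<Rightarrow> real" where
  "C_Z k = (\<Sum>i<k. (1 - theta_w \<theta>) ^ (k - i) *
              (4 * c5 * \<beta>\<^sup>2 / theta_w \<theta> * PX i + 4 * c5 * \<eta>\<^sup>2 / theta_w \<theta> * C_G i))
           + c5 * (\<Sum>i<k. (1 - theta_w \<theta>) ^ (k - i) * (\<eta>\<^sup>2 / q + 2 * \<eta>\<^sup>2 / theta_w \<theta>) * D i)
           + c5 * (1 - theta_w \<theta>) ^ k * consensus_err X0"

definition Phi_C :: "nat \<Rightarrow> real" where
  "Phi_C k = 8 / \<tau> *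
     ((\<integral>\<omega>. \<tau> / (4 * p) * consensus_err (Q k \<omega>)
            + 4 * (1 - \<tau>) / (4 - \<tau>) * consensus_err (Y k \<omega>) \<partial>M)
      + 16 / theta_w \<theta> * C_U k
      + (1 - theta_w \<theta> / 6) * (48 * (1 - \<tau>) * \<gamma>\<^sup>2 / (\<tau> * theta_w \<theta>)) * C_Z k
      + 1 / (theta_w \<theta> * L\<^sup>2) * C_G k)"

definition Phi_U :: "nat \<Rightarrow> 'w \<Rightarrow> real" where
  "Phi_U k \<omega> = (2 * \<tau> + \<alpha>) / (2 * \<alpha> * p) *
     (obj_avg f (row_avg (U k \<omega>)) - obj_avg f xs)"

definition Phi :: "nat \<Rightarrow> real" where
  "Phi k = (\<integral>\<omega>. 1 / \<gamma> * (obj_avg f (row_avg (Y k \<omega>)) - obj_avg f xs)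
                 + Phi_U k \<omega>
                 + (1 + \<beta>) / (2 * \<eta>) * (norm (row_avg (Z k \<omega>) - xs))\<^sup>2
                 + c4 CARD('n) L \<alpha> \<gamma> \<tau> q \<eta> * Phi_C k \<partial>M)"

end


section \<open>Complexities\<close>

text \<open>
  Costs of the first \<open>K\<close> iterations, per agent. The initialization needs one local gradient, at the
  agent's row of \<open>X0\<close>, and iteration \<open>k\<close> needs one more iff \<open>\<xi> k\<close> or \<open>\<zeta> k\<close> is nonzero. Each
  iteration is one communication round.
\<close>

definition expected_gradients ::
  "'w measure \<Rightarrow> (nat \<Rightarrow> 'w \<Rightarrow> real) \<Rightarrow> (nat \<Rightarrow> 'w \<Rightarrow> real) \<Rightarrow> nat \<Rightarrow> real" where
  "expected_gradients M \<xi> \<zeta> K =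
     (\<integral>\<omega>. real (1 + card {k. k < K \<and> (\<xi> k \<omega> \<noteq> 0 \<or> \<zeta> k \<omega> \<noteq> 0)}) \<partial>M)"

definition communication_rounds :: "nat \<Rightarrow> real" where
  "communication_rounds K = real K"

text \<open>
  Absolute constant hidden in the \<open>O\<close> notation. It is a numeral because an existential quantifier
  inside a theorem could not range in front of the index types \<open>'n\<close> and \<open>'d\<close>, so that the constant
  would be allowed to depend on the number of agents and on the dimension.
\<close>

definition O_const :: real where
  "O_const = 10 ^ 8"

end

theory Submission
  imports Defs
begin

text \<open>
  Linear convergence comes from one potential, a sum of an optimization part and a consensus part,
  whose expectation contracts in a single iteration.

  \<^bold>\<open>The averages.\<close> Since every block that enters the recursion is stacked, the two blocks of each
  doubled iterate keep the same row average, and \<open>W_tilde\<close> preserves it. The averages therefore follow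
  a loopless Katyusha-type accelerated method: \<open>row_avg (upper Gt)\<close> is the average gradient at \<open>Q\<close>, and
  the step direction of \<open>Z\<close> is an unbiased estimate of the average \<open>h\<close> of the local gradients at the rows
  of \<open>X\<close>. The pair (linearized value, \<open>h\<close>) acts as an inexact first-order oracle of the averaged
  objective at \<open>row_avg X\<close>, with an error of size \<open>L / (2 n)\<close> times the consensus error of \<open>X\<close>
  (lemmas \<open>obj_avg_lower\<close>, \<open>obj_avg_upper\<close>, \<open>obj_avg_cocoercive\<close>). The usual accelerated analysis
  (\<open>expected_accelerated_step\<close>) contracts the optimization part up to multiples of the consensus errors
  of \<open>X\<close> and \<open>Q\<close>; cocoercivity supplies a negative multiple of the gradient gap
  \<open>|gradF X - gradF Q|^2\<close>, which pays for the variance of the estimate and for what the gap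
  contributes to the consensus part.

  \<^bold>\<open>Consensus.\<close> On the mean-zero part, \<open>W_tilde\<close> is the companion matrix of the Chebyshev-type recursion
  \<open>x' = (1 + \<eta>) B x - \<eta> y\<close> with \<open>B = W - avg_matrix\<close>. Its powers decay like
  \<open>(1 - theta_w)^k\<close>, but only up to a factor in the Euclidean norm. The remedy is a quadratic form that
  \<open>W_tilde\<close> scales exactly by \<open>(1 - theta_w)^2\<close>, that dominates the consensus error of the upper
  block, and that on stacked matrices is at most \<open>c5 = 14\<close> times the consensus error
  (\<open>exists_consensus_form\<close>). It is the energy of a damped discrete oscillator, weighted with
  \<open>(I - B)^{-1}\<close>; this weight makes the comparison constant uniform in the spectral gap. Measured in
  this form, the iterates \<open>Gt\<close>, \<open>Ut\<close>, \<open>Zt\<close> satisfy one-step inequalities whose solutions are exactly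
  \<open>C_G\<close>, \<open>C_U\<close>, \<open>C_Z\<close>, and \<open>Phi_C_Suc_le\<close> combines these into a contraction of \<open>Phi_C\<close> that even leaves
  multiples of the consensus errors of \<open>X\<close> and \<open>Q\<close> to spare. The coefficient \<open>c4\<close> balances the two parts.

  \<^bold>\<open>Expectations.\<close> The noise takes four values per iteration, so each state takes finitely many values
  almost surely. All integrability questions disappear, and independence turns the expectation of
  a function of the next state into that of a four-point average over the present one
  (\<open>expectation_Suc\<close>). Every probabilistic step is thus reduced to a deterministic inequality.
\<close>

section \<open>An energy of the Chebyshev recursion\<close>

text \<open>
  With \<open>y = v - B v\<close> and \<open>z = w - B w\<close>, the right-hand side is the energy
  of the state \<open>(y, z)\<close> weighted by \<open>(I - B)^{-1}\<close>. Completing the square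
  in \<open>w\<close> leaves a quadratic form in \<open>v\<close> alone. For an eigenvalue
  \<open>\<lambda>\<close> of \<open>B\<close>, and with \<open>k1 = 1 / (4 (1 + s))\<close> and
  \<open>K = (1 + \<eta>)^2 / (4 \<eta>) = (3 + s)/4 + k1\<close>, the claim for it is
  \<open>(1 - \<lambda>) (1 - K \<lambda>^2) - (3 + s)/4 (1 - \<lambda>)^2 = (3 + s)/4 \<lambda> (1 - \<lambda>)^2 + k1 (1 - \<lambda>) (m^2 - \<lambda>^2) \<ge> 0\<close>,
  which holds because \<open>0 \<le> \<lambda> \<le> m < 1\<close>. The proof writes this polynomial
  as a combination of manifestly nonnegative forms in \<open>B\<close>, which avoids an eigenbasis.
\<close>
lemma chebyshev_energy_lower_bound:
  fixes B :: "'a::euclidean_space \<Rightarrow> 'a"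
  assumes B: "linear B"
    and adj: "\<And>x y. B x \<bullet> y = x \<bullet> B y"
    and psd: "\<And>x. 0 \<le> x \<bullet> B x"
    and contr: "\<And>x. norm (B x) \<le> m * norm x"
    and m: "0 \<le> m" "m < 1"
    and s: "s = sqrt (1 - m\<^sup>2)" and \<eta>: "\<eta> = 1 / (1 + s)"
  shows "(3 + s) / 4 * (norm (v - B v))\<^sup>2 \<le>
     (v - B v) \<bullet> v - (1 + \<eta>) * ((v - B v) \<bullet> B w) + \<eta> * ((w - B w) \<bullet> w)"
proof -
  have m1: "m\<^sup>2 < 1" using m by (simp add: abs_square_less_1)
  have s0: "0 < s" and s2: "s\<^sup>2 = 1 - m\<^sup>2" using s m1 by auto
  have \<eta>0: "0 < \<eta>" using \<eta> s0 by simp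
  define K where "K = (1 + \<eta>)\<^sup>2 / (4 * \<eta>)"
  define k1 where "k1 = 1 / (4 * (1 + s))"
  define k where "k = (1 + \<eta>) / (2 * \<eta>)"
  have sub: "B (x - y) = B x - B y" for x y using B by (rule linear_diff)
  have scl: "B (t *\<^sub>R x) = t *\<^sub>R B x" for t x using B by (rule linear_scale)
  have Imp: "0 \<le> (x - B x) \<bullet> x" for x
  proof -
    have "x \<bullet> B x \<le> norm x * norm (B x)" by (rule norm_cauchy_schwarz)
    also have "\<dots> \<le> norm x * (m * norm x)" by (intro mult_left_mono contr) auto
    also have "\<dots> \<le> norm x * norm x" using m by (intro mult_left_mono) (auto intro: mult_left_le_one_le)
    finally show ?thesis by (simp add: inner_diff_left adj dot_square_norm power2_eq_square)
  qed
  define a b c d where "a = v \<bullet> v" and "b = v \<bullet> B v" and "c = B v \<bullet> B v" and "d = B v \<bullet> B (B v)"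
  have K: "K = (3 + s) / 4 + k1"
  proof -
    have e: "1 + \<eta> = (2 + s) * \<eta>" unfolding \<eta> using s0 by (simp add: field_simps)
    have "K = (2 + s)\<^sup>2 * \<eta> / 4"
      unfolding K_def e power_mult_distrib using \<eta>0 by (simp add: power2_eq_square)
    also have "\<dots> = (3 + s) / 4 + k1"
      unfolding k1_def \<eta> using s0 by (simp add: divide_simps) (simp add: algebra_simps power2_eq_square)
    finally show ?thesis .
  qed
  have k1m: "k1 * m\<^sup>2 = (1 - s) / 4"
  proof -
    have "m\<^sup>2 = (1 - s) * (1 + s)" using s2 by (simp add: algebra_simps power2_eq_square)
    then show ?thesis unfolding k1_def using s0 by (simp add: field_simps)
  qed
  have sq: "0 \<le> (w - k *\<^sub>R B v - B (w - k *\<^sub>R B v)) \<bullet> (w - k *\<^sub>R B v)" by (rule Imp)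
  have sym: "w \<bullet> B v = v \<bullet> B w" "w \<bullet> B (B v) = v \<bullet> B (B w)"
    by (metis adj inner_commute)+
  have "(w - k *\<^sub>R B v - B (w - k *\<^sub>R B v)) \<bullet> (w - k *\<^sub>R B v)
     = (w - B w) \<bullet> w - 2 * k * ((v - B v) \<bullet> B w) + k\<^sup>2 * (c - d)"
    unfolding c_def d_def sub scl
    by (simp add: inner_diff_left inner_diff_right adj sym power2_eq_square algebra_simps)
  with sq have "0 \<le> \<eta> * ((w - B w) \<bullet> w - 2 * k * ((v - B v) \<bullet> B w) + k\<^sup>2 * (c - d))"
    using \<eta>0 by simp
  also have "\<dots> = \<eta> * ((w - B w) \<bullet> w) - (1 + \<eta>) * ((v - B v) \<bullet> B w) + K * (c - d)"
    unfolding k_def K_def using \<eta>0 by (simp add: field_simps power2_eq_square)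
  finally have 1: "- (K * (c - d)) \<le> \<eta> * ((w - B w) \<bullet> w) - (1 + \<eta>) * ((v - B v) \<bullet> B w)" by simp
  \<comment> \<open>operator form of \<open>\<lambda> (1 - \<lambda>)^2 \<ge> 0\<close>\<close>
  have 2: "0 \<le> b - 2 * c + d"
    using psd[of "v - B v"] unfolding b_def c_def d_def sub
    by (simp add: inner_diff_left inner_diff_right adj algebra_simps)
  \<comment> \<open>operator form of \<open>(m - \<lambda>)^2 (m + \<lambda>) \<ge> 0\<close>; with \<open>m^2 - \<lambda>^2 \<ge> 0\<close> it gives \<open>(1 - \<lambda>) (m^2 - \<lambda>^2) \<ge> 0\<close>, as
    \<open>1 - \<lambda> = (1 - m) + (m - \<lambda>)\<close>\<close>
  have "0 \<le> m * ((m *\<^sub>R v - B v) \<bullet> (m *\<^sub>R v - B v)) + (m *\<^sub>R v - B v) \<bullet> B (m *\<^sub>R v - B v)"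
    using psd m by simp
  then have 3: "0 \<le> m^3 * a - m\<^sup>2 * b - m * c + d"
    unfolding a_def b_def c_def d_def sub scl
    by (simp add: inner_diff_left inner_diff_right adj algebra_simps power2_eq_square power3_eq_cube)
  have 4: "0 \<le> m\<^sup>2 * a - c"
    using power_mono[OF contr[of v], of 2] unfolding a_def c_def
    by (simp add: power_mult_distrib dot_square_norm)
  have 5: "0 \<le> m\<^sup>2 * (a - b) - (c - d)"
  proof -
    have "m\<^sup>2 * (a - b) - (c - d) = (1 - m) * (m\<^sup>2 * a - c) + (m^3 * a - m\<^sup>2 * b - m * c + d)"
      by (simp add: algebra_simps power2_eq_square power3_eq_cube)
    moreover have "0 \<le> (1 - m) * (m\<^sup>2 * a - c)" using 4 m by simp
    ultimately show ?thesis using 3 by linarith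
  qed
  have n: "(norm (v - B v))\<^sup>2 = a - 2 * b + c"
    unfolding a_def b_def c_def
    by (simp add: dot_square_norm[symmetric] inner_diff_left inner_diff_right adj)
  have i: "(v - B v) \<bullet> v = a - b" unfolding a_def b_def by (simp add: inner_diff_left adj)
  define h where "h = (3 + s) / 4"
  have k1h: "k1 * m\<^sup>2 = 1 - h" unfolding k1m h_def by (simp add: field_simps)
  have "k1 * (m\<^sup>2 * (a - b) - (c - d)) = (1 - h) * (a - b) - k1 * (c - d)"
    unfolding k1h[symmetric] by (simp add: algebra_simps)
  then have "(a - b) - K * (c - d) - h * (a - 2 * b + c) =
      h * (b - 2 * c + d) + k1 * (m\<^sup>2 * (a - b) - (c - d))"
    unfolding K h_def[symmetric] by (simp only: ring_distribs)
  moreover have "0 \<le> h * (b - 2 * c + d) + k1 * (m\<^sup>2 * (a - b) - (c - d))"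
    by (intro add_nonneg_nonneg mult_nonneg_nonneg 2 5) (use s0 in \<open>auto simp: k1_def h_def\<close>)
  ultimately show ?thesis using 1 unfolding n i h_def[symmetric] by linarith
qed

text \<open>
  The recursion \<open>x' = (1 + \<eta>) B x - \<eta> y\<close> is a damped oscillator. Its energy
  \<open>|x|^2 - (1 + \<eta>) \<langle>x, B y\<rangle> + \<eta> |y|^2\<close> is multiplied by
  exactly \<open>\<eta>\<close> in each step, and so is every version of it weighted by a function
  of \<open>B\<close>. The weight \<open>R = (I - B)^{-1}\<close> turns the energy of a stacked
  state into \<open>(1 + \<eta>) |a|^2\<close>, while the energy still dominates
  \<open>|x|^2\<close>; after normalization the comparison constant is
  \<open>4 (2 + s) / ((1 + s) (3 + s)) \<le> 8/3\<close>, uniformly in the spectral gap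
  \<open>1 - m\<close>.
\<close>
lemma exists_chebyshev_form:
  fixes B :: "'a::euclidean_space \<Rightarrow> 'a"
  assumes B: "linear B"
    and adj: "\<And>x y. B x \<bullet> y = x \<bullet> B y"
    and psd: "\<And>x. 0 \<le> x \<bullet> B x"
    and contr: "\<And>x. norm (B x) \<le> m * norm x"
    and m: "0 \<le> m" "m < 1"
    and s: "s = sqrt (1 - m\<^sup>2)" and \<eta>: "\<eta> = 1 / (1 + s)"
  obtains Q :: "'a \<times> 'a \<Rightarrow> 'a \<times> 'a \<Rightarrow> real"
  where "bilinear Q" "\<And>u v. Q u v = Q v u"
    "\<And>u. (norm (fst u))\<^sup>2 \<le> Q u u"
    "\<And>a. Q (a, a) (a, a) \<le> 14 * (norm a)\<^sup>2"
    "\<And>u. Q ((1 + \<eta>) *\<^sub>R B (fst u) - \<eta> *\<^sub>R snd u, fst u)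
            ((1 + \<eta>) *\<^sub>R B (fst u) - \<eta> *\<^sub>R snd u, fst u) = \<eta> * Q u u"
proof -
  have m1: "m\<^sup>2 < 1" using m by (simp add: abs_square_less_1)
  have s0: "0 < s" using s m1 by auto
  have \<eta>0: "0 < \<eta>" "\<eta> \<le> 1" using \<eta> s0 by auto
  have sub: "B (x - y) = B x - B y" for x y using B by (rule linear_diff)
  have add: "B (x + y) = B x + B y" for x y using B by (rule linear_add)
  have scl: "B (t *\<^sub>R x) = t *\<^sub>R B x" for t x using B by (rule linear_scale)
  have lin: "linear (\<lambda>x. x - B x)" using B by (intro linear_compose_sub) (auto simp: linear_iff)
  have inj: "inj (\<lambda>x. x - B x)"
  proof (subst linear_injective_0[OF lin], safe)
    fix x assume "x - B x = 0"
    then have "norm x \<le> m * norm x" using contr[of x] by simp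
    then have "(1 - m) * norm x \<le> 0" by (simp add: algebra_simps)
    then show "x = 0" using m by (simp add: mult_le_0_iff)
  qed
  obtain R where R: "linear R" "\<And>x. R (x - B x) = x" "\<And>x. R x - B (R x) = x"
    using linear_injective_isomorphism[OF lin inj] by metis
  have Radd: "R (x + y) = R x + R y" for x y using R(1) by (rule linear_add)
  have Rscl: "R (t *\<^sub>R x) = t *\<^sub>R R x" for t x using R(1) by (rule linear_scale)
  have RB: "R (B x) = B (R x)" for x
  proof -
    have "R (B x) = R (B (R x - B (R x)))" using R(3)[of x] by simp
    also have "\<dots> = R (B (R x) - B (B (R x)))" by (simp add: sub)
    also have "\<dots> = B (R x)" by (rule R(2))
    finally show ?thesis .
  qed
  have Radj: "R x \<bullet> y = x \<bullet> R y" for x y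
  proof -
    have "R x \<bullet> y = R x \<bullet> (R y - B (R y))" using R(3)[of y] by simp
    also have "\<dots> = (R x - B (R x)) \<bullet> R y" by (simp add: inner_diff_left inner_diff_right adj)
    finally show ?thesis using R(3)[of x] by simp
  qed
  define c where "c = (3 + s) / 4"
  have c0: "0 < c" using s0 unfolding c_def by simp
  define P where "P = (\<lambda>u v. fst u \<bullet> R (fst v)
     - (1 + \<eta>) / 2 * (fst u \<bullet> B (R (snd v)) + snd u \<bullet> B (R (fst v))) + \<eta> * (snd u \<bullet> R (snd v)))"
  define Q where "Q = (\<lambda>u v. P u v / c)"
  show ?thesis
  proof
    have "P (u + u') v = P u v + P u' v" "P v (u + u') = P v u + P v u'" for u u' v
      unfolding P_def by (simp_all add: Radd add inner_add_left inner_add_right ring_distribs)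
    moreover have "P (t *\<^sub>R u) v = t * P u v" "P v (t *\<^sub>R u) = t * P v u" for t u v
      unfolding P_def by (simp_all add: Rscl scl algebra_simps)
    ultimately show "bilinear Q"
      unfolding bilinear_def linear_iff Q_def by (simp add: add_divide_distrib)
    have "P u v = P v u" for u v
      unfolding P_def
      by (simp add: inner_commute[of "fst v"] inner_commute[of "snd v"] Radj adj RB[symmetric] algebra_simps)
    then show "Q u v = Q v u" for u v unfolding Q_def by simp
    have flip: "fst u \<bullet> B (R (snd u)) = snd u \<bullet> B (R (fst u))" for u :: "'a \<times> 'a"
      by (metis RB Radj adj inner_commute)
    have diag: "P u u = fst u \<bullet> R (fst u) - (1 + \<eta>) * (fst u \<bullet> B (R (snd u))) + \<eta> * (snd u \<bullet> R (snd u))" for u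
      unfolding P_def flip[of u, symmetric] by simp
    show "(norm (fst u))\<^sup>2 \<le> Q u u" for u
    proof -
      let ?v = "R (fst u)" and ?w = "R (snd u)"
      have "c * (norm (?v - B ?v))\<^sup>2 \<le> (?v - B ?v) \<bullet> ?v - (1 + \<eta>) * ((?v - B ?v) \<bullet> B ?w) + \<eta> * ((?w - B ?w) \<bullet> ?w)"
        unfolding c_def by (rule chebyshev_energy_lower_bound[OF B adj psd contr m s \<eta>])
      then have "c * (norm (fst u))\<^sup>2 \<le> P u u"
        unfolding diag R(3) .
      then show ?thesis unfolding Q_def using c0 by (simp add: field_simps)
    qed
    show "Q (a, a) (a, a) \<le> 14 * (norm a)\<^sup>2" for a
    proof -
      have "P (a, a) (a, a) = (1 + \<eta>) * (a \<bullet> (R a - B (R a)))"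
        unfolding diag by (simp add: inner_diff_right algebra_simps)
      also have "\<dots> = (1 + \<eta>) * (norm a)\<^sup>2" unfolding R(3) by (simp add: dot_square_norm)
      also have "\<dots> \<le> 14 * c * (norm a)\<^sup>2"
        using \<eta>0 s0 unfolding c_def by (intro mult_right_mono) auto
      finally show ?thesis unfolding Q_def using c0 by (simp add: field_simps)
    qed
    show "Q ((1 + \<eta>) *\<^sub>R B (fst u) - \<eta> *\<^sub>R snd u, fst u)
            ((1 + \<eta>) *\<^sub>R B (fst u) - \<eta> *\<^sub>R snd u, fst u) = \<eta> * Q u u" for u
    proof -
      obtain x y where u: "u = (x, y)" by (cases u)
      define z where "z = (1 + \<eta>) *\<^sub>R B x - \<eta> *\<^sub>R y"
      have "P (z, x) (z, x) = z \<bullet> (R z - (1 + \<eta>) *\<^sub>R B (R x)) + \<eta> * (x \<bullet> R x)"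
        unfolding diag by (simp add: inner_diff_right)
      also have "R z - (1 + \<eta>) *\<^sub>R B (R x) = - \<eta> *\<^sub>R R y"
        unfolding z_def by (simp add: linear_diff[OF R(1)] Rscl RB)
      also have "z \<bullet> (- \<eta> *\<^sub>R R y) = \<eta> * (- (1 + \<eta>) * (x \<bullet> B (R y)) + \<eta> * (y \<bullet> R y))"
        unfolding z_def by (simp add: inner_diff_left adj algebra_simps)
      finally have "P (z, x) (z, x) = \<eta> * P u u"
        unfolding u diag by (simp add: algebra_simps)
      then have "P ((1 + \<eta>) *\<^sub>R B (fst u) - \<eta> *\<^sub>R snd u, fst u)
            ((1 + \<eta>) *\<^sub>R B (fst u) - \<eta> *\<^sub>R snd u, fst u) = \<eta> * P u u"
        unfolding z_def u by simp
      then show ?thesis unfolding Q_def by simp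
    qed
  qed
qed

section \<open>Gossip matrices\<close>

lemma bilinear_compose_linear:
  assumes Q: "bilinear Q" and P: "linear P"
  shows "bilinear (\<lambda>s t. Q (P s) (P t))"
  unfolding bilinear_def
proof (intro conjI allI)
  show "linear (\<lambda>t. Q (P s) (P t))" for s
    using linear_compose[OF P, of "Q (P s)"] Q unfolding bilinear_def by (simp add: o_def)
  show "linear (\<lambda>s. Q (P s) (P t))" for t
    using linear_compose[OF P, of "\<lambda>s. Q s (P t)"] Q unfolding bilinear_def by (simp add: o_def)
qed

definition lower :: "real^'d^('n + 'n) \<Rightarrow> real^'d^'n" where
  "lower A = (\<chi> a. A $ Inr a)"

lemma matrix_mult_row: "((W :: real^'n^'m) ** (A :: real^'d^'n)) $ i = (\<Sum>j\<in>UNIV. W $ i $ j *\<^sub>R A $ j)"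
  by (simp add: matrix_matrix_mult_def vec_eq_iff)

lemma inner_matrix_mult_left:
  "((W :: real^'n^'m) ** (A :: real^'d^'n)) \<bullet> C = A \<bullet> (transpose W ** C)"
proof -
  have "(W ** A) \<bullet> C = (\<Sum>i\<in>UNIV. \<Sum>j\<in>UNIV. W $ i $ j * (A $ j \<bullet> C $ i))"
    by (simp add: inner_vec_def[of "W ** A"] matrix_mult_row inner_sum_left)
  also have "\<dots> = (\<Sum>j\<in>UNIV. \<Sum>i\<in>UNIV. W $ i $ j * (A $ j \<bullet> C $ i))" by (rule sum.swap)
  also have "\<dots> = A \<bullet> (transpose W ** C)"
    by (simp add: inner_vec_def[of A] matrix_mult_row inner_sum_right transpose_def)
  finally show ?thesis .
qed

lemma inner_eq_sum_columns: "(A :: real^'d^'n) \<bullet> C = (\<Sum>j\<in>UNIV. column j A \<bullet> column j C)"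
  by (simp add: inner_vec_def column_def) (rule sum.swap)

lemma column_matrix_mult: "column j ((W :: real^'n^'m) ** (A :: real^'d^'n)) = W *v column j A"
  by (simp add: column_def matrix_matrix_mult_def matrix_vector_mult_def vec_eq_iff)

lemma norm_matrix_mult_le: "norm ((W :: real^'n^'m) ** (A :: real^'d^'n)) \<le> onorm ((*v) W) * norm A"
proof (rule power2_le_imp_le)
  have "(norm (W ** A))\<^sup>2 = (\<Sum>j\<in>UNIV. (norm (W *v column j A))\<^sup>2)"
    by (simp add: dot_square_norm[symmetric] inner_eq_sum_columns column_matrix_mult)
  also have "\<dots> \<le> (\<Sum>j\<in>UNIV. (onorm ((*v) W) * norm (column j A))\<^sup>2)"
    by (intro sum_mono power_mono onorm matrix_vector_mul_bounded_linear) auto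
  also have "\<dots> = (onorm ((*v) W) * norm A)\<^sup>2"
    by (simp add: power_mult_distrib sum_distrib_left[symmetric])
       (simp add: dot_square_norm[symmetric] inner_eq_sum_columns)
  finally show "(norm (W ** A))\<^sup>2 \<le> (onorm ((*v) W) * norm A)\<^sup>2" .
  show "0 \<le> onorm ((*v) W) * norm A"
    by (intro mult_nonneg_nonneg onorm_pos_le matrix_vector_mul_bounded_linear) auto
qed

lemma proj_matrix_mult_row: "(proj_matrix ** (A :: real^'d^'n::finite)) $ i = A $ i - row_avg A"
proof -
  have "(proj_matrix ** A) $ i = (\<Sum>j\<in>UNIV. (if i = j then A $ j else 0) - (1 / real CARD('n)) *\<^sub>R A $ j)"
    unfolding matrix_mult_row proj_matrix_def avg_matrix_def
    by (intro sum.cong) (auto simp: mat_def scaleR_diff_left)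
  also have "\<dots> = A $ i - row_avg A"
    by (simp add: sum_subtractf row_avg_def scaleR_sum_right)
  finally show ?thesis .
qed

lemma avg_matrix_mult_row: "(avg_matrix ** (A :: real^'d^'n::finite)) $ i = row_avg A"
  unfolding matrix_mult_row row_avg_def avg_matrix_def by (simp add: scaleR_sum_right)

lemma proj_matrix_mult: "proj_matrix ** (A :: real^'d^'n::finite) = A - avg_matrix ** A"
  by (simp add: vec_eq_iff[of "proj_matrix ** A"] proj_matrix_mult_row avg_matrix_mult_row)

lemma linear_row_avg: "linear (row_avg :: real^'d^'n::finite \<Rightarrow> real^'d)"
  unfolding row_avg_def by (intro linearI) (simp_all add: sum.distrib scaleR_add_right scaleR_sum_right mult.commute)

lemma row_avg_const: "row_avg (\<chi> i::'n::finite. c) = (c :: real^'d)"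
  by (simp add: row_avg_def sum_constant_scaleR del: sum_constant)

lemma row_avg_proj [simp]: "row_avg (proj_matrix ** (A :: real^'d^'n::finite)) = 0"
proof -
  have "row_avg (proj_matrix ** A) = row_avg (A - (\<chi> i. row_avg A))"
    by (rule arg_cong[where f = row_avg]) (simp add: vec_eq_iff[of "proj_matrix ** A"] proj_matrix_mult_row)
  then show ?thesis by (simp add: linear_diff[OF linear_row_avg] row_avg_const)
qed

lemma linear_matrix_mult: "linear (\<lambda>A :: real^'d^'n. (W :: real^'n^'m) ** A)"
  by (intro linearI) (simp_all add: matrix_matrix_mult_def vec_eq_iff sum.distrib algebra_simps sum_distrib_left)

lemma transpose_proj_matrix [simp]: "transpose (proj_matrix :: real^'n^'n::finite) = proj_matrix"
  by (simp add: transpose_def proj_matrix_def avg_matrix_def mat_def vec_eq_iff)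

lemma sum_indicator_scaleR: "(\<Sum>j\<in>UNIV. (c * (if (a::'n::finite) = j then 1 else 0)) *\<^sub>R g j) = c *\<^sub>R (g a :: 'b::real_vector)"
proof -
  have "(c * (if a = j then 1 else 0)) *\<^sub>R g j = (if a = j then c *\<^sub>R g j else 0)" for j by auto
  then show ?thesis by simp
qed

lemma sum_UNIV_sum_type:
  "(\<Sum>j\<in>(UNIV::('a::finite + 'b::finite) set). g j) = (\<Sum>j\<in>UNIV. g (Inl j)) + (\<Sum>j\<in>UNIV. g (Inr j))"
  unfolding UNIV_Plus_UNIV[symmetric] by (subst sum.Plus) auto

lemma W_tilde_upper:
  "upper (W_tilde \<theta> W ** (S :: real^'d^('n + 'n::finite))) = (1 + eta_w \<theta>) *\<^sub>R (W ** upper S) - eta_w \<theta> *\<^sub>R lower S"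
proof -
  have "upper (W_tilde \<theta> W ** S) $ a = ((1 + eta_w \<theta>) *\<^sub>R (W ** upper S) - eta_w \<theta> *\<^sub>R lower S) $ a" for a
    using sum_indicator_scaleR[of "- eta_w \<theta>" a "\<lambda>j. S $ Inr j"]
    by (simp add: upper_def lower_def matrix_mult_row sum_UNIV_sum_type W_tilde_def block_matrix_def mat_def scaleR_sum_right)
  then show ?thesis by (simp add: vec_eq_iff[of "upper _"])
qed

lemma W_tilde_lower: "lower (W_tilde \<theta> W ** (S :: real^'d^('n + 'n::finite))) = upper S"
proof -
  have "lower (W_tilde \<theta> W ** S) $ a = upper S $ a" for a
    using sum_indicator_scaleR[of 1 a "\<lambda>j. S $ Inl j"]
    by (simp add: upper_def lower_def matrix_mult_row sum_UNIV_sum_type W_tilde_def block_matrix_def mat_def)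
  then show ?thesis by (simp add: vec_eq_iff[of "lower _"])
qed

lemma upper_stack2 [simp]: "upper (stack2 A) = A" and lower_stack2 [simp]: "lower (stack2 A) = A"
  by (simp_all add: upper_def lower_def stack2_def vec_eq_iff)

lemma linear_upper: "linear upper" and linear_lower: "linear lower" and linear_stack2: "linear stack2"
  by (auto intro!: linearI simp: upper_def lower_def stack2_def vec_eq_iff split: sum.splits)

context
  fixes Edges and W :: "real^'n^'n::finite" and \<theta>
  assumes W: "gossip_matrix Edges W \<theta>"
begin

lemma gossip_row_avg: "row_avg (W ** (A :: real^'d^'n)) = row_avg A"
proof -
  have one: "(\<Sum>i\<in>UNIV. W $ i $ j) = 1" for j
  proof -
    have "(transpose W *v (\<chi> i. 1)) $ j = 1" using W unfolding gossip_matrix_def by (metis vec_lambda_beta)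
    then show ?thesis by (simp add: matrix_vector_mult_def transpose_def)
  qed
  have "(\<Sum>i\<in>UNIV. (W ** A) $ i) = (\<Sum>j\<in>UNIV. \<Sum>i\<in>UNIV. W $ i $ j *\<^sub>R A $ j)"
    unfolding matrix_mult_row by (rule sum.swap)
  also have "\<dots> = (\<Sum>j\<in>UNIV. A $ j)" by (simp add: scaleR_sum_left[symmetric] one)
  finally show ?thesis unfolding row_avg_def by simp
qed

lemma gossip_const: "W ** (\<chi> i. c) = (\<chi> i. (c :: real^'d))"
proof -
  have one: "(\<Sum>i\<in>UNIV. W $ j $ i) = 1" for j
  proof -
    have "(W *v (\<chi> i. 1)) $ j = 1" using W unfolding gossip_matrix_def by (metis vec_lambda_beta)
    then show ?thesis by (simp add: matrix_vector_mult_def)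
  qed
  then show ?thesis by (simp add: vec_eq_iff[of "W ** _"] matrix_mult_row scaleR_sum_left[symmetric])
qed

lemma gossip_deviation: "(W - avg_matrix) ** (A :: real^'d^'n) = W ** A - avg_matrix ** A"
  by (simp add: matrix_matrix_mult_def vec_eq_iff sum_subtractf algebra_simps)

lemma gossip_deviation_proj: "(W - avg_matrix) ** (proj_matrix ** (A :: real^'d^'n)) = (W - avg_matrix) ** A"
proof -
  have "proj_matrix ** A = A - (\<chi> i. row_avg A)"
    by (simp add: vec_eq_iff[of "proj_matrix ** A"] proj_matrix_mult_row)
  moreover have "avg_matrix ** (\<chi> i. row_avg A) = (\<chi> i. row_avg A)"
    by (simp add: vec_eq_iff[of "avg_matrix ** _"] avg_matrix_mult_row row_avg_const)
  ultimately show ?thesis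
    by (simp add: gossip_deviation linear_diff[OF linear_matrix_mult] gossip_const)
qed

lemma proj_gossip: "proj_matrix ** (W ** (A :: real^'d^'n)) = (W - avg_matrix) ** A"
  unfolding proj_matrix_mult gossip_deviation
  by (simp add: vec_eq_iff[of "_ - _"] avg_matrix_mult_row gossip_row_avg)

text \<open>
  The Chebyshev form for \<open>B = W - avg_matrix\<close>, pulled back along the projection of both
  blocks to mean zero. The projection intertwines \<open>W_tilde\<close> with the recursion for
  \<open>B\<close>, and \<open>\<eta> = eta_w \<theta>\<close> is the value
  \<open>1 / (1 + s)\<close> that belongs to \<open>m = 1 - \<theta>\<close>.
\<close>
lemma exists_consensus_form:
  obtains N :: "real^'d^('n + 'n) \<Rightarrow> real^'d^('n + 'n) \<Rightarrow> real"
  where "bilinear N" "\<And>s t. N s t = N t s"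
    "\<And>s. (norm (proj_matrix ** upper s))\<^sup>2 \<le> N s s"
    "\<And>A. N (stack2 A) (stack2 A) \<le> c5 * (norm (proj_matrix ** A))\<^sup>2"
    "\<And>s. N (W_tilde \<theta> W ** s) (W_tilde \<theta> W ** s) = (1 - theta_w \<theta>)\<^sup>2 * N s s"
proof -
  have \<theta>: "0 < \<theta>" "\<theta> \<le> 1" and sym: "transpose W = W" and psd: "\<And>x. 0 \<le> x \<bullet> (W *v x)"
    and on: "onorm ((*v) (W - avg_matrix)) = 1 - \<theta>"
    using W unfolding gossip_matrix_def by auto
  define B :: "real^'d^'n \<Rightarrow> real^'d^'n" where "B = (\<lambda>A. (W - avg_matrix) ** A)"
  have linB: "linear B" unfolding B_def by (rule linear_matrix_mult)
  have symB: "transpose (W - avg_matrix) = W - avg_matrix"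
    using sym by (simp add: transpose_def avg_matrix_def vec_eq_iff)
  have adjB: "B x \<bullet> y = x \<bullet> B y" for x y
    unfolding B_def inner_matrix_mult_left symB ..
  have psdB: "0 \<le> A \<bullet> B A" for A
  proof -
    have "A \<bullet> B A = A \<bullet> (proj_matrix ** (W ** (proj_matrix ** A)))"
      unfolding B_def proj_gossip gossip_deviation_proj ..
    also have "\<dots> = (proj_matrix ** A) \<bullet> (W ** (proj_matrix ** A))"
      by (simp add: inner_matrix_mult_left)
    also have "0 \<le> \<dots>"
      unfolding inner_eq_sum_columns column_matrix_mult by (intro sum_nonneg psd)
    finally show ?thesis .
  qed
  define s where "s = sqrt (1 - (1 - \<theta>)\<^sup>2)"
  have s: "0 \<le> s" using \<theta> unfolding s_def by (simp add: power_le_one)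
  have eta: "eta_w \<theta> = 1 / (1 + s)"
    unfolding eta_w_def eta_root_def s_def[symmetric] using s by (simp add: field_simps)
  have rho: "(1 - theta_w \<theta>)\<^sup>2 = eta_w \<theta>"
    unfolding theta_w_def rho_w_def using s by (simp add: eta)
  obtain Q where Q: "bilinear Q" "\<And>u v. Q u v = Q v u"
    "\<And>u. (norm (fst u))\<^sup>2 \<le> Q u u"
    "\<And>a. Q (a, a) (a, a) \<le> 14 * (norm a)\<^sup>2"
    "\<And>u. Q ((1 + eta_w \<theta>) *\<^sub>R B (fst u) - eta_w \<theta> *\<^sub>R snd u, fst u)
            ((1 + eta_w \<theta>) *\<^sub>R B (fst u) - eta_w \<theta> *\<^sub>R snd u, fst u) = eta_w \<theta> * Q u u"
    using exists_chebyshev_form[OF linB adjB psdB _ _ _ s_def eta] \<theta>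
      norm_matrix_mult_le[of "W - avg_matrix"] unfolding on B_def by auto
  define \<pi> :: "real^'d^('n + 'n) \<Rightarrow> (real^'d^'n) \<times> (real^'d^'n)"
    where "\<pi> = (\<lambda>s. (proj_matrix ** upper s, proj_matrix ** lower s))"
  have lin\<pi>: "linear \<pi>"
    unfolding \<pi>_def
    by (intro linearI) (simp_all add: linear_add[OF linear_upper] linear_add[OF linear_lower]
        linear_scale[OF linear_upper] linear_scale[OF linear_lower]
        linear_add[OF linear_matrix_mult] linear_scale[OF linear_matrix_mult])
  have step: "\<pi> (W_tilde \<theta> W ** s) = ((1 + eta_w \<theta>) *\<^sub>R B (fst (\<pi> s)) - eta_w \<theta> *\<^sub>R snd (\<pi> s), fst (\<pi> s))" for s
    unfolding \<pi>_def W_tilde_upper W_tilde_lower B_def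
    by (simp add: linear_diff[OF linear_matrix_mult] linear_scale[OF linear_matrix_mult] proj_gossip gossip_deviation_proj)
  show ?thesis
  proof (rule that[of "\<lambda>s t. Q (\<pi> s) (\<pi> t)"])
    show "bilinear (\<lambda>s t. Q (\<pi> s) (\<pi> t))"
      using bilinear_compose_linear[OF Q(1) lin\<pi>] .
    show "Q (\<pi> s) (\<pi> t) = Q (\<pi> t) (\<pi> s)" for s t by (rule Q(2))
    show "(norm (proj_matrix ** upper s))\<^sup>2 \<le> Q (\<pi> s) (\<pi> s)" for s
      using Q(3)[of "\<pi> s"] by (simp add: \<pi>_def)
    show "Q (\<pi> (stack2 A)) (\<pi> (stack2 A)) \<le> c5 * (norm (proj_matrix ** A))\<^sup>2" for A
      using Q(4) by (simp add: \<pi>_def c5_def)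
    show "Q (\<pi> (W_tilde \<theta> W ** s)) (\<pi> (W_tilde \<theta> W ** s)) = (1 - theta_w \<theta>)\<^sup>2 * Q (\<pi> s) (\<pi> s)" for s
      unfolding step Q(5) rho ..
  qed
qed

end

section \<open>The inexact first-order oracle of the averaged objective\<close>

lemma DERIV_along_line:
  fixes h :: "real^'d \<Rightarrow> real"
  assumes "\<And>x. GDERIV h x :> g x"
  shows "((\<lambda>t. h (x + t *\<^sub>R v)) has_field_derivative (g (x + t *\<^sub>R v) \<bullet> v)) (at t)"
proof -
  have "((\<lambda>t. x + t *\<^sub>R v) has_derivative (\<lambda>t. t *\<^sub>R v)) (at t)"
    by (auto intro!: derivative_eq_intros)
  moreover have "(h has_derivative (\<lambda>d. d \<bullet> g (x + t *\<^sub>R v))) (at (x + t *\<^sub>R v))"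
    using assms unfolding gderiv_def by blast
  ultimately have "((\<lambda>t. h (x + t *\<^sub>R v)) has_derivative (\<lambda>d. (d *\<^sub>R v) \<bullet> g (x + t *\<^sub>R v))) (at t)"
    by (rule has_derivative_compose)
  then show ?thesis
    unfolding has_field_derivative_def by (simp add: inner_commute mult_commute_abs)
qed

text \<open>
  Along the segment from \<open>x\<close> to \<open>y\<close>, the function minus its quadratic
  model is nondecreasing, since strong monotonicity of the gradient bounds its derivative from
  below. The upper bound follows in the same way from the Lipschitz bound on the gradient.
\<close>
lemma smooth_strongly_convex_lower:
  assumes "smooth_strongly_convex \<mu> L h g"
  shows "h x + g x \<bullet> (y - x) + \<mu> / 2 * (norm (y - x))\<^sup>2 \<le> h y"
proof -
  define v where "v = y - x"
  define \<phi> where "\<phi> = (\<lambda>t. h (x + t *\<^sub>R v) - t * (g x \<bullet> v) - t\<^sup>2 * (\<mu> / 2 * (norm v)\<^sup>2))"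
  have d: "(\<phi> has_field_derivative (g (x + t *\<^sub>R v) \<bullet> v - g x \<bullet> v - t * (\<mu> * (norm v)\<^sup>2))) (at t)" for t
    unfolding \<phi>_def using assms unfolding smooth_strongly_convex_def
    by (auto intro!: derivative_eq_intros DERIV_along_line)
  have "\<phi> 0 \<le> \<phi> 1"
  proof (rule DERIV_nonneg_imp_nondecreasing[of 0 1 \<phi>])
    fix t :: real assume t: "0 \<le> t" "t \<le> 1"
    have "\<mu> * (norm (x + t *\<^sub>R v - x))\<^sup>2 \<le> (x + t *\<^sub>R v - x) \<bullet> (g (x + t *\<^sub>R v) - g x)"
      using assms unfolding smooth_strongly_convex_def by blast
    then have "t * (t * (\<mu> * (norm v)\<^sup>2)) \<le> t * (g (x + t *\<^sub>R v) \<bullet> v - g x \<bullet> v)"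
      by (simp add: power_mult_distrib power2_eq_square inner_diff_right inner_commute algebra_simps)
    then have "0 \<le> g (x + t *\<^sub>R v) \<bullet> v - g x \<bullet> v - t * (\<mu> * (norm v)\<^sup>2)"
      using t by (cases "t = 0") (auto simp: mult_le_cancel_left)
    then show "\<exists>z. DERIV \<phi> t :> z \<and> 0 \<le> z" using d by blast
  qed simp
  then show ?thesis unfolding \<phi>_def v_def by simp
qed

lemma smooth_strongly_convex_upper:
  assumes "smooth_strongly_convex \<mu> L h g"
  shows "h y \<le> h x + g x \<bullet> (y - x) + L / 2 * (norm (y - x))\<^sup>2"
proof -
  define v where "v = y - x"
  define \<phi> where "\<phi> = (\<lambda>t. t * (g x \<bullet> v) + t\<^sup>2 * (L / 2 * (norm v)\<^sup>2) - h (x + t *\<^sub>R v))"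
  have d: "(\<phi> has_field_derivative (g x \<bullet> v + t * (L * (norm v)\<^sup>2) - g (x + t *\<^sub>R v) \<bullet> v)) (at t)" for t
    unfolding \<phi>_def using assms unfolding smooth_strongly_convex_def
    by (auto intro!: derivative_eq_intros DERIV_along_line)
  have "\<phi> 0 \<le> \<phi> 1"
  proof (rule DERIV_nonneg_imp_nondecreasing[of 0 1 \<phi>])
    fix t :: real assume t: "0 \<le> t" "t \<le> 1"
    have "norm (g (x + t *\<^sub>R v) - g x) \<le> L * norm (x + t *\<^sub>R v - x)"
      using assms unfolding smooth_strongly_convex_def by blast
    then have "norm (g (x + t *\<^sub>R v) - g x) * norm v \<le> L * (t * norm v) * norm v"
      using t by (intro mult_right_mono) auto
    then have "(g (x + t *\<^sub>R v) - g x) \<bullet> v \<le> L * (t * norm v) * norm v"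
      using norm_cauchy_schwarz order_trans by blast
    then have "0 \<le> g x \<bullet> v + t * (L * (norm v)\<^sup>2) - g (x + t *\<^sub>R v) \<bullet> v"
      by (simp add: inner_diff_left power2_eq_square algebra_simps)
    then show "\<exists>z. DERIV \<phi> t :> z \<and> 0 \<le> z" using d by blast
  qed simp
  then show ?thesis unfolding \<phi>_def v_def by simp
qed

text \<open>
  The point \<open>w\<close> is a gradient step of length \<open>1 / L\<close> from \<open>y\<close>
  for the function \<open>\<lambda>v. h v - g x \<bullet> v\<close>, which \<open>x\<close>
  minimizes. Such a step decreases this function by at least \<open>|g x - g y|^2 / (2 L)\<close>.
\<close>
lemma smooth_strongly_convex_cocoercive:
  assumes h: "smooth_strongly_convex \<mu> L h g" and "0 \<le> \<mu>" "0 < L"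
  shows "h x + g x \<bullet> (y - x) + 1 / (2 * L) * (norm (g x - g y))\<^sup>2 \<le> h y"
proof -
  define w where "w = y - (1 / L) *\<^sub>R (g y - g x)"
  have wy: "w - y = - ((1 / L) *\<^sub>R (g y - g x))" and wx: "w - x = (y - x) - (1 / L) *\<^sub>R (g y - g x)"
    unfolding w_def by auto
  have "0 \<le> \<mu> / 2 * (norm (w - x))\<^sup>2" using \<open>0 \<le> \<mu>\<close> by simp
  then have "h x + g x \<bullet> (w - x) \<le> h w"
    using smooth_strongly_convex_lower[OF h, of x w] by linarith
  also have "h w \<le> h y + g y \<bullet> (w - y) + L / 2 * (norm (w - y))\<^sup>2"
    by (rule smooth_strongly_convex_upper[OF h])
  finally have "h x + g x \<bullet> (w - x) \<le> h y + g y \<bullet> (w - y) + L / 2 * (norm (w - y))\<^sup>2" .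
  moreover have "L / 2 * (norm (w - y))\<^sup>2 = 1 / (2 * L) * (norm (g x - g y))\<^sup>2"
  proof -
    have "norm (w - y) = norm (g x - g y) / L"
      unfolding wy using \<open>0 < L\<close> by (simp add: norm_minus_commute del: scaleR_diff_right)
    then show ?thesis using \<open>0 < L\<close> by (simp add: power_divide power2_eq_square)
  qed
  moreover have "g y \<bullet> (w - y) - g x \<bullet> (w - x) = - (g x \<bullet> (y - x)) - 2 * (1 / (2 * L) * (norm (g x - g y))\<^sup>2)"
  proof -
    have "(norm (g x - g y))\<^sup>2 = g y \<bullet> (g y - g x) - g x \<bullet> (g y - g x)"
      unfolding dot_square_norm[symmetric] by (simp add: inner_diff_left inner_diff_right inner_commute)
    then have "1 / L * (norm (g x - g y))\<^sup>2 = 1 / L * (g y \<bullet> (g y - g x)) - 1 / L * (g x \<bullet> (g y - g x))"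
      by (simp add: right_diff_distrib diff_divide_distrib)
    then show ?thesis unfolding wy wx by (simp add: inner_diff_right[of _ "y - x"] del: scaleR_diff_right)
  qed
  ultimately show ?thesis by linarith
qed

lemma sum_row_avg: "(\<Sum>i\<in>UNIV. A $ i) = real CARD('n) *\<^sub>R row_avg (A :: real^'d^'n::finite)"
  by (simp add: row_avg_def)

lemma norm_matrix_squared: "(norm (A :: real^'d^'n::finite))\<^sup>2 = (\<Sum>i\<in>UNIV. (norm (A $ i))\<^sup>2)"
  by (simp add: dot_square_norm[symmetric] inner_vec_def)

lemma sum_norm_diff_squared:
  fixes A :: "real^'d^'n::finite"
  shows "(\<Sum>i\<in>UNIV. (norm (y - A $ i))\<^sup>2) = real CARD('n) * (norm (y - row_avg A))\<^sup>2 + (norm (proj_matrix ** A))\<^sup>2"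
proof -
  define P where "P = proj_matrix ** A"
  have "(\<Sum>i\<in>UNIV. P $ i) = 0" using sum_row_avg[of P] by (simp add: P_def)
  then have z: "(\<Sum>i\<in>UNIV. (y - row_avg A) \<bullet> P $ i) = 0" by (simp add: inner_sum_right[symmetric])
  have "(norm (y - A $ i))\<^sup>2 = (norm (y - row_avg A))\<^sup>2 + (norm (P $ i))\<^sup>2 - 2 * ((y - row_avg A) \<bullet> P $ i)" for i
  proof -
    have "y - A $ i = (y - row_avg A) - P $ i" by (simp add: P_def proj_matrix_mult_row)
    then show ?thesis
      by (simp only: dot_square_norm[symmetric]) (simp add: inner_diff_left inner_diff_right inner_commute)
  qed
  then show ?thesis
    unfolding P_def[symmetric] norm_matrix_squared[of P]
    using z by (simp add: sum.distrib sum_subtractf sum_distrib_left[symmetric])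
qed

lemma norm_squared_row_avg_proj:
  "(norm (A :: real^'d^'n::finite))\<^sup>2 = real CARD('n) * (norm (row_avg A))\<^sup>2 + (norm (proj_matrix ** A))\<^sup>2"
  using sum_norm_diff_squared[of 0 A] by (simp add: norm_matrix_squared[of A])

text \<open>
  The value at \<open>row_avg X\<close> that the agents see: each linearizes its own function at its
  own row.
\<close>
definition linearized_avg ::
  "('n \<Rightarrow> real^'d \<Rightarrow> real) \<Rightarrow> ('n \<Rightarrow> real^'d \<Rightarrow> real^'d) \<Rightarrow> real^'d^'n::finite \<Rightarrow> real" where
  "linearized_avg f g X =
     (1 / real CARD('n)) * (\<Sum>i\<in>UNIV. f i (X $ i) + g i (X $ i) \<bullet> (row_avg X - X $ i))"

abbreviation rowwise :: "('n \<Rightarrow> real^'d \<Rightarrow> real^'d) \<Rightarrow> real^'d^'n \<Rightarrow> real^'d^'n" where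
  "rowwise g X \<equiv> (\<chi> i. g i (X $ i))"

lemma linearized_avg_shift:
  fixes X :: "real^'d^'n::finite"
  shows "linearized_avg f g X + row_avg (rowwise g X) \<bullet> (y - row_avg X)
    = (1 / real CARD('n)) * (\<Sum>i\<in>UNIV. f i (X $ i) + g i (X $ i) \<bullet> (y - X $ i))"
proof -
  have "row_avg (rowwise g X) \<bullet> (y - row_avg X) = (1 / real CARD('n)) * (\<Sum>i\<in>UNIV. g i (X $ i) \<bullet> (y - row_avg X))"
    by (simp add: row_avg_def[of "rowwise g X"] inner_sum_left)
  then show ?thesis
    unfolding linearized_avg_def distrib_left[symmetric] sum.distrib[symmetric] by (simp add: inner_diff_right)
       (simp add: add_divide_distrib[symmetric] sum.distrib[symmetric])
qed

context
  fixes f :: "'n::finite \<Rightarrow> real^'d \<Rightarrow> real" and g :: "'n \<Rightarrow> real^'d \<Rightarrow> real^'d" and \<mu> L :: real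
  assumes f: "\<And>i. smooth_strongly_convex \<mu> L (f i) (g i)"
    and \<mu>: "0 < \<mu>" and L: "0 < L"
begin

lemma obj_avg_lower:
  "linearized_avg f g X + row_avg (rowwise g X) \<bullet> (y - row_avg X) + \<mu> / 2 * (norm (y - row_avg X))\<^sup>2
    \<le> obj_avg f y"
proof -
  have "(\<Sum>i\<in>UNIV. f i (X $ i) + g i (X $ i) \<bullet> (y - X $ i)) + \<mu> / 2 * (real CARD('n) * (norm (y - row_avg X))\<^sup>2)
    \<le> (\<Sum>i\<in>UNIV. f i (X $ i) + g i (X $ i) \<bullet> (y - X $ i)) + \<mu> / 2 * (\<Sum>i\<in>UNIV. (norm (y - X $ i))\<^sup>2)"
    unfolding sum_norm_diff_squared using \<mu> by simp
  also have "\<dots> = (\<Sum>i\<in>UNIV. f i (X $ i) + g i (X $ i) \<bullet> (y - X $ i) + \<mu> / 2 * (norm (y - X $ i))\<^sup>2)"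
    by (simp add: sum.distrib sum_distrib_left)
  also have "\<dots> \<le> (\<Sum>i\<in>UNIV. f i y)"
    by (intro sum_mono smooth_strongly_convex_lower[OF f])
  finally have "(1 / real CARD('n)) * ((\<Sum>i\<in>UNIV. f i (X $ i) + g i (X $ i) \<bullet> (y - X $ i)) + \<mu> / 2 * (real CARD('n) * (norm (y - row_avg X))\<^sup>2))
    \<le> (1 / real CARD('n)) * (\<Sum>i\<in>UNIV. f i y)" by (intro mult_left_mono) auto
  then show ?thesis unfolding linearized_avg_shift obj_avg_def by (simp add: distrib_left)
qed

lemma obj_avg_upper:
  "obj_avg f y \<le> linearized_avg f g X + row_avg (rowwise g X) \<bullet> (y - row_avg X)
    + L / 2 * ((norm (y - row_avg X))\<^sup>2 + (norm (proj_matrix ** X))\<^sup>2 / real CARD('n))"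
proof -
  have "(\<Sum>i\<in>UNIV. f i y) \<le> (\<Sum>i\<in>UNIV. f i (X $ i) + g i (X $ i) \<bullet> (y - X $ i) + L / 2 * (norm (y - X $ i))\<^sup>2)"
    by (intro sum_mono smooth_strongly_convex_upper[OF f])
  also have "\<dots> = (\<Sum>i\<in>UNIV. f i (X $ i) + g i (X $ i) \<bullet> (y - X $ i)) + L / 2 * (\<Sum>i\<in>UNIV. (norm (y - X $ i))\<^sup>2)"
    by (simp add: sum.distrib sum_distrib_left)
  finally have "(1 / real CARD('n)) * (\<Sum>i\<in>UNIV. f i y) \<le> (1 / real CARD('n)) *
     ((\<Sum>i\<in>UNIV. f i (X $ i) + g i (X $ i) \<bullet> (y - X $ i)) + L / 2 * (real CARD('n) * (norm (y - row_avg X))\<^sup>2 + (norm (proj_matrix ** X))\<^sup>2))"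
    unfolding sum_norm_diff_squared by (intro mult_left_mono) auto
  then show ?thesis unfolding linearized_avg_shift obj_avg_def by (simp add: field_simps)
qed

text \<open>
  The squared gradient difference is what later absorbs the variance of the gradient estimate.
  Cocoercivity produces it with the gradients at the common point \<open>row_avg Q\<close>;
  replacing them by those at the rows of \<open>Q\<close> halves the constant and costs the
  consensus error of \<open>Q\<close>.
\<close>
lemma obj_avg_cocoercive:
  "linearized_avg f g X + row_avg (rowwise g X) \<bullet> (row_avg Q - row_avg X)
    + 1 / (4 * L * real CARD('n)) * (norm (rowwise g X - rowwise g Q))\<^sup>2
    \<le> obj_avg f (row_avg Q) + L / (2 * real CARD('n)) * (norm (proj_matrix ** Q))\<^sup>2"
proof -
  let ?u = "row_avg Q"
  have split: "(norm (g i (X $ i) - g i (Q $ i)))\<^sup>2 \<le> 2 * (norm (g i (X $ i) - g i ?u))\<^sup>2 + 2 * L\<^sup>2 * (norm (?u - Q $ i))\<^sup>2" for i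
  proof -
    have "norm (g i ?u - g i (Q $ i)) \<le> L * norm (?u - Q $ i)"
      using f unfolding smooth_strongly_convex_def by blast
    then have 1: "(norm (g i ?u - g i (Q $ i)))\<^sup>2 \<le> L\<^sup>2 * (norm (?u - Q $ i))\<^sup>2"
      using power_mono[of _ _ 2] by (fastforce simp: power_mult_distrib)
    have "norm (g i (X $ i) - g i (Q $ i)) \<le> norm (g i (X $ i) - g i ?u) + norm (g i ?u - g i (Q $ i))"
      by (metis norm_triangle_ineq diff_add_cancel add_diff_eq)
    then have "(norm (g i (X $ i) - g i (Q $ i)))\<^sup>2 \<le> (norm (g i (X $ i) - g i ?u) + norm (g i ?u - g i (Q $ i)))\<^sup>2"
      by (intro power_mono) auto
    also have "\<dots> \<le> 2 * (norm (g i (X $ i) - g i ?u))\<^sup>2 + 2 * (norm (g i ?u - g i (Q $ i)))\<^sup>2"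
      using sum_squares_bound[of "norm (g i (X $ i) - g i ?u)" "norm (g i ?u - g i (Q $ i))"]
      by (simp add: power2_sum)
    finally show ?thesis using 1 by linarith
  qed
  have "(norm (rowwise g X - rowwise g Q))\<^sup>2 = (\<Sum>i\<in>UNIV. (norm (g i (X $ i) - g i (Q $ i)))\<^sup>2)"
    by (simp add: norm_matrix_squared)
  also have "\<dots> \<le> (\<Sum>i\<in>UNIV. 2 * (norm (g i (X $ i) - g i ?u))\<^sup>2 + 2 * L\<^sup>2 * (norm (?u - Q $ i))\<^sup>2)"
    by (intro sum_mono split)
  also have "\<dots> = 2 * (\<Sum>i\<in>UNIV. (norm (g i (X $ i) - g i ?u))\<^sup>2) + 2 * L\<^sup>2 * (norm (proj_matrix ** Q))\<^sup>2"
    using sum_norm_diff_squared[of ?u Q] by (simp add: sum.distrib sum_distrib_left[symmetric])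
  finally have D: "(norm (rowwise g X - rowwise g Q))\<^sup>2 \<le> 2 * (\<Sum>i\<in>UNIV. (norm (g i (X $ i) - g i ?u))\<^sup>2) + 2 * L\<^sup>2 * (norm (proj_matrix ** Q))\<^sup>2" .
  have "(\<Sum>i\<in>UNIV. f i (X $ i) + g i (X $ i) \<bullet> (?u - X $ i)) + 1 / (2 * L) * (\<Sum>i\<in>UNIV. (norm (g i (X $ i) - g i ?u))\<^sup>2)
     = (\<Sum>i\<in>UNIV. f i (X $ i) + g i (X $ i) \<bullet> (?u - X $ i) + 1 / (2 * L) * (norm (g i (X $ i) - g i ?u))\<^sup>2)"
    by (simp add: sum.distrib sum_distrib_left sum_divide_distrib)
  also have "\<dots> \<le> (\<Sum>i\<in>UNIV. f i ?u)"
    using \<mu> L by (intro sum_mono smooth_strongly_convex_cocoercive[OF f]) auto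
  finally have "(\<Sum>i\<in>UNIV. f i (X $ i) + g i (X $ i) \<bullet> (?u - X $ i)) + 1 / (4 * L) * ((norm (rowwise g X - rowwise g Q))\<^sup>2 - 2 * L\<^sup>2 * (norm (proj_matrix ** Q))\<^sup>2)
     \<le> (\<Sum>i\<in>UNIV. f i ?u)"
    using D L by (simp add: field_simps)
  then have "(1 / real CARD('n)) * ((\<Sum>i\<in>UNIV. f i (X $ i) + g i (X $ i) \<bullet> (?u - X $ i)) + 1 / (4 * L) * ((norm (rowwise g X - rowwise g Q))\<^sup>2 - 2 * L\<^sup>2 * (norm (proj_matrix ** Q))\<^sup>2))
     \<le> (1 / real CARD('n)) * (\<Sum>i\<in>UNIV. f i ?u)" by (intro mult_left_mono) auto
  then show ?thesis unfolding linearized_avg_shift obj_avg_def using L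
    by (simp add: field_simps power2_eq_square)
qed

end

section \<open>One accelerated step\<close>

lemma proximal_three_point:
  fixes z z' x s v :: "'a::real_inner"
  assumes "(1 + \<beta>) *\<^sub>R z' = z + \<beta> *\<^sub>R x - \<eta> *\<^sub>R v"
  shows "(1 + \<beta>) * (norm (z' - s))\<^sup>2
    = (norm (z - s))\<^sup>2 + \<beta> * (norm (x - s))\<^sup>2 - (norm (z' - z))\<^sup>2 - \<beta> * (norm (z' - x))\<^sup>2 - 2 * \<eta> * (v \<bullet> (z' - s))"
proof -
  have sq: "(norm (a - s))\<^sup>2 = (norm (z' - a))\<^sup>2 + (norm (z' - s))\<^sup>2 + 2 * ((a - z') \<bullet> (z' - s))" for a
    by (simp only: dot_square_norm[symmetric]) (simp add: inner_diff_left inner_diff_right inner_commute)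
  have "\<eta> * (v \<bullet> (z' - s)) = (z + \<beta> *\<^sub>R x - (1 + \<beta>) *\<^sub>R z') \<bullet> (z' - s)"
    unfolding assms by simp
  also have "\<dots> = (z - z') \<bullet> (z' - s) + \<beta> * ((x - z') \<bullet> (z' - s))"
    by (simp add: algebra_simps inner_diff_left inner_add_left)
  finally have "2 * (\<eta> * (v \<bullet> (z' - s))) = 2 * ((z - z') \<bullet> (z' - s)) + \<beta> * (2 * ((x - z') \<bullet> (z' - s)))"
    by (simp add: algebra_simps)
  moreover have "\<beta> * (norm (x - s))\<^sup>2 = \<beta> * (norm (z' - x))\<^sup>2 + \<beta> * (norm (z' - s))\<^sup>2 + \<beta> * (2 * ((x - z') \<bullet> (z' - s)))"
    by (simp only: sq[of x] distrib_left)
  moreover have "(1 + \<beta>) * (norm (z' - s))\<^sup>2 = (norm (z' - s))\<^sup>2 + \<beta> * (norm (z' - s))\<^sup>2"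
    by (simp add: distrib_right)
  moreover have "2 * \<eta> * (v \<bullet> (z' - s)) = 2 * (\<eta> * (v \<bullet> (z' - s)))" by simp
  ultimately show ?thesis using sq[of z] by linarith
qed

lemma neg_inner_le_Young:
  fixes d w :: "'a::real_inner"
  assumes "0 < \<eta>"
  shows "- (e * (d \<bullet> w)) \<le> 3 / (8 * \<eta>) * (norm w)\<^sup>2 + 2 * \<eta> / 3 * (e\<^sup>2 * (norm d)\<^sup>2)"
proof -
  have "0 \<le> (norm (3 *\<^sub>R w + (4 * \<eta> * e) *\<^sub>R d))\<^sup>2 / (24 * \<eta>)" using assms by simp
  also have "(norm (3 *\<^sub>R w + (4 * \<eta> * e) *\<^sub>R d))\<^sup>2
     = 9 * (norm w)\<^sup>2 + 24 * \<eta> * e * (d \<bullet> w) + 16 * \<eta>\<^sup>2 * (e\<^sup>2 * (norm d)\<^sup>2)"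
    unfolding dot_square_norm[symmetric]
    by (simp add: inner_add_left inner_add_right inner_commute power2_eq_square)
  also have "\<dots> / (24 * \<eta>) = 3 / (8 * \<eta>) * (norm w)\<^sup>2 + e * (d \<bullet> w) + 2 * \<eta> / 3 * (e\<^sup>2 * (norm d)\<^sup>2)"
    using assms by (simp add: field_simps power2_eq_square)
  finally show ?thesis by simp
qed

lemma two_point_average:
  fixes q :: real
  assumes "q \<noteq> 0"
  shows "q * (E + c * ((1 / q - 1)\<^sup>2 * d) - (1 / q - 1) * w) + (1 - q) * (E + c * ((0 - 1)\<^sup>2 * d) - (0 - 1) * w)
    = E + c * ((1 / q - 1) * d)"
proof -
  define r where "r = 1 / q - 1"
  have r: "q * r = 1 - q" unfolding r_def using assms by (simp add: field_simps)
  have r2: "q * r\<^sup>2 = r - q * r" unfolding power2_eq_square mult.assoc[symmetric] r by (simp add: algebra_simps r)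
  have "q * (E + c * (r\<^sup>2 * d) - r * w) + (1 - q) * (E + c * ((0 - 1)\<^sup>2 * d) - (0 - 1) * w)
    = E + c * d * (q * r\<^sup>2 + (1 - q)) + w * ((1 - q) - q * r)"
    by (simp add: algebra_simps)
  also have "\<dots> = E + c * (r * d)" unfolding r2 r by (simp add: algebra_simps)
  finally show ?thesis unfolding r_def .
qed

context
  fixes f :: "'n::finite \<Rightarrow> real^'d \<Rightarrow> real" and g :: "'n \<Rightarrow> real^'d \<Rightarrow> real^'d" and \<mu> L :: real
    and \<alpha> \<beta> \<gamma> \<tau> \<eta> A :: real and X Q :: "real^'d^'n" and y z s :: "real^'d"
  assumes f: "\<And>i. smooth_strongly_convex \<mu> L (f i) (g i)"
    and \<mu>: "0 < \<mu>" and L: "0 < L"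
    and pos: "0 < \<alpha>" "0 \<le> \<beta>" "0 < \<gamma>" "0 < \<tau>" "0 < \<eta>"
    and A: "A = (1 - \<alpha> - \<tau>) / \<alpha>" "0 \<le> A"
    and step: "L * \<gamma> \<le> 1 / (4 * \<eta>)" "\<beta> / (2 * \<eta>) \<le> \<mu> / 4"
    and X: "row_avg X = (1 - \<alpha> - \<tau>) *\<^sub>R y + \<alpha> *\<^sub>R z + \<tau> *\<^sub>R row_avg Q"
begin

text \<open>
  The step of \<open>z\<close> uses the direction \<open>h + e d\<close>, where \<open>e d\<close>
  is the deviation from the mean direction \<open>h\<close>. Smoothness bounds the new value at
  \<open>y\<close>; the linear term \<open>h \<bullet> w\<close> with \<open>w = z' - z\<close>
  cancels against the three-point identity for \<open>z'\<close>. The remaining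
  \<open>- h \<bullet> (z - s)\<close> splits along the coupling
  \<open>z - x = A (x - y) + (\<tau> / \<alpha>) (x - u)\<close>, and each part is bounded by the
  oracle. The squares \<open>|w|^2\<close>, with coefficients \<open>1/8 + 3/8 - 1/2\<close> in
  units of \<open>1 / \<eta>\<close>, cancel exactly.
\<close>
lemma accelerated_step:
  fixes z' d :: "real^'d" and e :: real
  assumes z': "(1 + \<beta>) *\<^sub>R z' = z + \<beta> *\<^sub>R row_avg X - \<eta> *\<^sub>R (row_avg (rowwise g X) + e *\<^sub>R d)"
  shows "1 / \<gamma> * (obj_avg f (row_avg X + \<gamma> *\<^sub>R (z' - z)) - obj_avg f s) + (1 + \<beta>) / (2 * \<eta>) * (norm (z' - s))\<^sup>2
    \<le> A * (obj_avg f y - obj_avg f s) + \<tau> / \<alpha> * (obj_avg f (row_avg Q) - obj_avg f s)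
      + (1 / \<gamma> - A - \<tau> / \<alpha> - 1) * (linearized_avg f g X - obj_avg f s)
      + 1 / (2 * \<eta>) * (norm (z - s))\<^sup>2
      + L / (2 * real CARD('n) * \<gamma>) * (norm (proj_matrix ** X))\<^sup>2
      + \<tau> / \<alpha> * (L / (2 * real CARD('n)) * (norm (proj_matrix ** Q))\<^sup>2
          - 1 / (4 * L * real CARD('n)) * (norm (rowwise g X - rowwise g Q))\<^sup>2)
      + 2 * \<eta> / 3 * (e\<^sup>2 * (norm d)\<^sup>2) - e * (d \<bullet> (z - s))"
proof -
  define x where "x = row_avg X"
  define u where "u = row_avg Q"
  define h where "h = row_avg (rowwise g X)"
  define w where "w = z' - z"
  define F where "F = obj_avg f"
  define Ft where "Ft = linearized_avg f g X"
  define cX where "cX = (norm (proj_matrix ** X))\<^sup>2"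
  define cQ where "cQ = (norm (proj_matrix ** Q))\<^sup>2"
  define D where "D = (norm (rowwise g X - rowwise g Q))\<^sup>2"
  define n where "n = real CARD('n)"
  have n: "0 < n" unfolding n_def by simp
  note defs = x_def[symmetric] u_def[symmetric] h_def[symmetric] F_def[symmetric] Ft_def[symmetric]
    cX_def[symmetric] cQ_def[symmetric] D_def[symmetric] n_def[symmetric]
  have up: "1 / \<gamma> * F (x + \<gamma> *\<^sub>R w) \<le> 1 / \<gamma> * Ft + h \<bullet> w + L * \<gamma> / 2 * (norm w)\<^sup>2 + L / (2 * n * \<gamma>) * cX"
  proof -
    have "F (x + \<gamma> *\<^sub>R w) \<le> Ft + h \<bullet> (\<gamma> *\<^sub>R w) + L / 2 * ((norm (\<gamma> *\<^sub>R w))\<^sup>2 + cX / n)"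
      using obj_avg_upper[where f = f and g = g and X = X and y = "x + \<gamma> *\<^sub>R w", OF f \<mu> L] unfolding defs by simp
    then have "1 / \<gamma> * F (x + \<gamma> *\<^sub>R w) \<le> 1 / \<gamma> * (Ft + h \<bullet> (\<gamma> *\<^sub>R w) + L / 2 * ((norm (\<gamma> *\<^sub>R w))\<^sup>2 + cX / n))"
      using pos by (intro mult_left_mono) auto
    also have "\<dots> = 1 / \<gamma> * Ft + h \<bullet> w + L * \<gamma> / 2 * (norm w)\<^sup>2 + L / (2 * n * \<gamma>) * cX"
      using pos n by (simp add: power_mult_distrib field_simps power2_eq_square)
    finally show ?thesis .
  qed
  have prox: "(1 + \<beta>) / (2 * \<eta>) * (norm (z' - s))\<^sup>2
      = 1 / (2 * \<eta>) * (norm (z - s))\<^sup>2 + \<beta> / (2 * \<eta>) * (norm (x - s))\<^sup>2 - 1 / (2 * \<eta>) * (norm w)\<^sup>2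
        - \<beta> / (2 * \<eta>) * (norm (z' - x))\<^sup>2 - (h + e *\<^sub>R d) \<bullet> (z' - s)"
  proof -
    have "(1 + \<beta>) / (2 * \<eta>) * (norm (z' - s))\<^sup>2 = (1 / (2 * \<eta>)) * ((1 + \<beta>) * (norm (z' - s))\<^sup>2)" by simp
    also have "\<dots> = 1 / (2 * \<eta>) * ((norm (z - s))\<^sup>2 + \<beta> * (norm (x - s))\<^sup>2 - (norm w)\<^sup>2 - \<beta> * (norm (z' - x))\<^sup>2
        - 2 * \<eta> * ((h + e *\<^sub>R d) \<bullet> (z' - s)))"
      using proximal_three_point[OF z'[unfolded defs], of s] unfolding w_def by simp
    finally show ?thesis using pos by (simp add: right_diff_distrib distrib_left)
  qed
  have inner: "(h + e *\<^sub>R d) \<bullet> (z' - s) = h \<bullet> w + e * (d \<bullet> w) + h \<bullet> (z - s) + e * (d \<bullet> (z - s))"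
    unfolding w_def by (simp add: inner_add_left inner_diff_right algebra_simps)
  have couple: "- (h \<bullet> (z - s)) = A * (h \<bullet> (y - x)) + \<tau> / \<alpha> * (h \<bullet> (u - x)) + h \<bullet> (s - x)"
  proof -
    have "\<alpha> *\<^sub>R (z - x) = (1 - \<alpha> - \<tau>) *\<^sub>R (x - y) + \<tau> *\<^sub>R (x - u)"
      using X unfolding defs by (simp add: algebra_simps)
    then have "\<alpha> * (h \<bullet> (z - x)) = (1 - \<alpha> - \<tau>) * (h \<bullet> (x - y)) + \<tau> * (h \<bullet> (x - u))"
      by (metis inner_add_right inner_scaleR_right)
    then have "h \<bullet> (z - x) = A * (h \<bullet> (x - y)) + \<tau> / \<alpha> * (h \<bullet> (x - u))"
      unfolding A using pos by (simp add: field_simps)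
    then show ?thesis by (simp add: inner_diff_right algebra_simps)
  qed
  have convex: "h \<bullet> (v - x) \<le> F v - Ft - \<mu> / 2 * (norm (v - x))\<^sup>2" for v
    using obj_avg_lower[where f = f and g = g and X = X and y = v, OF f \<mu> L] unfolding defs by simp
  have y: "A * (h \<bullet> (y - x)) \<le> A * (F y - Ft)"
  proof -
    have "0 \<le> \<mu> / 2 * (norm (y - x))\<^sup>2" using \<mu> by simp
    then show ?thesis using A convex[of y] by (intro mult_left_mono) linarith+
  qed
  have u: "\<tau> / \<alpha> * (h \<bullet> (u - x)) \<le> \<tau> / \<alpha> * (F u - Ft + (L / (2 * n) * cQ - 1 / (4 * L * n) * D))"
    using obj_avg_cocoercive[where f = f and g = g and X = X and Q = Q, OF f \<mu> L] pos unfolding defs by (intro mult_left_mono) auto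
  have young: "- (e * (d \<bullet> w)) \<le> 3 / (8 * \<eta>) * (norm w)\<^sup>2 + 2 * \<eta> / 3 * (e\<^sup>2 * (norm d)\<^sup>2)"
    using pos by (intro neg_inner_le_Young)
  have w: "L * \<gamma> / 2 * (norm w)\<^sup>2 \<le> 1 / (8 * \<eta>) * (norm w)\<^sup>2"
    using step(1) by (intro mult_right_mono) auto
  have w0: "1 / (8 * \<eta>) * (norm w)\<^sup>2 + 3 / (8 * \<eta>) * (norm w)\<^sup>2 - 1 / (2 * \<eta>) * (norm w)\<^sup>2 = 0"
    using pos by (simp add: field_simps)
  have xs: "\<beta> / (2 * \<eta>) * (norm (x - s))\<^sup>2 \<le> \<mu> / 4 * (norm (s - x))\<^sup>2"
    using step(2) unfolding norm_minus_commute[of x s] by (intro mult_right_mono) auto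
  have "0 \<le> \<mu> / 4 * (norm (s - x))\<^sup>2" using \<mu> by simp
  moreover have "0 \<le> \<beta> / (2 * \<eta>) * (norm (z' - x))\<^sup>2" using pos by simp
  ultimately have "1 / \<gamma> * F (x + \<gamma> *\<^sub>R w) + (1 + \<beta>) / (2 * \<eta>) * (norm (z' - s))\<^sup>2
    \<le> 1 / \<gamma> * Ft + L / (2 * n * \<gamma>) * cX + 1 / (2 * \<eta>) * (norm (z - s))\<^sup>2
      + A * (F y - Ft) + \<tau> / \<alpha> * (F u - Ft + (L / (2 * n) * cQ - 1 / (4 * L * n) * D)) + (F s - Ft)
      + 2 * \<eta> / 3 * (e\<^sup>2 * (norm d)\<^sup>2) - e * (d \<bullet> (z - s))"
    using up prox inner couple convex[of s] y u young w w0 xs by linarith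
  also have "\<dots> = A * (F y - F s) + \<tau> / \<alpha> * (F u - F s) + (1 / \<gamma> - A - \<tau> / \<alpha> - 1) * (Ft - F s)
      + 1 / (2 * \<eta>) * (norm (z - s))\<^sup>2 + L / (2 * n * \<gamma>) * cX
      + \<tau> / \<alpha> * (L / (2 * n) * cQ - 1 / (4 * L * n) * D)
      + 2 * \<eta> / 3 * (e\<^sup>2 * (norm d)\<^sup>2) - e * (d \<bullet> (z - s)) + 1 / \<gamma> * F s"
    by (simp only: ring_distribs)
  finally show ?thesis unfolding defs w_def[symmetric] by (simp add: right_diff_distrib)
qed

text \<open>
  The deviation \<open>b - 1\<close> has mean \<open>0\<close> and variance \<open>1 / q - 1\<close>
  when \<open>b\<close> is \<open>1 / q\<close> with probability \<open>q\<close> and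
  \<open>0\<close> otherwise, so the cross term of the previous lemma vanishes on average. The
  weight \<open>cU\<close> is chosen so that refreshing the anchor with probability \<open>p\<close>
  removes \<open>\<tau> / \<alpha> + 1 / 2\<close> times the value gap of the anchor,
  \<open>1 / 2\<close> more than the step produces. In units of \<open>L / (2 n)\<close>, the
  consensus error of \<open>X\<close> collects the coefficient
  \<open>1 / \<gamma> + (\<tau> / \<alpha> + 1 / 2) + (A + 1 / 2 - 1 / \<gamma>) = 1 / \<alpha>\<close>.
\<close>
lemma expected_accelerated_step:
  fixes p q :: real and zz :: "real \<Rightarrow> real^'d"
  assumes pq: "0 < p" "0 < q" "q < 1"
    and zz: "\<And>b. (1 + \<beta>) *\<^sub>R zz b = z + \<beta> *\<^sub>R row_avg X - \<eta> *\<^sub>R (row_avg (rowwise g Q) + b *\<^sub>R (row_avg (rowwise g X) - row_avg (rowwise g Q)))"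
    and A': "1 / \<gamma> - A - 1 / 2 \<le> 0"
    and s: "\<And>x. obj_avg f s \<le> obj_avg f x"
  defines "V \<equiv> \<lambda>z'. 1 / \<gamma> * (obj_avg f (row_avg X + \<gamma> *\<^sub>R (z' - z)) - obj_avg f s) + (1 + \<beta>) / (2 * \<eta>) * (norm (z' - s))\<^sup>2"
    and "cU \<equiv> (2 * \<tau> + \<alpha>) / (2 * \<alpha> * p)"
  shows "q * V (zz (1 / q)) + (1 - q) * V (zz 0)
      + (p * (cU * (obj_avg f (row_avg X) - obj_avg f s)) + (1 - p) * (cU * (obj_avg f (row_avg Q) - obj_avg f s)))
    \<le> A * (obj_avg f y - obj_avg f s) + (cU - 1 / 2) * (obj_avg f (row_avg Q) - obj_avg f s)
      + 1 / (2 * \<eta>) * (norm (z - s))\<^sup>2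
      + L / (2 * real CARD('n) * \<alpha>) * (norm (proj_matrix ** X))\<^sup>2
      + \<tau> / \<alpha> * (L / (2 * real CARD('n))) * (norm (proj_matrix ** Q))\<^sup>2
      + (2 * \<eta> / (3 * q * real CARD('n)) - \<tau> / (4 * \<alpha> * L * real CARD('n))) * (norm (rowwise g X - rowwise g Q))\<^sup>2"
proof -
  define d where "d = row_avg (rowwise g X) - row_avg (rowwise g Q)"
  define n where "n = real CARD('n)"
  have n: "0 < n" unfolding n_def by simp
  define D where "D = (norm (rowwise g X - rowwise g Q))\<^sup>2"
  define cX where "cX = (norm (proj_matrix ** X))\<^sup>2"
  define cQ where "cQ = (norm (proj_matrix ** Q))\<^sup>2"
  define v where "v = linearized_avg f g X - obj_avg f s"
  define fx where "fx = obj_avg f (row_avg X) - obj_avg f s"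
  define fu where "fu = obj_avg f (row_avg Q) - obj_avg f s"
  define E where "E = A * (obj_avg f y - obj_avg f s) + \<tau> / \<alpha> * fu
      + (1 / \<gamma> - A - \<tau> / \<alpha> - 1) * v
      + 1 / (2 * \<eta>) * (norm (z - s))\<^sup>2 + L / (2 * n * \<gamma>) * cX
      + \<tau> / \<alpha> * (L / (2 * n) * cQ - 1 / (4 * L * n) * D)"
  have V: "V (zz b) \<le> E + 2 * \<eta> / 3 * ((b - 1)\<^sup>2 * (norm d)\<^sup>2) - (b - 1) * (d \<bullet> (z - s))" for b
  proof -
    have "(1 + \<beta>) *\<^sub>R zz b = z + \<beta> *\<^sub>R row_avg X - \<eta> *\<^sub>R (row_avg (rowwise g X) + (b - 1) *\<^sub>R d)"
      unfolding zz d_def by (simp add: algebra_simps)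
    then show ?thesis
      unfolding V_def E_def v_def fu_def n_def D_def cX_def cQ_def by (rule accelerated_step)
  qed
  have dD: "(norm d)\<^sup>2 \<le> D / n"
  proof -
    have "d = row_avg (rowwise g X - rowwise g Q)"
      unfolding d_def by (simp add: linear_diff[OF linear_row_avg])
    moreover have "n * (norm (row_avg (rowwise g X - rowwise g Q)))\<^sup>2 \<le> D"
      using norm_squared_row_avg_proj[of "rowwise g X - rowwise g Q"] zero_le_power2[of "norm (proj_matrix ** (rowwise g X - rowwise g Q))"]
      unfolding D_def n_def by linarith
    ultimately show ?thesis using n by (simp only: pos_le_divide_eq mult.commute)
  qed
  have "q * V (zz (1 / q)) + (1 - q) * V (zz 0) \<le>
     q * (E + 2 * \<eta> / 3 * ((1 / q - 1)\<^sup>2 * (norm d)\<^sup>2) - (1 / q - 1) * (d \<bullet> (z - s)))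
     + (1 - q) * (E + 2 * \<eta> / 3 * ((0 - 1)\<^sup>2 * (norm d)\<^sup>2) - (0 - 1) * (d \<bullet> (z - s)))"
    using pq by (intro add_mono mult_left_mono V) auto
  also have "\<dots> = E + 2 * \<eta> / 3 * ((1 / q - 1) * (norm d)\<^sup>2)"
    using pq by (intro two_point_average) auto
  also have "\<dots> \<le> E + 2 * \<eta> / 3 * (1 / q * (D / n))"
    using pq pos dD by (intro add_left_mono mult_left_mono mult_mono) auto
  finally have 1: "q * V (zz (1 / q)) + (1 - q) * V (zz 0) \<le> E + 2 * \<eta> / (3 * q * n) * D" by simp
  have cU: "cU * p = \<tau> / \<alpha> + 1 / 2"
    unfolding cU_def using pq pos by (simp add: field_simps)
  have fx: "fx \<le> v + L / (2 * n) * cX" "0 \<le> fx"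
    using obj_avg_upper[where f = f and g = g and X = X and y = "row_avg X", OF f \<mu> L] s unfolding fx_def v_def n_def cX_def by simp_all
  have \<alpha>: "1 / \<alpha> = A + \<tau> / \<alpha> + 1" unfolding A using pos by (simp add: field_simps)
  \<comment> \<open>the coefficient of the linearized value is nonpositive, so only its lower bound is needed\<close>
  define e where "e = L / (2 * n) * cX"
  have e: "L / (2 * n * \<gamma>) * cX = 1 / \<gamma> * e" "L / (2 * n * \<alpha>) * cX = 1 / \<alpha> * e"
    unfolding e_def by simp_all
  have "(1 / \<gamma> - A - \<tau> / \<alpha> - 1) * v + (\<tau> / \<alpha> + 1 / 2) * fx
     \<le> (1 / \<gamma> - A - \<tau> / \<alpha> - 1) * v + (\<tau> / \<alpha> + 1 / 2) * (v + e)"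
    using fx pos unfolding e_def[symmetric] by (intro add_left_mono mult_left_mono) auto
  also have "\<dots> = (1 / \<gamma> - A - 1 / 2) * v + (\<tau> / \<alpha> + 1 / 2) * e"
    unfolding ring_distribs by linarith
  also have "\<dots> \<le> (1 / \<gamma> - A - 1 / 2) * (- e) + (\<tau> / \<alpha> + 1 / 2) * e"
    using fx A' unfolding e_def[symmetric] by (intro add_right_mono mult_left_mono_neg) auto
  also have "\<dots> = (1 / \<alpha> - 1 / \<gamma>) * e"
    unfolding \<alpha> ring_distribs by linarith
  finally have 2: "(1 / \<gamma> - A - \<tau> / \<alpha> - 1) * v + (\<tau> / \<alpha> + 1 / 2) * fx + L / (2 * n * \<gamma>) * cX \<le> L / (2 * n * \<alpha>) * cX"
    unfolding e ring_distribs by linarith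
  have "p * (cU * fx) + (1 - p) * (cU * fu) = (cU * p) * fx + cU * fu - (cU * p) * fu"
    by (simp add: algebra_simps)
  then have 3: "p * (cU * fx) + (1 - p) * (cU * fu) = (\<tau> / \<alpha> + 1 / 2) * fx + cU * fu - (\<tau> / \<alpha> * fu + 1 / 2 * fu)"
    unfolding cU by (simp add: distrib_right)
  have 4: "\<tau> / \<alpha> * (L / (2 * n) * cQ - 1 / (4 * L * n) * D) = \<tau> / \<alpha> * (L / (2 * n)) * cQ - \<tau> / (4 * \<alpha> * L * n) * D"
    by (simp add: right_diff_distrib)
  show ?thesis
    unfolding n_def[symmetric] D_def[symmetric] cX_def[symmetric] cQ_def[symmetric] fx_def[symmetric] fu_def[symmetric]
    using 1 2 3 4 unfolding E_def left_diff_distrib[of _ _ fu] left_diff_distrib[of _ _ D] by linarith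
qed

end

section \<open>Markov chains driven by the two noise sequences\<close>

definition noise_avg :: "real \<Rightarrow> real \<Rightarrow> (real \<Rightarrow> real \<Rightarrow> real) \<Rightarrow> real" where
  "noise_avg p q h = p * (q * h 1 (1 / q) + (1 - q) * h 1 0) + (1 - p) * (q * h 0 (1 / q) + (1 - q) * h 0 0)"

text \<open>
  \<open>g\<close> is measurable with respect to the variables indexed by \<open>K\<close>, hence
  independent of the variable \<open>N i\<close>.
\<close>
lemma (in prob_space) indep_past_integral:
  fixes N :: "'i \<Rightarrow> 'a \<Rightarrow> real" and g :: "'a \<Rightarrow> real" and h :: "real \<Rightarrow> real"
  assumes ind: "indep_vars (\<lambda>_. borel) N UNIV" and i: "i \<notin> K"
    and g: "g \<in> borel_measurable (vimage_algebra (space M) (\<lambda>\<omega>. restrict (\<lambda>j. N j \<omega>) K) (PiM K (\<lambda>_. borel)))"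
    and gi: "integrable M g" and h: "h \<in> borel_measurable borel" and hi: "integrable M (\<lambda>\<omega>. h (N i \<omega>))"
  shows "(\<integral>\<omega>. g \<omega> * h (N i \<omega>) \<partial>M) = (\<integral>\<omega>. g \<omega> \<partial>M) * (\<integral>\<omega>. h (N i \<omega>) \<partial>M)"
proof (rule indep_var_lebesgue_integral[OF _ gi hi])
  let ?R = "\<lambda>A \<omega>. restrict (\<lambda>j. N j \<omega>) A"
  have "indep_var (PiM K (\<lambda>_. borel)) (?R K) (PiM {i} (\<lambda>_. borel)) (?R {i})"
    using i by (intro indep_var_restrict[OF ind]) auto
  then have "indep_set (sigma_sets (space M) {?R K -` A \<inter> space M | A. A \<in> sets (PiM K (\<lambda>_. borel))})
      (sigma_sets (space M) {?R {i} -` A \<inter> space M | A. A \<in> sets (PiM {i} (\<lambda>_. borel))})"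
    unfolding indep_var_eq by blast
  then have "indep_set (sigma_sets (space M) {g -` A \<inter> space M | A. A \<in> sets borel})
      (sigma_sets (space M) {(\<lambda>\<omega>. h (N i \<omega>)) -` A \<inter> space M | A. A \<in> sets borel})"
    unfolding indep_set_def
  proof (rule indep_sets_mono_sets, goal_cases)
    case (1 b)
    have "{g -` A \<inter> space M | A. A \<in> sets borel} \<subseteq> sigma_sets (space M) {?R K -` A \<inter> space M | A. A \<in> sets (PiM K (\<lambda>_. borel))}"
      using measurable_sets[OF g] by (auto simp: sets_vimage_algebra)
    moreover have "{(\<lambda>\<omega>. h (N i \<omega>)) -` A \<inter> space M | A. A \<in> sets borel}
        \<subseteq> {?R {i} -` A \<inter> space M | A. A \<in> sets (PiM {i} (\<lambda>_. borel))}"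
    proof safe
      fix A :: "real set" assume A: "A \<in> sets borel"
      have "(\<lambda>v. h (v i)) \<in> borel_measurable (PiM {i} (\<lambda>_. borel))"
        using h by measurable
      then have "(\<lambda>v. h (v i)) -` A \<inter> space (PiM {i} (\<lambda>_. borel)) \<in> sets (PiM {i} (\<lambda>_. borel))"
        using A by (rule measurable_sets)
      moreover have "(\<lambda>\<omega>. h (N i \<omega>)) -` A \<inter> space M
          = ?R {i} -` ((\<lambda>v. h (v i)) -` A \<inter> space (PiM {i} (\<lambda>_. borel))) \<inter> space M"
        by (auto simp: space_PiM)
      ultimately show "\<exists>Aa. (\<lambda>\<omega>. h (N i \<omega>)) -` A \<inter> space M = ?R {i} -` Aa \<inter> space M \<and> Aa \<in> sets (PiM {i} (\<lambda>_. borel))"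
        by blast
    qed
    ultimately show ?case
      by (cases b) (simp_all add: sigma_sets_mono sigma_sets_mono')
  qed
  moreover have "g \<in> borel_measurable M" "(\<lambda>\<omega>. h (N i \<omega>)) \<in> borel_measurable M"
    using gi hi by auto
  ultimately show "indep_var borel g borel (\<lambda>\<omega>. h (N i \<omega>))"
    unfolding indep_var_eq by blast
qed

text \<open>
  The update \<open>T\<close> is only assumed to be continuous. As the noise takes finitely many
  values, this is enough for measurability, integrability and the Markov property of all continuous
  observables.
\<close>
locale noise_driven_chain =
  fixes p q :: real and M :: "'w measure" and \<xi> \<zeta> :: "nat \<Rightarrow> 'w \<Rightarrow> real"
    and S :: "nat \<Rightarrow> 'w \<Rightarrow> 's::euclidean_space" and s0 :: 's and T :: "'s \<Rightarrow> real \<Rightarrow> real \<Rightarrow> 's"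
  assumes noise: "ogt_noise p q M \<xi> \<zeta>" and p: "0 < p" "p < 1" and q: "0 < q" "q < 1"
    and S_0: "\<And>\<omega>. S 0 \<omega> = s0"
    and S_Suc: "\<And>k \<omega>. S (Suc k) \<omega> = T (S k \<omega>) (\<xi> k \<omega>) (\<zeta> k \<omega>)"
    and T: "continuous_on UNIV (\<lambda>(s, a, b). T s a b)"
begin

sublocale prob_space M using noise unfolding ogt_noise_def by blast

abbreviation N where "N \<equiv> case_sum \<xi> \<zeta>"

abbreviation past where
  "past K \<equiv> vimage_algebra (space M) (\<lambda>\<omega>. restrict (\<lambda>j. N j \<omega>) K) (PiM K (\<lambda>_. borel :: real measure))"

lemma indep_N: "indep_vars (\<lambda>_. borel) N UNIV"
  using noise unfolding ogt_noise_def by blast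

lemma measurable_\<xi> [measurable]: "\<xi> k \<in> borel_measurable M"
  and measurable_\<zeta> [measurable]: "\<zeta> k \<in> borel_measurable M"
proof -
  have "N i \<in> borel_measurable M" for i using indep_N unfolding indep_vars_def by simp
  from this[of "Inl k"] this[of "Inr k"] show "\<xi> k \<in> borel_measurable M" "\<zeta> k \<in> borel_measurable M" by simp_all
qed

lemma prob_noise:
  "prob {\<omega> \<in> space M. \<xi> k \<omega> = 1} = p" "prob {\<omega> \<in> space M. \<xi> k \<omega> = 0} = 1 - p"
  "prob {\<omega> \<in> space M. \<zeta> k \<omega> = 1 / q} = q" "prob {\<omega> \<in> space M. \<zeta> k \<omega> = 0} = 1 - q"
  using noise unfolding ogt_noise_def by blast+

text \<open>
  The full-measure event on which the noise only takes the values that carry its mass.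
\<close>
definition regular :: "'w \<Rightarrow> bool" where
  "regular \<omega> \<longleftrightarrow> (\<forall>k. \<xi> k \<omega> \<in> {0, 1} \<and> \<zeta> k \<omega> \<in> {0, 1 / q})"

lemma AE_two_values:
  fixes Y :: "'w \<Rightarrow> real"
  assumes "Y \<in> borel_measurable M" "a \<noteq> b"
    and "prob {\<omega> \<in> space M. Y \<omega> = a} = r" "prob {\<omega> \<in> space M. Y \<omega> = b} = 1 - r"
  shows "AE \<omega> in M. Y \<omega> \<in> {a, b}"
proof -
  have m: "{\<omega> \<in> space M. Y \<omega> = c} \<in> events" for c using assms(1) by measurable
  have "prob ({\<omega> \<in> space M. Y \<omega> = a} \<union> {\<omega> \<in> space M. Y \<omega> = b}) = r + (1 - r)"
    using assms by (subst finite_measure_Union[OF m m]) auto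
  then have "prob {\<omega> \<in> space M. Y \<omega> \<in> {a, b}} = 1"
    by (simp add: Un_def conj_disj_distribL)
  then have "AE \<omega> in M. \<omega> \<in> {\<omega> \<in> space M. Y \<omega> \<in> {a, b}}" by (rule prob_eq_1[THEN iffD1, rotated]) (use assms(1) in measurable)
  then show ?thesis by auto
qed

lemma AE_regular: "AE \<omega> in M. regular \<omega>"
  unfolding regular_def AE_all_countable
proof (intro allI AE_conjI)
  show "AE \<omega> in M. \<xi> k \<omega> \<in> {0, 1}" for k
    using AE_two_values[OF measurable_\<xi> _ prob_noise(1,2)] by (simp add: insert_commute)
  show "AE \<omega> in M. \<zeta> k \<omega> \<in> {0, 1 / q}" for k
    using AE_two_values[OF measurable_\<zeta> _ prob_noise(3,4)] q by (simp add: insert_commute)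
qed

lemma chain_measurable:
  assumes "\<And>j. j < k \<Longrightarrow> \<xi> j \<in> borel_measurable F" "\<And>j. j < k \<Longrightarrow> \<zeta> j \<in> borel_measurable F"
  shows "S k \<in> borel_measurable F"
  using assms
proof (induction k)
  case 0
  then show ?case by (simp add: S_0 cong: measurable_cong)
next
  case (Suc k)
  have "(\<lambda>\<omega>. (S k \<omega>, \<xi> k \<omega>, \<zeta> k \<omega>)) \<in> borel_measurable F"
    using Suc by (intro borel_measurable_Pair) auto
  from measurable_compose[OF this borel_measurable_continuous_onI[OF T]] show ?case
    by (simp add: S_Suc[abs_def])
qed

lemma chain_measurable_M [measurable]: "S k \<in> borel_measurable M"
  by (rule chain_measurable) measurable

text \<open>
  This finiteness makes every observable bounded almost surely, whatever its growth.
\<close>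
lemma finite_chain_range: "finite (S k ` {\<omega>. regular \<omega>})"
proof (induction k)
  case 0
  have "S 0 ` {\<omega>. regular \<omega>} \<subseteq> {s0}" by (auto simp: S_0)
  then show ?case by (rule finite_subset) simp
next
  case (Suc k)
  have "S (Suc k) ` {\<omega>. regular \<omega>} \<subseteq> (\<lambda>(s, a, b). T s a b) ` (S k ` {\<omega>. regular \<omega>} \<times> {0, 1} \<times> {0, 1 / q})"
    unfolding image_subset_iff
  proof safe
    fix \<omega> assume "regular \<omega>"
    then have "(S k \<omega>, \<xi> k \<omega>, \<zeta> k \<omega>) \<in> S k ` {\<omega>. regular \<omega>} \<times> {0, 1} \<times> {0, 1 / q}"
      unfolding regular_def by auto
    then show "S (Suc k) \<omega> \<in> (\<lambda>(s, a, b). T s a b) ` (S k ` {\<omega>. regular \<omega>} \<times> {0, 1} \<times> {0, 1 / q})"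
      unfolding S_Suc by (rule rev_image_eqI) simp
  qed
  then show ?case by (rule finite_subset) (use Suc in auto)
qed

lemma integrable_chain:
  fixes \<phi> :: "'s \<Rightarrow> real"
  assumes [measurable]: "\<phi> \<in> borel_measurable borel"
  shows "integrable M (\<lambda>\<omega>. \<phi> (S k \<omega>))"
proof -
  have "finite ((\<lambda>s. norm (\<phi> s)) ` S k ` {\<omega>. regular \<omega>})" using finite_chain_range by simp
  then have "norm (\<phi> (S k \<omega>)) \<le> Max ((\<lambda>s. norm (\<phi> s)) ` S k ` {\<omega>. regular \<omega>})" if "regular \<omega>" for \<omega>
    using that by (intro Max_ge) auto
  then show ?thesis
    using AE_regular by (intro integrable_const_bound[of _ "Max ((\<lambda>s. norm (\<phi> s)) ` S k ` {\<omega>. regular \<omega>})"]) auto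
qed

lemma measurable_N_past:
  assumes "i \<in> K"
  shows "N i \<in> borel_measurable (past K)"
proof -
  have "(\<lambda>\<omega>. restrict (\<lambda>j. N j \<omega>) K) \<in> measurable (past K) (PiM K (\<lambda>_. borel))"
    by (rule measurable_vimage_algebra1) (auto simp: space_PiM)
  from measurable_compose[OF this measurable_component_singleton[OF assms]] show ?thesis
    using assms by simp
qed

text \<open>
  \<open>S k\<close> depends on the noise before time \<open>k\<close> only. Independence is applied
  twice: to \<open>\<zeta> k\<close> against the past together with \<open>\<xi> k\<close>, and then
  to \<open>\<xi> k\<close> against the past.
\<close>
lemma integral_indicator_noise:
  fixes \<phi> :: "'s \<Rightarrow> real"
  assumes [measurable]: "\<phi> \<in> borel_measurable borel"
  shows "(\<integral>\<omega>. \<phi> (S k \<omega>) * indicator {a} (\<xi> k \<omega>) * indicator {b} (\<zeta> k \<omega>) \<partial>M)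
    = (\<integral>\<omega>. \<phi> (S k \<omega>) \<partial>M) * prob {\<omega> \<in> space M. \<xi> k \<omega> = a} * prob {\<omega> \<in> space M. \<zeta> k \<omega> = b}"
proof -
  let ?K = "Inl ` {..<k} \<union> Inr ` {..<k}"
  have ind: "(\<integral>\<omega>. indicator {c} (N i \<omega>) \<partial>M) = prob {\<omega> \<in> space M. N i \<omega> = c}" 
       "integrable M (\<lambda>\<omega>. indicator {c} (N i \<omega>) :: real)" for c :: real and i
  proof -
    have [measurable]: "N i \<in> borel_measurable M" using indep_N unfolding indep_vars_def by simp
    have e: "(indicator {c} (N i \<omega>) :: real) = indicator (N i -` {c}) \<omega>" for \<omega> by (simp add: indicator_def)
    have "N i -` {c} \<inter> space M = {\<omega> \<in> space M. N i \<omega> = c}" by auto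
    then show "(\<integral>\<omega>. indicator {c} (N i \<omega>) \<partial>M) = prob {\<omega> \<in> space M. N i \<omega> = c}" unfolding e by simp
    show "integrable M (\<lambda>\<omega>. indicator {c} (N i \<omega>) :: real)"
      by (rule integrable_const_bound[of _ 1]) (auto simp: indicator_def)
  qed
  have Sm: "S k \<in> borel_measurable (past K)" if "?K \<subseteq> K" for K
  proof (rule chain_measurable)
    fix j assume "j < k"
    then have "Inl j \<in> K" "Inr j \<in> K" using that by auto
    from measurable_N_past[OF this(1)] measurable_N_past[OF this(2)]
    show "\<xi> j \<in> borel_measurable (past K)" "\<zeta> j \<in> borel_measurable (past K)" by simp_all
  qed
  have int: "integrable M (\<lambda>\<omega>. \<phi> (S k \<omega>))" by (rule integrable_chain) measurable
  have int2: "integrable M (\<lambda>\<omega>. \<phi> (S k \<omega>) * indicator {a} (\<xi> k \<omega>))"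
    by (rule Bochner_Integration.integrable_bound[OF int]) (auto simp: indicator_def)
  have "(\<integral>\<omega>. (\<phi> (S k \<omega>) * indicator {a} (N (Inl k) \<omega>)) * indicator {b} (N (Inr k) \<omega>) \<partial>M)
    = (\<integral>\<omega>. \<phi> (S k \<omega>) * indicator {a} (N (Inl k) \<omega>) \<partial>M) * (\<integral>\<omega>. indicator {b} (N (Inr k) \<omega>) \<partial>M)"
  proof (rule indep_past_integral[OF indep_N, where K = "insert (Inl k) ?K"])
    have "(\<lambda>\<omega>. indicator {a} (N (Inl k) \<omega>) :: real) \<in> borel_measurable (past (insert (Inl k) ?K))"
      by (rule measurable_compose[OF measurable_N_past borel_measurable_indicator]) auto
    moreover have "(\<lambda>\<omega>. \<phi> (S k \<omega>)) \<in> borel_measurable (past (insert (Inl k) ?K))"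
      by (rule measurable_compose[OF Sm assms]) auto
    ultimately show "(\<lambda>\<omega>. \<phi> (S k \<omega>) * indicator {a} (N (Inl k) \<omega>)) \<in> borel_measurable (past (insert (Inl k) ?K))"
      by (intro borel_measurable_times)
    show "integrable M (\<lambda>\<omega>. \<phi> (S k \<omega>) * indicator {a} (N (Inl k) \<omega>))" using int2 by simp
    show "integrable M (\<lambda>\<omega>. indicator {b} (N (Inr k) \<omega>) :: real)" by (rule ind(2))
  qed auto
  also have "(\<integral>\<omega>. \<phi> (S k \<omega>) * indicator {a} (N (Inl k) \<omega>) \<partial>M)
    = (\<integral>\<omega>. \<phi> (S k \<omega>) \<partial>M) * (\<integral>\<omega>. indicator {a} (N (Inl k) \<omega>) \<partial>M)"
  proof (rule indep_past_integral[OF indep_N, where K = ?K])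
    show "(\<lambda>\<omega>. \<phi> (S k \<omega>)) \<in> borel_measurable (past ?K)"
      by (rule measurable_compose[OF Sm assms]) auto
    show "integrable M (\<lambda>\<omega>. indicator {a} (N (Inl k) \<omega>) :: real)" by (rule ind(2))
  qed (use int in auto)
  finally show ?thesis unfolding ind by simp
qed

lemma expectation_Suc:
  fixes \<phi> :: "'s \<Rightarrow> real"
  assumes \<phi>: "\<phi> \<in> borel_measurable borel"
  shows "(\<integral>\<omega>. \<phi> (S (Suc k) \<omega>) \<partial>M) = (\<integral>\<omega>. noise_avg p q (\<lambda>a b. \<phi> (T (S k \<omega>) a b)) \<partial>M)"
proof -
  let ?h = "\<lambda>a b \<omega>. \<phi> (T (S k \<omega>) a b)"
  let ?g = "\<lambda>a b \<omega>. ?h a b \<omega> * indicator {a} (\<xi> k \<omega>) * indicator {b} (\<zeta> k \<omega>)"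
  have m: "(\<lambda>s. \<phi> (T s a b)) \<in> borel_measurable borel" for a b
  proof -
    have "continuous_on UNIV (\<lambda>s. (\<lambda>(s, a, b). T s a b) (s, a, b))"
      by (rule continuous_on_compose2[OF T]) (auto intro!: continuous_intros)
    then have "(\<lambda>s. T s a b) \<in> borel_measurable borel" by (simp add: borel_measurable_continuous_onI)
    then show ?thesis using \<phi> by (rule measurable_compose)
  qed
  have ih: "integrable M (?h a b)" for a b by (rule integrable_chain[OF m])
  have ig: "integrable M (?g a b)" for a b
    by (rule Bochner_Integration.integrable_bound[OF ih[of a b]]) (use ih[of a b, THEN borel_measurable_integrable] in \<open>auto simp: indicator_def\<close>)
  have "(\<integral>\<omega>. \<phi> (S (Suc k) \<omega>) \<partial>M) = (\<integral>\<omega>. (?g 1 (1 / q) \<omega> + ?g 1 0 \<omega>) + (?g 0 (1 / q) \<omega> + ?g 0 0 \<omega>) \<partial>M)"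
  proof (rule integral_cong_AE)
    show "AE \<omega> in M. \<phi> (S (Suc k) \<omega>) = (?g 1 (1 / q) \<omega> + ?g 1 0 \<omega>) + (?g 0 (1 / q) \<omega> + ?g 0 0 \<omega>)"
      using AE_regular
    proof eventually_elim
      case (elim \<omega>)
      then have "\<xi> k \<omega> \<in> {0, 1}" "\<zeta> k \<omega> \<in> {0, 1 / q}" unfolding regular_def by blast+
      then show ?case using q by (auto simp: S_Suc)
    qed
  qed (use ig integrable_chain[OF \<phi>] in auto)
  also have "\<dots> = (\<integral>\<omega>. ?h 1 (1 / q) \<omega> \<partial>M) * p * q + (\<integral>\<omega>. ?h 1 0 \<omega> \<partial>M) * p * (1 - q)
      + ((\<integral>\<omega>. ?h 0 (1 / q) \<omega> \<partial>M) * (1 - p) * q + (\<integral>\<omega>. ?h 0 0 \<omega> \<partial>M) * (1 - p) * (1 - q))"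
    using ig by (simp add: integral_indicator_noise[OF m] prob_noise)
  also have "\<dots> = (\<integral>\<omega>. noise_avg p q (\<lambda>a b. ?h a b \<omega>) \<partial>M)"
    unfolding noise_avg_def using ih by (simp add: algebra_simps)
  finally show ?thesis .
qed

lemma expectation_Suc_le:
  fixes \<phi> \<psi> :: "'s \<Rightarrow> real"
  assumes \<phi>: "continuous_on UNIV \<phi>" and \<psi>: "continuous_on UNIV \<psi>"
    and P: "\<And>\<omega>. regular \<omega> \<Longrightarrow> P (S k \<omega>)"
    and le: "\<And>s. P s \<Longrightarrow> noise_avg p q (\<lambda>a b. \<phi> (T s a b)) \<le> \<psi> s"
  shows "(\<integral>\<omega>. \<phi> (S (Suc k) \<omega>) \<partial>M) \<le> (\<integral>\<omega>. \<psi> (S k \<omega>) \<partial>M)"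
proof -
  have "continuous_on UNIV (\<lambda>s. \<phi> ((\<lambda>(s, a, b). T s a b) (s, a, b)))" for a b
    by (intro continuous_on_compose2[OF \<phi>] continuous_on_compose2[OF T]) (auto intro!: continuous_intros)
  then have c: "continuous_on UNIV (\<lambda>s. noise_avg p q (\<lambda>a b. \<phi> (T s a b)))"
    unfolding noise_avg_def by (intro continuous_intros) auto
  have "(\<integral>\<omega>. \<phi> (S (Suc k) \<omega>) \<partial>M) = (\<integral>\<omega>. noise_avg p q (\<lambda>a b. \<phi> (T (S k \<omega>) a b)) \<partial>M)"
    by (rule expectation_Suc[OF borel_measurable_continuous_onI[OF \<phi>]])
  also have "\<dots> \<le> (\<integral>\<omega>. \<psi> (S k \<omega>) \<partial>M)"
  proof (rule integral_mono_AE)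
    show "AE \<omega> in M. noise_avg p q (\<lambda>a b. \<phi> (T (S k \<omega>) a b)) \<le> \<psi> (S k \<omega>)"
      using AE_regular by eventually_elim (intro le P)
  qed (intro integrable_chain[OF borel_measurable_continuous_onI] c \<psi>)+
  finally show ?thesis .
qed

end

section \<open>The iteration as a Markov chain\<close>

lemma psd_form_add_le:
  fixes N :: "'a::real_vector \<Rightarrow> 'a \<Rightarrow> real"
  assumes N: "bilinear N" "\<And>s t. N s t = N t s" "\<And>s. 0 \<le> N s s" and t: "0 < t"
  shows "N (a + b) (a + b) \<le> (1 + t) * N a a + (1 + 1 / t) * N b b"
    and "2 * N a b \<le> t * N a a + 1 / t * N b b"
proof -
  have "0 \<le> N (t *\<^sub>R a - b) (t *\<^sub>R a - b) / t" using N(3) t by simp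
  also have "N (t *\<^sub>R a - b) (t *\<^sub>R a - b) = t * (t * N a a) - t * (2 * N a b) + N b b"
    using N(2)[of b a] by (simp add: bilinear_lsub[OF N(1)] bilinear_rsub[OF N(1)] bilinear_lmul[OF N(1)] bilinear_rmul[OF N(1)] algebra_simps)
  finally show 1: "2 * N a b \<le> t * N a a + 1 / t * N b b"
    using t by (simp add: field_simps)
  have "N (a + b) (a + b) = N a a + 2 * N a b + N b b"
    using N(2)[of b a] by (simp add: bilinear_ladd[OF N(1)] bilinear_radd[OF N(1)])
  then show "N (a + b) (a + b) \<le> (1 + t) * N a a + (1 + 1 / t) * N b b"
    using 1 by (simp add: algebra_simps)
qed

lemma norm_add_squared_le:
  fixes a b :: "'a::real_inner"
  assumes "0 < t"
  shows "(norm (a + b))\<^sup>2 \<le> (1 + t) * (norm a)\<^sup>2 + (1 + 1 / t) * (norm b)\<^sup>2"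
  unfolding dot_square_norm[symmetric]
  by (rule psd_form_add_le(1)) (use assms in \<open>auto simp: bilinear_def linear_iff inner_add_left inner_add_right inner_commute\<close>)

text \<open>
  Since \<open>theta_w \<theta> = 1 - 1 / sqrt (1 + s)\<close> with
  \<open>s = sqrt (1 - (1 - \<theta>)^2) \<ge> sqrt \<theta>\<close>, the acceleration turns the
  spectral gap \<open>\<theta>\<close> into one of order \<open>sqrt \<theta>\<close>.
\<close>
lemma theta_w_bounds:
  assumes "0 < \<theta>" "\<theta> \<le> 1"
  shows "0 < theta_w \<theta>" "theta_w \<theta> < 1" "sqrt \<theta> / 4 \<le> theta_w \<theta>"
proof -
  define s where "s = sqrt (1 - (1 - \<theta>)\<^sup>2)"
  have "sqrt \<theta> \<le> s" unfolding s_def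
    using assms by (intro real_sqrt_le_mono) (simp add: power2_eq_square algebra_simps mult_left_le)
  moreover have "0 < sqrt \<theta>" using assms by simp
  ultimately have s0: "0 < s" by linarith
  have s1: "s \<le> 1" unfolding s_def by simp
  have eta: "eta_w \<theta> = 1 / (1 + s)"
    unfolding eta_w_def eta_root_def s_def[symmetric] using s0 by (simp add: field_simps)
  have "1 / (1 + s) \<le> (1 - s / 4)\<^sup>2"
  proof -
    have "0 \<le> s * (8 - 7 * s) + s * (s * s)" using s0 s1 by (intro add_nonneg_nonneg mult_nonneg_nonneg) auto
    moreover have "16 * ((1 - s / 4)\<^sup>2 * (1 + s)) = 16 + (s * (8 - 7 * s) + s * (s * s))"
      by (simp add: power2_eq_square field_simps)
    ultimately have "1 \<le> (1 - s / 4)\<^sup>2 * (1 + s)" by linarith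
    then show ?thesis using s0 by (simp add: pos_divide_le_eq)
  qed
  then have "rho_w \<theta> \<le> 1 - s / 4"
    unfolding rho_w_def eta using s1 by (intro real_le_lsqrt) auto
  then show "sqrt \<theta> / 4 \<le> theta_w \<theta>" "0 < theta_w \<theta>"
    unfolding theta_w_def using \<open>sqrt \<theta> \<le> s\<close> s0 by auto
  show "theta_w \<theta> < 1" unfolding theta_w_def rho_w_def eta using s0 by simp
qed

locale ogt_run = ogt f gradf W L \<theta> xs X0 \<alpha> \<beta> \<gamma> \<tau> p q \<eta> M \<xi> \<zeta>
  for f :: "'n::finite \<Rightarrow> real^'d \<Rightarrow> real" and gradf :: "'n \<Rightarrow> real^'d \<Rightarrow> real^'d" and W :: "real^'n^'n"
    and L \<theta> xs X0 \<alpha> \<beta> \<gamma> \<tau> p q \<eta> and M :: "'w measure" and \<xi> \<zeta> +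
  fixes \<mu> :: real and Edges :: "('n \<times> 'n) set"
  assumes \<mu>: "0 < \<mu>" and \<mu>L: "\<mu> \<le> L"
    and f: "\<And>i. smooth_strongly_convex \<mu> L (f i) (gradf i)"
    and minimizer: "unique_minimizer (obj_avg f) xs"
    and gossip: "gossip_matrix Edges W \<theta>"
    and params: "ogt_params_range \<alpha> \<beta> \<gamma> \<tau> p q \<eta>"
    and ogt_noise: "ogt_noise p q M \<xi> \<zeta>"
    and conds: "ogt_conditions CARD('n) \<mu> L \<theta> \<alpha> \<beta> \<gamma> \<tau> p q \<eta>"
begin

declare X.simps [simp del] Y.simps [simp del] Q.simps [simp del] Zt.simps [simp del] Ut.simps [simp del] Gt.simps [simp del]

lemma L: "0 < L" using \<mu> \<mu>L by simp

lemma ranges: "0 < \<alpha>" "\<alpha> < 1" "0 < \<beta>" "\<beta> < 1" "0 < \<gamma>" "\<gamma> < 1" "0 < \<tau>" "\<tau> < 1" "0 < p" "p < 1" "0 < q" "q < 1" "0 < \<eta>"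
  using params unfolding ogt_params_range_def by auto

abbreviation \<theta>w where "\<theta>w \<equiv> theta_w \<theta>"

lemma \<theta>: "0 < \<theta>" "\<theta> \<le> 1" using gossip unfolding gossip_matrix_def by auto

lemma \<theta>w: "0 < \<theta>w" "\<theta>w < 1" using theta_w_bounds[OF \<theta>] by auto

type_synonym ('m, 'e) ogt_state = "(real^'e^'m) \<times> (real^'e^'m) \<times> (real^'e^('m + 'm)) \<times> (real^'e^('m + 'm)) \<times> (real^'e^('m + 'm))"

definition sY :: "('n, 'd) ogt_state \<Rightarrow> real^'d^'n" where "sY s = fst s"
definition sQ :: "('n, 'd) ogt_state \<Rightarrow> real^'d^'n" where "sQ s = fst (snd s)"
definition sZ :: "('n, 'd) ogt_state \<Rightarrow> real^'d^('n + 'n)" where "sZ s = fst (snd (snd s))"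
definition sU :: "('n, 'd) ogt_state \<Rightarrow> real^'d^('n + 'n)" where "sU s = fst (snd (snd (snd s)))"
definition sG :: "('n, 'd) ogt_state \<Rightarrow> real^'d^('n + 'n)" where "sG s = snd (snd (snd (snd s)))"
definition sX :: "('n, 'd) ogt_state \<Rightarrow> real^'d^'n" where
  "sX s = (1 - \<alpha> - \<tau>) *\<^sub>R sY s + \<alpha> *\<^sub>R upper (sZ s) + \<tau> *\<^sub>R upper (sU s)"

definition next_Z :: "('n, 'd) ogt_state \<Rightarrow> real \<Rightarrow> real^'d^('n + 'n)" where
  "next_Z s b = (1 / (1 + \<beta>)) *\<^sub>R (W_tilde \<theta> W **
     (sZ s + \<beta> *\<^sub>R stack2 (sX s) - \<eta> *\<^sub>R stack2 (upper (sG s)) + (\<eta> * b) *\<^sub>R (stack2 (gradF (sQ s)) - stack2 (gradF (sX s)))))"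

definition next_state :: "('n, 'd) ogt_state \<Rightarrow> real \<Rightarrow> real \<Rightarrow> ('n, 'd) ogt_state" where
  "next_state s a b =
    (sX s + \<gamma> *\<^sub>R (upper (next_Z s b) - upper (sZ s)),
     (1 - a) *\<^sub>R sQ s + a *\<^sub>R sX s,
     next_Z s b,
     W_tilde \<theta> W ** ((1 - a) *\<^sub>R sU s + a *\<^sub>R stack2 (sX s)),
     W_tilde \<theta> W ** sG s + a *\<^sub>R (stack2 (gradF (sX s)) - stack2 (gradF (sQ s))))"

lemma next_state_simps [simp]:
  "sY (next_state s a b) = sX s + \<gamma> *\<^sub>R (upper (next_Z s b) - upper (sZ s))"
  "sQ (next_state s a b) = (1 - a) *\<^sub>R sQ s + a *\<^sub>R sX s"
  "sZ (next_state s a b) = next_Z s b"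
  "sU (next_state s a b) = W_tilde \<theta> W ** ((1 - a) *\<^sub>R sU s + a *\<^sub>R stack2 (sX s))"
  "sG (next_state s a b) = W_tilde \<theta> W ** sG s + a *\<^sub>R (stack2 (gradF (sX s)) - stack2 (gradF (sQ s)))"
  unfolding sY_def sQ_def sZ_def sU_def sG_def next_state_def by simp_all

definition state :: "nat \<Rightarrow> 'w \<Rightarrow> ('n, 'd) ogt_state" where
  "state k \<omega> = (Y k \<omega>, Q k \<omega>, Zt k \<omega>, Ut k \<omega>, Gt k \<omega>)"

lemma state_simps [simp]:
  "sY (state k \<omega>) = Y k \<omega>" "sQ (state k \<omega>) = Q k \<omega>" "sZ (state k \<omega>) = Zt k \<omega>"
  "sU (state k \<omega>) = Ut k \<omega>" "sG (state k \<omega>) = Gt k \<omega>" "sX (state k \<omega>) = X k \<omega>"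
  unfolding sX_def by (simp_all add: sY_def sQ_def sZ_def sU_def sG_def state_def X.simps)

lemma continuous_on_linear:
  fixes h :: "'a::euclidean_space \<Rightarrow> 'b::euclidean_space"
  assumes "linear h" "continuous_on S g"
  shows "continuous_on S (\<lambda>x. h (g x))"
  using assms by (intro continuous_on_compose2[OF linear_continuous_on[of h UNIV]]) (auto simp: linear_conv_bounded_linear)

lemmas continuous_on_matrix_ops [continuous_intros] =
  continuous_on_linear[OF linear_upper] continuous_on_linear[OF linear_stack2]
  continuous_on_linear[OF linear_matrix_mult] continuous_on_linear[OF linear_row_avg]

lemma continuous_on_gradF [continuous_intros]:
  assumes "continuous_on S g"
  shows "continuous_on S (\<lambda>x. gradF (g x))"
proof -
  have "continuous_on UNIV (gradf i)" for i
    using f[of i] L unfolding smooth_strongly_convex_def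
    by (intro lipschitz_on_continuous_on[of L] lipschitz_onI) (auto simp: dist_norm)
  then have "continuous_on S (\<lambda>x. gradf i (g x $ i))" for i
    using continuous_on_compose2[of UNIV "gradf i" S "\<lambda>x. g x $ i"] assms by (auto intro: continuous_intros)
  then show ?thesis unfolding gradF_def by (rule continuous_on_vec_lambda)
qed

lemma continuous_on_state [continuous_intros]:
  assumes "continuous_on S g"
  shows "continuous_on S (\<lambda>x. sY (g x))" "continuous_on S (\<lambda>x. sQ (g x))" "continuous_on S (\<lambda>x. sZ (g x))"
    "continuous_on S (\<lambda>x. sU (g x))" "continuous_on S (\<lambda>x. sG (g x))" "continuous_on S (\<lambda>x. sX (g x))"
  unfolding sX_def sY_def sQ_def sZ_def sU_def sG_def
  by (rule continuous_intros assms)+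

lemma continuous_next_state: "continuous_on UNIV (\<lambda>(s, a, b). next_state s a b)"
  unfolding case_prod_beta next_state_def next_Z_def by (intro continuous_intros)

sublocale noise_driven_chain p q M \<xi> \<zeta> state "(X0, X0, stack2 X0, stack2 X0, stack2 (gradF X0))" next_state
proof
  show "ogt_noise p q M \<xi> \<zeta>" by (rule ogt_noise)
  show "continuous_on UNIV (\<lambda>(s, a, b). next_state s a b)" by (rule continuous_next_state)
  show "state 0 \<omega> = (X0, X0, stack2 X0, stack2 X0, stack2 (gradF X0))" for \<omega>
    unfolding state_def by (simp add: Y.simps Q.simps Zt.simps Ut.simps Gt.simps)
  show "state (Suc k) \<omega> = next_state (state k \<omega>) (\<xi> k \<omega>) (\<zeta> k \<omega>)" for k \<omega>
    unfolding next_state_def next_Z_def state_simps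
    by (simp add: state_def Y.simps(2) Q.simps(2) Zt.simps(2) Ut.simps(2) Gt.simps(2))
qed (use ranges in auto)

text \<open>
  The invariants behind the averaged dynamics. The last one says that the tracker \<open>Gt\<close>
  averages to the mean gradient at \<open>Q\<close>; it survives an update only if
  \<open>\<xi> k\<close> is \<open>0\<close> or \<open>1\<close>.
\<close>
definition balanced :: "('n, 'd) ogt_state \<Rightarrow> bool" where
  "balanced s \<longleftrightarrow>
     row_avg (upper (sZ s)) = row_avg (lower (sZ s)) \<and>
     row_avg (upper (sU s)) = row_avg (lower (sU s)) \<and>
     row_avg (upper (sG s)) = row_avg (lower (sG s)) \<and>
     row_avg (upper (sU s)) = row_avg (sQ s) \<and>
     row_avg (upper (sG s)) = row_avg (gradF (sQ s))"

lemmas linear_ops =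
  linear_add[OF linear_upper] linear_diff[OF linear_upper] linear_scale[OF linear_upper]
  linear_add[OF linear_lower] linear_diff[OF linear_lower] linear_scale[OF linear_lower]
  linear_add[OF linear_row_avg] linear_diff[OF linear_row_avg] linear_scale[OF linear_row_avg]

lemma row_avg_W_tilde:
  assumes "row_avg (upper S) = row_avg (lower S)"
  shows "row_avg (upper (W_tilde \<theta> W ** S)) = row_avg (upper S)" "row_avg (lower (W_tilde \<theta> W ** S)) = row_avg (upper S)"
  using assms by (simp_all add: W_tilde_upper W_tilde_lower linear_ops gossip_row_avg[OF gossip] algebra_simps)

lemma balanced_next_Z:
  assumes "balanced s"
  shows "row_avg (upper (next_Z s b)) = (1 / (1 + \<beta>)) *\<^sub>R (row_avg (upper (sZ s)) + \<beta> *\<^sub>R row_avg (sX s)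
      - \<eta> *\<^sub>R (row_avg (gradF (sQ s)) + b *\<^sub>R (row_avg (gradF (sX s)) - row_avg (gradF (sQ s)))))"
    and "row_avg (lower (next_Z s b)) = row_avg (upper (next_Z s b))"
proof -
  let ?S = "sZ s + \<beta> *\<^sub>R stack2 (sX s) - \<eta> *\<^sub>R stack2 (upper (sG s)) + (\<eta> * b) *\<^sub>R (stack2 (gradF (sQ s)) - stack2 (gradF (sX s)))"
  have e: "row_avg (upper ?S) = row_avg (lower ?S)" using assms by (simp add: linear_ops balanced_def)
  show "row_avg (lower (next_Z s b)) = row_avg (upper (next_Z s b))"
    unfolding next_Z_def using row_avg_W_tilde[OF e] by (simp add: linear_ops)
  show "row_avg (upper (next_Z s b)) = (1 / (1 + \<beta>)) *\<^sub>R (row_avg (upper (sZ s)) + \<beta> *\<^sub>R row_avg (sX s)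
      - \<eta> *\<^sub>R (row_avg (gradF (sQ s)) + b *\<^sub>R (row_avg (gradF (sX s)) - row_avg (gradF (sQ s)))))"
    unfolding next_Z_def linear_ops(3) linear_ops(9) row_avg_W_tilde(1)[OF e]
    using assms[unfolded balanced_def, THEN conjunct2, THEN conjunct2, THEN conjunct2, THEN conjunct2]
    by (simp add: linear_ops algebra_simps)
qed

lemma balanced_next_state:
  assumes "balanced s" "a \<in> {0, 1}"
  shows "balanced (next_state s a b)"
proof -
  have u: "row_avg (upper ((1 - a) *\<^sub>R sU s + a *\<^sub>R stack2 (sX s))) = row_avg (lower ((1 - a) *\<^sub>R sU s + a *\<^sub>R stack2 (sX s)))"
    and g: "row_avg (upper (sG s)) = row_avg (lower (sG s))"
    using assms by (simp_all add: linear_ops balanced_def)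
  show ?thesis
    using assms unfolding balanced_def
    by (auto simp: balanced_next_Z(2)[OF assms(1)] linear_ops row_avg_W_tilde[OF u] row_avg_W_tilde[OF g] row_avg_W_tilde)
qed

lemma balanced_state: "regular \<omega> \<Longrightarrow> balanced (state k \<omega>)"
proof (induction k)
  case 0
  then show ?case unfolding S_0 by (simp add: balanced_def sZ_def sU_def sG_def sQ_def)
next
  case (Suc k)
  then have "\<xi> k \<omega> \<in> {0, 1}" unfolding regular_def by blast
  then show ?case unfolding S_Suc using Suc by (intro balanced_next_state) auto
qed

lemma integrable_state:
  fixes \<phi> :: "('n, 'd) ogt_state \<Rightarrow> real"
  assumes "continuous_on UNIV \<phi>"
  shows "integrable M (\<lambda>\<omega>. \<phi> (state k \<omega>))"
  using assms by (intro integrable_chain borel_measurable_continuous_onI)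

end

section \<open>Consensus errors of the gossiped iterates\<close>

context ogt_run
begin

lemma cond_contraction:
    "2 * (1 - \<tau>) / (2 - \<tau>) + 192 * c5 * (1 - \<tau>) * \<gamma>\<^sup>2 * \<beta>\<^sup>2 / (\<tau> * \<theta>w\<^sup>2) + \<tau> / 4 + 16 * c5 * p / \<theta>w \<le> 1 - \<tau> / 8"
    "\<alpha>\<^sup>2 / ((1 - \<tau>) * \<gamma>\<^sup>2) \<le> 1"
    "192 * c5 * (1 - \<tau>) * \<gamma>\<^sup>2 * \<eta>\<^sup>2 * L\<^sup>2 / (\<tau> * \<theta>w) \<le> \<theta>w / 2"
  and cond_coupling:
    "2 * \<eta> * L\<^sup>2 / (q * real CARD('n)) \<le> c3 CARD('n) L \<alpha> \<gamma> \<tau> / 2"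
    "c5 * c3 CARD('n) L \<alpha> \<gamma> \<tau> * c2_tilde \<theta> L \<gamma> \<tau> p q \<eta> \<le> \<eta> / (2 * q * real CARD('n))"
    "8 * \<eta> * L / q \<le> \<tau> / \<alpha>"
  and cond_descent:
    "L * \<gamma> \<le> 1 / (4 * \<eta>)" "\<beta> / (2 * \<eta>) \<le> \<mu> / 4"
    "1 / \<gamma> - (1 - \<alpha> - \<tau>) / \<alpha> - 1 / 2 \<le> 0" "(1 - \<alpha> - \<tau>) / \<alpha> \<le> 1 / \<gamma> - 1 / 4"
  using conds unfolding ogt_conditions_def by blast+

text \<open>
  The tracker is refreshed more slowly than gossip averages. This keeps the drift caused by the mean
  of \<open>\<xi>\<close> from exceeding the contribution of its variance in the bound for
  \<open>Gt\<close>.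
\<close>
lemma p_le_\<theta>w: "p \<le> \<theta>w"
proof -
  have "0 \<le> 2 * (1 - \<tau>) / (2 - \<tau>)" "0 \<le> 192 * c5 * (1 - \<tau>) * \<gamma>\<^sup>2 * \<beta>\<^sup>2 / (\<tau> * \<theta>w\<^sup>2)"
    using ranges by (simp_all add: c5_def)
  then have "16 * c5 * p / \<theta>w \<le> 1" using cond_contraction(1) ranges by linarith
  then show ?thesis using \<theta>w ranges by (simp add: c5_def pos_divide_le_eq)
qed

text \<open>
  One fixed choice of the form provided by \<open>exists_consensus_form\<close>; all later bounds
  refer to the same form.
\<close>
definition cform :: "real^'d^('n + 'n) \<Rightarrow> real^'d^('n + 'n) \<Rightarrow> real" where
  "cform = (SOME N. bilinear N \<and> (\<forall>s t. N s t = N t s) \<and> (\<forall>s. (norm (proj_matrix ** upper s))\<^sup>2 \<le> N s s) \<and>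
    (\<forall>A. N (stack2 A) (stack2 A) \<le> c5 * (norm (proj_matrix ** A))\<^sup>2) \<and>
    (\<forall>s. N (W_tilde \<theta> W ** s) (W_tilde \<theta> W ** s) = (1 - \<theta>w)\<^sup>2 * N s s))"

lemma cform:
  shows bilinear_cform: "bilinear cform" and cform_sym: "cform s t = cform t s"
    and cform_upper: "consensus_err (upper s) \<le> cform s s"
    and cform_stack2: "cform (stack2 A) (stack2 A) \<le> c5 * consensus_err A"
    and cform_W_tilde: "cform (W_tilde \<theta> W ** s) (W_tilde \<theta> W ** s) = (1 - \<theta>w)\<^sup>2 * cform s s"
proof -
  have "\<exists>N :: real^'d^('n + 'n) \<Rightarrow> real^'d^('n + 'n) \<Rightarrow> real. bilinear N \<and> (\<forall>s t. N s t = N t s) \<and> (\<forall>s. (norm (proj_matrix ** upper s))\<^sup>2 \<le> N s s) \<and>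
    (\<forall>A. N (stack2 A) (stack2 A) \<le> c5 * (norm (proj_matrix ** A))\<^sup>2) \<and>
    (\<forall>s. N (W_tilde \<theta> W ** s) (W_tilde \<theta> W ** s) = (1 - \<theta>w)\<^sup>2 * N s s)"
    by (rule exists_consensus_form[OF gossip]) blast
  from someI_ex[OF this] show "bilinear cform" "cform s t = cform t s" "consensus_err (upper s) \<le> cform s s"
    "cform (stack2 A) (stack2 A) \<le> c5 * consensus_err A"
    "cform (W_tilde \<theta> W ** s) (W_tilde \<theta> W ** s) = (1 - \<theta>w)\<^sup>2 * cform s s"
    unfolding cform_def[symmetric] consensus_err_def by blast+
qed

lemma consensus_err_nonneg [simp]: "0 \<le> consensus_err A"
  unfolding consensus_err_def by simp

lemma cform_nonneg [simp]: "0 \<le> cform s s"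
  using cform_upper[of s] consensus_err_nonneg[of "upper s"] by linarith

lemma consensus_err_le_norm: "consensus_err A \<le> (norm A)\<^sup>2"
  using norm_squared_row_avg_proj[of A] unfolding consensus_err_def by simp

lemmas cform_young = psd_form_add_le[OF bilinear_cform cform_sym cform_nonneg]

lemmas cform_linear = bilinear_ladd[OF bilinear_cform] bilinear_radd[OF bilinear_cform]
  bilinear_lsub[OF bilinear_cform] bilinear_rsub[OF bilinear_cform]
  bilinear_lmul[OF bilinear_cform] bilinear_rmul[OF bilinear_cform]

lemma continuous_on_cform [continuous_intros]:
  assumes "continuous_on S g"
  shows "continuous_on S (\<lambda>x. cform (g x) (g x))"
  using bilinear_cform by (intro bounded_bilinear.continuous_on[OF _ assms assms]) (simp only: bilinear_conv_bounded_bilinear)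

lemma continuous_on_consensus_err [continuous_intros]:
  "continuous_on S g \<Longrightarrow> continuous_on S (\<lambda>x. consensus_err (g x))"
  unfolding consensus_err_def by (intro continuous_intros)

definition grad_gap :: "('n, 'd) ogt_state \<Rightarrow> real" where
  "grad_gap s = (norm (gradF (sX s) - gradF (sQ s)))\<^sup>2"

lemma continuous_on_grad_gap [continuous_intros]:
  "continuous_on S g \<Longrightarrow> continuous_on S (\<lambda>x. grad_gap (g x))"
  unfolding grad_gap_def by (intro continuous_intros)

lemma grad_gap_nonneg [simp]: "0 \<le> grad_gap s" unfolding grad_gap_def by simp

lemma cform_grad_gap:
  "cform (stack2 (gradF (sX s)) - stack2 (gradF (sQ s))) (stack2 (gradF (sX s)) - stack2 (gradF (sQ s))) \<le> c5 * grad_gap s"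
proof -
  have "cform (stack2 (gradF (sX s) - gradF (sQ s))) (stack2 (gradF (sX s) - gradF (sQ s))) \<le> c5 * grad_gap s"
    unfolding grad_gap_def
    by (rule order_trans[OF cform_stack2]) (auto simp: c5_def consensus_err_le_norm)
  then show ?thesis by (simp add: linear_diff[OF linear_stack2])
qed

text \<open>
  A refresh happens with probability \<open>p\<close>, so the cross term has weight
  \<open>2 p\<close>. Young's inequality with parameter \<open>theta_w / p\<close> spends
  \<open>theta_w\<close> of the contraction on it and leaves \<open>p^2 / theta_w \<le> p\<close>
  for the gradient gap.
\<close>
lemma cform_G_step:
  "noise_avg p q (\<lambda>a b. cform (sG (next_state s a b)) (sG (next_state s a b)))
    \<le> (1 - \<theta>w) * cform (sG s) (sG s) + 2 * c5 * p * grad_gap s" (is "?l \<le> _")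
proof -
  define x where "x = W_tilde \<theta> W ** sG s"
  define d where "d = stack2 (gradF (sX s)) - stack2 (gradF (sQ s))"
  have "cform (x + d) (x + d) = cform x x + 2 * cform x d + cform d d"
    using cform_sym[of d x] by (simp add: cform_linear)
  then have "?l
     = cform x x + p * (2 * cform x d) + p * cform d d"
    unfolding next_state_simps x_def[symmetric] d_def[symmetric] by (simp add: noise_avg_def algebra_simps)
  also have "p * (2 * cform x d) \<le> p * (\<theta>w / p * cform x x + 1 / (\<theta>w / p) * cform d d)"
    using ranges \<theta>w by (intro mult_left_mono cform_young(2)) auto
  also have "\<dots> = \<theta>w * cform x x + p * (p / \<theta>w) * cform d d"
    using ranges by (simp add: distrib_left)
  also have "p * (p / \<theta>w) * cform d d \<le> p * 1 * cform d d"
    using ranges p_le_\<theta>w \<theta>w by (intro mult_mono mult_left_mono) auto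
  finally have "?l
     \<le> (1 + \<theta>w) * cform x x + 2 * p * cform d d" by (simp add: algebra_simps)
  also have "\<dots> \<le> (1 - \<theta>w) * cform (sG s) (sG s) + 2 * p * (c5 * grad_gap s)"
  proof (intro add_mono mult_left_mono cform_grad_gap[of s, folded d_def])
    have "(1 + \<theta>w) * cform x x = (1 - \<theta>w\<^sup>2) * ((1 - \<theta>w) * cform (sG s) (sG s))"
      unfolding x_def cform_W_tilde by (simp add: power2_eq_square algebra_simps)
    also have "\<dots> \<le> 1 * ((1 - \<theta>w) * cform (sG s) (sG s))"
      using \<theta>w by (intro mult_right_mono) auto
    finally show "(1 + \<theta>w) * cform x x \<le> (1 - \<theta>w) * cform (sG s) (sG s)" by simp
  qed (use ranges in auto)
  finally have "?l
     \<le> (1 - \<theta>w) * cform (sG s) (sG s) + 2 * p * (c5 * grad_gap s)" .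
  moreover have "2 * p * (c5 * grad_gap s) = 2 * c5 * p * grad_gap s" by simp
  ultimately show ?thesis by (simp only:)
qed

lemma cform_U_step:
  "noise_avg p q (\<lambda>a b. cform (sU (next_state s a b)) (sU (next_state s a b)))
    \<le> (1 - \<theta>w)\<^sup>2 * (cform (sU s) (sU s) + c5 * p * consensus_err (sX s))" (is "?l \<le> _")
proof -
  have "?l
    = (1 - \<theta>w)\<^sup>2 * ((1 - p) * cform (sU s) (sU s) + p * cform (stack2 (sX s)) (stack2 (sX s)))"
    by (simp add: noise_avg_def cform_W_tilde) (simp add: algebra_simps)
  also have "\<dots> \<le> (1 - \<theta>w)\<^sup>2 * (1 * cform (sU s) (sU s) + p * (c5 * consensus_err (sX s)))"
    using ranges by (intro mult_left_mono add_mono mult_right_mono cform_stack2) auto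
  finally show ?thesis by (simp only: mult_1 mult.assoc mult.left_commute[of p])
qed

text \<open>
  The direction is split into its mean over \<open>b\<close>, which acts on
  \<open>v + \<eta> d\<close>, and a fluctuation of variance at most \<open>\<eta>^2 / q\<close>.
  Young's inequality with parameter \<open>theta_w / (1 - theta_w)\<close> gives up one of the two
  factors \<open>1 - theta_w\<close> and separates \<open>Z\<close> from what is added to it.
\<close>
lemma cform_Z_step:
  "noise_avg p q (\<lambda>a b. cform (sZ (next_state s a b)) (sZ (next_state s a b)))
    \<le> (1 - \<theta>w) * (cform (sZ s) (sZ s) + 4 * c5 * \<beta>\<^sup>2 / \<theta>w * consensus_err (sX s)
        + 4 * c5 * \<eta>\<^sup>2 / \<theta>w * consensus_err (upper (sG s)) + c5 * ((\<eta>\<^sup>2 / q + 2 * \<eta>\<^sup>2 / \<theta>w) * grad_gap s))"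
proof -
  define x where "x = stack2 (sX s)"
  define g where "g = stack2 (upper (sG s))"
  define d where "d = stack2 (gradF (sQ s)) - stack2 (gradF (sX s))"
  define z where "z = sZ s"
  define v where "v = z + \<beta> *\<^sub>R x - \<eta> *\<^sub>R g"
  let ?E = "4 * (\<beta>\<^sup>2 * cform x x) + 4 * (\<eta>\<^sup>2 * cform g g) + 2 * (\<eta>\<^sup>2 * cform d d)"
  let ?V = "cform (v + \<eta> *\<^sub>R d) (v + \<eta> *\<^sub>R d)"
  define \<rho> where "\<rho> = 1 - \<theta>w"
  have \<rho>: "0 < \<rho>" "\<rho> < 1" "\<theta>w = 1 - \<rho>" using \<theta>w unfolding \<rho>_def by auto
  have xg: "cform x x \<le> c5 * consensus_err (sX s)" "cform g g \<le> c5 * consensus_err (upper (sG s))"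
    unfolding x_def g_def by (rule cform_stack2)+
  have dd: "cform d d \<le> c5 * grad_gap s"
  proof -
    have "cform d d = cform (- d) (- d)" by (simp add: bilinear_lneg[OF bilinear_cform] bilinear_rneg[OF bilinear_cform])
    then show ?thesis using cform_grad_gap[of s] unfolding d_def by simp
  qed
  have nz: "cform (next_Z s b) (next_Z s b) \<le> \<rho>\<^sup>2 * cform (v + (\<eta> * b) *\<^sub>R d) (v + (\<eta> * b) *\<^sub>R d)" for b
  proof -
    let ?w = "v + (\<eta> * b) *\<^sub>R d"
    have "cform (next_Z s b) (next_Z s b) = (1 / (1 + \<beta>)) * ((1 / (1 + \<beta>)) * (\<rho>\<^sup>2 * cform ?w ?w))"
      unfolding next_Z_def cform_linear(5) cform_linear(6) cform_W_tilde x_def v_def z_def d_def g_def \<rho>_def by simp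
    also have "\<dots> \<le> 1 * (1 * (\<rho>\<^sup>2 * cform ?w ?w))"
      using ranges by (intro mult_mono) (auto simp: divide_le_eq)
    finally show ?thesis by simp
  qed
  have "noise_avg p q (\<lambda>a b. cform (sZ (next_state s a b)) (sZ (next_state s a b)))
     = q * cform (next_Z s (1 / q)) (next_Z s (1 / q)) + (1 - q) * cform (next_Z s 0) (next_Z s 0)"
    by (simp add: noise_avg_def algebra_simps)
  also have "\<dots> \<le> q * (\<rho>\<^sup>2 * cform (v + (\<eta> * (1 / q)) *\<^sub>R d) (v + (\<eta> * (1 / q)) *\<^sub>R d))
      + (1 - q) * (\<rho>\<^sup>2 * cform (v + (\<eta> * 0) *\<^sub>R d) (v + (\<eta> * 0) *\<^sub>R d))"
    using ranges by (intro add_mono mult_left_mono nz) auto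
  also have "\<dots> = \<rho>\<^sup>2 * (?V + (\<eta>\<^sup>2 / q - \<eta>\<^sup>2) * cform d d)"
  proof -
    have "q * cform (v + (\<eta> * (1 / q)) *\<^sub>R d) (v + (\<eta> * (1 / q)) *\<^sub>R d) + (1 - q) * cform v v
      = ?V + (\<eta>\<^sup>2 / q - \<eta>\<^sup>2) * cform d d"
      using ranges by (simp add: cform_linear power2_eq_square field_simps)
    moreover have "q * (\<rho>\<^sup>2 * a) + (1 - q) * (\<rho>\<^sup>2 * b) = \<rho>\<^sup>2 * (q * a + (1 - q) * b)" for a b
      by (simp add: algebra_simps)
    ultimately show ?thesis by simp
  qed
  also have "?V + (\<eta>\<^sup>2 / q - \<eta>\<^sup>2) * cform d d
     \<le> 1 / \<rho> * cform z z + 1 / \<theta>w * ?E + \<eta>\<^sup>2 / q * cform d d"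
  proof (intro add_mono mult_right_mono)
    let ?r = "(\<beta> *\<^sub>R x + (- \<eta>) *\<^sub>R g) + \<eta> *\<^sub>R d"
    have "v + \<eta> *\<^sub>R d = z + ?r" unfolding v_def by simp
    then have "?V \<le> (1 + \<theta>w / \<rho>) * cform z z + (1 + 1 / (\<theta>w / \<rho>)) * cform ?r ?r"
      using \<rho>(1) \<theta>w(1) by (simp only:) (intro cform_young(1), simp)
    moreover have "1 + \<theta>w / \<rho> = 1 / \<rho>" "1 + 1 / (\<theta>w / \<rho>) = 1 / \<theta>w"
      using \<rho> \<theta>w(1) by (simp_all add: field_simps)
    ultimately have r: "?V \<le> 1 / \<rho> * cform z z + 1 / \<theta>w * cform ?r ?r" by (simp only:)
    have "cform ?r ?r \<le> ?E"
    proof -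
      have "cform ?r ?r \<le> 2 * cform (\<beta> *\<^sub>R x + (- \<eta>) *\<^sub>R g) (\<beta> *\<^sub>R x + (- \<eta>) *\<^sub>R g) + 2 * cform (\<eta> *\<^sub>R d) (\<eta> *\<^sub>R d)"
        using cform_young(1)[of 1 "\<beta> *\<^sub>R x + (- \<eta>) *\<^sub>R g" "\<eta> *\<^sub>R d"] by simp
      moreover have "cform (\<beta> *\<^sub>R x + (- \<eta>) *\<^sub>R g) (\<beta> *\<^sub>R x + (- \<eta>) *\<^sub>R g)
          \<le> 2 * cform (\<beta> *\<^sub>R x) (\<beta> *\<^sub>R x) + 2 * cform ((- \<eta>) *\<^sub>R g) ((- \<eta>) *\<^sub>R g)"
        using cform_young(1)[of 1 "\<beta> *\<^sub>R x" "(- \<eta>) *\<^sub>R g"] by simp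
      moreover have sq: "cform (c *\<^sub>R y) (c *\<^sub>R y) = c\<^sup>2 * cform y y" for c y
        by (simp add: cform_linear power2_eq_square)
      ultimately show ?thesis unfolding sq power2_minus by linarith
    qed
    then have "1 / \<theta>w * cform ?r ?r \<le> 1 / \<theta>w * ?E"
      using \<theta>w by (intro mult_left_mono) auto
    with r show "?V
      \<le> 1 / \<rho> * cform z z + 1 / \<theta>w * ?E"
      by linarith
  qed auto
  also have "\<rho>\<^sup>2 * (1 / \<rho> * cform z z + 1 / \<theta>w * ?E + \<eta>\<^sup>2 / q * cform d d)
     \<le> \<rho>\<^sup>2 * (1 / \<rho> * (cform z z + (1 / \<theta>w * ?E + \<eta>\<^sup>2 / q * cform d d)))"
  proof (intro mult_left_mono)
    let ?e = "1 / \<theta>w * ?E + \<eta>\<^sup>2 / q * cform d d"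
    have "0 \<le> ?e" using \<theta>w ranges by (intro add_nonneg_nonneg mult_nonneg_nonneg) auto
    then have "1 * ?e \<le> 1 / \<rho> * ?e" using \<rho> by (intro mult_right_mono) auto
    then show "1 / \<rho> * cform z z + 1 / \<theta>w * ?E + \<eta>\<^sup>2 / q * cform d d
      \<le> 1 / \<rho> * (cform z z + ?e)"
      unfolding distrib_left[of "1 / \<rho>" "cform z z"] by (simp only: add.assoc mult_1 add_le_cancel_left)
  qed auto
  also have "\<dots> = \<rho> * (cform z z + (1 / \<theta>w * ?E + \<eta>\<^sup>2 / q * cform d d))"
    using \<rho> by (simp add: power2_eq_square)
  also have "\<dots> \<le> \<rho> * (cform z z + (1 / \<theta>w * (4 * (\<beta>\<^sup>2 * (c5 * consensus_err (sX s))) + 4 * (\<eta>\<^sup>2 * (c5 * consensus_err (upper (sG s))))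
       + 2 * (\<eta>\<^sup>2 * (c5 * grad_gap s))) + \<eta>\<^sup>2 / q * (c5 * grad_gap s)))"
    using \<rho> \<theta>w ranges xg dd by (intro mult_left_mono add_mono order_refl) auto
  also have "\<dots> = \<rho> * (cform z z + 4 * c5 * \<beta>\<^sup>2 / \<theta>w * consensus_err (sX s)
        + 4 * c5 * \<eta>\<^sup>2 / \<theta>w * consensus_err (upper (sG s)) + c5 * ((\<eta>\<^sup>2 / q + 2 * \<eta>\<^sup>2 / \<theta>w) * grad_gap s))"
    by (simp add: distrib_left distrib_right ac_simps)
  finally show ?thesis using \<rho>(1) unfolding z_def \<rho>_def by (simp add: mult_left_mono)
qed

lemma C_G_Suc: "C_G (Suc k) = (1 - \<theta>w) * C_G k + 2 * c5 * p * D k"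
proof -
  have "(1 - \<theta>w) ^ (Suc k - 1 - i) = (1 - \<theta>w) * (1 - \<theta>w) ^ (k - 1 - i)" if "i < k" for i
    using that by (simp flip: power_Suc add: Suc_diff_Suc)
  then show ?thesis unfolding C_G_def
    by (simp add: sum_distrib_left distrib_left mult.assoc mult.left_commute)
qed

lemma C_U_Suc: "C_U (Suc k) = (1 - \<theta>w)\<^sup>2 * (C_U k + c5 * p * PX k)"
proof -
  have "(1 - \<theta>w) ^ (2 * (Suc k - i)) = (1 - \<theta>w)\<^sup>2 * (1 - \<theta>w) ^ (2 * (k - i))" if "i < Suc k" for i
    using that by (simp flip: power_add add: Suc_diff_le)
  then have "(\<Sum>i<Suc k. (1 - \<theta>w) ^ (2 * (Suc k - i)) * PX i) = (1 - \<theta>w)\<^sup>2 * (\<Sum>i<Suc k. (1 - \<theta>w) ^ (2 * (k - i)) * PX i)"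
    unfolding sum_distrib_left by (intro sum.cong) auto
  moreover have "(1 - \<theta>w) ^ (2 * Suc k) = (1 - \<theta>w)\<^sup>2 * (1 - \<theta>w) ^ (2 * k)"
    by (simp flip: power_add)
  ultimately show ?thesis unfolding C_U_def
    by (simp only: sum.lessThan_Suc) (simp add: distrib_left ac_simps)
qed

lemma C_Z_Suc: "C_Z (Suc k) = (1 - \<theta>w) * (C_Z k + (4 * c5 * \<beta>\<^sup>2 / \<theta>w * PX k + 4 * c5 * \<eta>\<^sup>2 / \<theta>w * C_G k)
    + c5 * ((\<eta>\<^sup>2 / q + 2 * \<eta>\<^sup>2 / \<theta>w) * D k))"
proof -
  have e: "(1 - \<theta>w) ^ (Suc k - i) = (1 - \<theta>w) * (1 - \<theta>w) ^ (k - i)" if "i < Suc k" for i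
    using that by (simp flip: power_Suc add: Suc_diff_le)
  have shift: "(\<Sum>i<Suc k. (1 - \<theta>w) ^ (Suc k - i) * h i) = (1 - \<theta>w) * ((\<Sum>i<k. (1 - \<theta>w) ^ (k - i) * h i) + h k)" for h :: "nat \<Rightarrow> real"
  proof -
    have "(\<Sum>i<Suc k. (1 - \<theta>w) ^ (Suc k - i) * h i) = (1 - \<theta>w) * (\<Sum>i<Suc k. (1 - \<theta>w) ^ (k - i) * h i)"
      unfolding sum_distrib_left using e by (intro sum.cong) auto
    then show ?thesis by simp
  qed
  show ?thesis unfolding C_Z_def mult.assoc[of "(1 - \<theta>w) ^ (_ - _)" _ "D _"] shift
    by (simp add: algebra_simps)
qed

lemma D_state: "D k = (\<integral>\<omega>. grad_gap (state k \<omega>) \<partial>M)"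
  unfolding D_def grad_gap_def by simp

lemma PX_state: "PX k = (\<integral>\<omega>. consensus_err (sX (state k \<omega>)) \<partial>M)"
  unfolding PX_def by simp

lemmas integrable_terms =
  integrable_state[OF continuous_on_cform[OF continuous_on_state(3)[OF continuous_on_id]]]
  integrable_state[OF continuous_on_cform[OF continuous_on_state(4)[OF continuous_on_id]]]
  integrable_state[OF continuous_on_cform[OF continuous_on_state(5)[OF continuous_on_id]]]
  integrable_state[OF continuous_on_consensus_err[OF continuous_on_state(1)[OF continuous_on_id]]]
  integrable_state[OF continuous_on_consensus_err[OF continuous_on_state(2)[OF continuous_on_id]]]
  integrable_state[OF continuous_on_consensus_err[OF continuous_on_state(6)[OF continuous_on_id]]]
  integrable_state[OF continuous_on_consensus_err[OF continuous_on_linear[OF linear_upper continuous_on_state(3)[OF continuous_on_id]]]]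
  integrable_state[OF continuous_on_consensus_err[OF continuous_on_linear[OF linear_upper continuous_on_state(4)[OF continuous_on_id]]]]
  integrable_state[OF continuous_on_consensus_err[OF continuous_on_linear[OF linear_upper continuous_on_state(5)[OF continuous_on_id]]]]
  integrable_state[OF continuous_on_grad_gap[OF continuous_on_id]]

lemma expected_cform_G_le: "(\<integral>\<omega>. cform (sG (state k \<omega>)) (sG (state k \<omega>)) \<partial>M) \<le> C_G k"
proof (induction k)
  case 0
  show ?case by (simp add: S_0 sG_def prob_space C_G_def cform_stack2 del: state_simps)
next
  case (Suc k)
  have "(\<integral>\<omega>. cform (sG (state (Suc k) \<omega>)) (sG (state (Suc k) \<omega>)) \<partial>M)
     \<le> (\<integral>\<omega>. (1 - \<theta>w) * cform (sG (state k \<omega>)) (sG (state k \<omega>)) + 2 * c5 * p * grad_gap (state k \<omega>) \<partial>M)"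
    by (rule expectation_Suc_le[where P = "\<lambda>_. True" and \<phi> = "\<lambda>s. cform (sG s) (sG s)"
          and \<psi> = "\<lambda>s. (1 - \<theta>w) * cform (sG s) (sG s) + 2 * c5 * p * grad_gap s"])
       (rule cform_G_step TrueI continuous_intros continuous_on_id)+
  also have "\<dots> = (1 - \<theta>w) * (\<integral>\<omega>. cform (sG (state k \<omega>)) (sG (state k \<omega>)) \<partial>M) + 2 * c5 * p * D k"
    unfolding D_state
    using integrable_terms by (simp del: state_simps)
  also have "\<dots> \<le> (1 - \<theta>w) * C_G k + 2 * c5 * p * D k"
    using Suc \<theta>w by (intro add_right_mono mult_left_mono) auto
  finally show ?case unfolding C_G_Suc .
qed

lemma expected_cform_U_le: "(\<integral>\<omega>. cform (sU (state k \<omega>)) (sU (state k \<omega>)) \<partial>M) \<le> C_U k"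
proof (induction k)
  case 0
  show ?case by (simp add: S_0 sU_def prob_space C_U_def cform_stack2 del: state_simps)
next
  case (Suc k)
  have "(\<integral>\<omega>. cform (sU (state (Suc k) \<omega>)) (sU (state (Suc k) \<omega>)) \<partial>M)
     \<le> (\<integral>\<omega>. (1 - \<theta>w)\<^sup>2 * (cform (sU (state k \<omega>)) (sU (state k \<omega>)) + c5 * p * consensus_err (sX (state k \<omega>))) \<partial>M)"
    by (rule expectation_Suc_le[where P = "\<lambda>_. True" and \<phi> = "\<lambda>s. cform (sU s) (sU s)"
          and \<psi> = "\<lambda>s. (1 - \<theta>w)\<^sup>2 * (cform (sU s) (sU s) + c5 * p * consensus_err (sX s))"])
       (rule cform_U_step TrueI continuous_intros continuous_on_id)+
  also have "\<dots> = (1 - \<theta>w)\<^sup>2 * ((\<integral>\<omega>. cform (sU (state k \<omega>)) (sU (state k \<omega>)) \<partial>M) + c5 * p * PX k)"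
    unfolding PX_state
    using integrable_terms by (simp del: state_simps)
  also have "\<dots> \<le> (1 - \<theta>w)\<^sup>2 * (C_U k + c5 * p * PX k)"
    using Suc \<theta>w by (intro add_right_mono mult_left_mono) auto
  finally show ?case unfolding C_U_Suc .
qed

lemma expected_cform_Z_le: "(\<integral>\<omega>. cform (sZ (state k \<omega>)) (sZ (state k \<omega>)) \<partial>M) \<le> C_Z k"
proof (induction k)
  case 0
  show ?case by (simp add: S_0 sZ_def prob_space C_Z_def cform_stack2 del: state_simps)
next
  case (Suc k)
  have G: "(\<integral>\<omega>. consensus_err (upper (sG (state k \<omega>))) \<partial>M) \<le> C_G k"
    using integrable_terms by (intro order_trans[OF integral_mono expected_cform_G_le] cform_upper)
  have "(\<integral>\<omega>. cform (sZ (state (Suc k) \<omega>)) (sZ (state (Suc k) \<omega>)) \<partial>M)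
     \<le> (\<integral>\<omega>. (1 - \<theta>w) * (cform (sZ (state k \<omega>)) (sZ (state k \<omega>)) + 4 * c5 * \<beta>\<^sup>2 / \<theta>w * consensus_err (sX (state k \<omega>))
        + 4 * c5 * \<eta>\<^sup>2 / \<theta>w * consensus_err (upper (sG (state k \<omega>))) + c5 * ((\<eta>\<^sup>2 / q + 2 * \<eta>\<^sup>2 / \<theta>w) * grad_gap (state k \<omega>))) \<partial>M)"
    by (rule expectation_Suc_le[where P = "\<lambda>_. True" and \<phi> = "\<lambda>s. cform (sZ s) (sZ s)"
          and \<psi> = "\<lambda>s. (1 - \<theta>w) * (cform (sZ s) (sZ s) + 4 * c5 * \<beta>\<^sup>2 / \<theta>w * consensus_err (sX s) + 4 * c5 * \<eta>\<^sup>2 / \<theta>w * consensus_err (upper (sG s)) + c5 * ((\<eta>\<^sup>2 / q + 2 * \<eta>\<^sup>2 / \<theta>w) * grad_gap s))"])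
       (rule cform_Z_step TrueI continuous_intros continuous_on_id)+
  also have "\<dots> = (1 - \<theta>w) * ((\<integral>\<omega>. cform (sZ (state k \<omega>)) (sZ (state k \<omega>)) \<partial>M) + 4 * c5 * \<beta>\<^sup>2 / \<theta>w * PX k
        + 4 * c5 * \<eta>\<^sup>2 / \<theta>w * (\<integral>\<omega>. consensus_err (upper (sG (state k \<omega>))) \<partial>M) + c5 * ((\<eta>\<^sup>2 / q + 2 * \<eta>\<^sup>2 / \<theta>w) * D k))"
    unfolding PX_state D_state using integrable_terms by (simp del: state_simps)
  also have "\<dots> \<le> (1 - \<theta>w) * (C_Z k + 4 * c5 * \<beta>\<^sup>2 / \<theta>w * PX k + 4 * c5 * \<eta>\<^sup>2 / \<theta>w * C_G k + c5 * ((\<eta>\<^sup>2 / q + 2 * \<eta>\<^sup>2 / \<theta>w) * D k))"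
    using Suc G \<theta>w by (intro mult_left_mono add_mono order_refl) (auto simp: c5_def)
  finally show ?case unfolding C_Z_Suc by (simp add: add.assoc)
qed

end

section \<open>Contraction of the consensus part\<close>

context ogt_run
begin

lemma consensus_err_add_le: "0 < t \<Longrightarrow> consensus_err (A + B) \<le> (1 + t) * consensus_err A + (1 + 1 / t) * consensus_err B"
  unfolding consensus_err_def linear_add[OF linear_matrix_mult] by (rule norm_add_squared_le)

lemma consensus_err_scaleR: "consensus_err (c *\<^sub>R A) = c\<^sup>2 * consensus_err A"
  unfolding consensus_err_def linear_scale[OF linear_matrix_mult] by (simp add: power_mult_distrib)

text \<open>
  The weight of \<open>Z\<close> must be of order \<open>\<alpha>^2\<close> rather than
  \<open>\<alpha>\<close>, because \<open>C_Z\<close> only enters \<open>Phi_C\<close> with a factor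
  of order \<open>\<gamma>^2\<close>. Plain convexity is therefore too weak: \<open>Z\<close> is
  first split off by Young's inequality, and convexity is used for \<open>Y\<close> and
  \<open>U\<close>.
\<close>
lemma consensus_err_X_le:
  "consensus_err (sX s) \<le> 4 / (4 - \<tau>) * ((1 - \<alpha> - \<tau>)\<^sup>2 / (1 - \<tau>) * consensus_err (sY s) + \<tau> * consensus_err (upper (sU s)))
     + 4 * \<alpha>\<^sup>2 / \<tau> * consensus_err (upper (sZ s))"
proof -
  let ?y = "(1 - \<alpha> - \<tau>) *\<^sub>R sY s" and ?z = "\<alpha> *\<^sub>R upper (sZ s)" and ?u = "\<tau> *\<^sub>R upper (sU s)"
  have "consensus_err (sX s) = consensus_err ((?y + ?u) + ?z)"
    unfolding sX_def by (simp add: add.assoc add.commute add.left_commute)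
  also have "\<dots> \<le> (1 + \<tau> / (4 - \<tau>)) * consensus_err (?y + ?u) + (1 + 1 / (\<tau> / (4 - \<tau>))) * consensus_err ?z"
    using ranges by (intro consensus_err_add_le) auto
  also have "1 + \<tau> / (4 - \<tau>) = 4 / (4 - \<tau>)" using ranges by (simp add: field_simps)
  also have "1 + 1 / (\<tau> / (4 - \<tau>)) = 4 / \<tau>" using ranges by (simp add: field_simps)
  also have "4 / (4 - \<tau>) * consensus_err (?y + ?u)
      \<le> 4 / (4 - \<tau>) * ((1 + \<tau> / (1 - \<tau>)) * consensus_err ?y + (1 + 1 / (\<tau> / (1 - \<tau>))) * consensus_err ?u)"
    using ranges by (intro mult_left_mono consensus_err_add_le) auto
  also have "1 + \<tau> / (1 - \<tau>) = 1 / (1 - \<tau>)" using ranges by (simp add: field_simps)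
  also have "1 + 1 / (\<tau> / (1 - \<tau>)) = 1 / \<tau>" using ranges by (simp add: field_simps)
  finally show ?thesis
    unfolding consensus_err_scaleR using ranges by (simp add: power2_eq_square)
qed

lemma consensus_err_Y_Suc_le:
  "consensus_err (Y (Suc k) \<omega>) \<le> (4 - \<tau>) / (4 - 2 * \<tau>) * consensus_err (X k \<omega>)
     + (4 - \<tau>) / \<tau> * \<gamma>\<^sup>2 * (2 * consensus_err (upper (Zt (Suc k) \<omega>)) + 2 * consensus_err (upper (Zt k \<omega>)))"
proof -
  let ?d = "upper (Zt (Suc k) \<omega>) - upper (Zt k \<omega>)"
  have "consensus_err ?d \<le> 2 * consensus_err (upper (Zt (Suc k) \<omega>)) + 2 * consensus_err (upper (Zt k \<omega>))"
    using consensus_err_add_le[of 1 "upper (Zt (Suc k) \<omega>)" "(-1) *\<^sub>R upper (Zt k \<omega>)"] unfolding consensus_err_scaleR by simp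
  moreover have "consensus_err (Y (Suc k) \<omega>) \<le> (1 + \<tau> / (4 - 2 * \<tau>)) * consensus_err (X k \<omega>) + (1 + 1 / (\<tau> / (4 - 2 * \<tau>))) * consensus_err (\<gamma> *\<^sub>R ?d)"
    unfolding Y.simps(2) using ranges by (intro consensus_err_add_le) auto
  moreover have "1 + \<tau> / (4 - 2 * \<tau>) = (4 - \<tau>) / (4 - 2 * \<tau>)" "1 + 1 / (\<tau> / (4 - 2 * \<tau>)) = (4 - \<tau>) / \<tau>"
    using ranges by (simp_all add: field_simps)
  ultimately show ?thesis
    unfolding consensus_err_scaleR using ranges
    by (smt (verit) mult.assoc mult_left_mono divide_nonneg_pos zero_le_power2 mult_nonneg_nonneg)
qed

definition EQ where "EQ k = (\<integral>\<omega>. consensus_err (Q k \<omega>) \<partial>M)"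
definition EY where "EY k = (\<integral>\<omega>. consensus_err (Y k \<omega>) \<partial>M)"

lemma expected_nonneg: "0 \<le> EQ k" "0 \<le> EY k" "0 \<le> PX k" "0 \<le> D k"
  unfolding EQ_def EY_def PX_def D_def by simp_all

lemma C_nonneg: "0 \<le> C_G k" "0 \<le> C_U k" "0 \<le> C_Z k"
proof -
  have n: "0 \<le> (\<integral>\<omega>. cform (h \<omega>) (h \<omega>) \<partial>M)" for h by simp
  show "0 \<le> C_G k" by (rule order_trans[OF n expected_cform_G_le])
  show "0 \<le> C_U k" by (rule order_trans[OF n expected_cform_U_le])
  show "0 \<le> C_Z k" by (rule order_trans[OF n expected_cform_Z_le])
qed

lemma expected_upper_le:
  "(\<integral>\<omega>. consensus_err (upper (Ut k \<omega>)) \<partial>M) \<le> C_U k"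
  "(\<integral>\<omega>. consensus_err (upper (Zt k \<omega>)) \<partial>M) \<le> C_Z k"
  using integrable_terms[of k]
  by (auto intro!: order_trans[OF integral_mono expected_cform_U_le] order_trans[OF integral_mono expected_cform_Z_le] cform_upper)

lemma PX_le: "PX k \<le> 4 / (4 - \<tau>) * ((1 - \<alpha> - \<tau>)\<^sup>2 / (1 - \<tau>)) * EY k + 4 * \<tau> / (4 - \<tau>) * C_U k + 4 * \<alpha>\<^sup>2 / \<tau> * C_Z k"
proof -
  have "PX k \<le> (\<integral>\<omega>. 4 / (4 - \<tau>) * ((1 - \<alpha> - \<tau>)\<^sup>2 / (1 - \<tau>) * consensus_err (Y k \<omega>) + \<tau> * consensus_err (upper (Ut k \<omega>)))
     + 4 * \<alpha>\<^sup>2 / \<tau> * consensus_err (upper (Zt k \<omega>)) \<partial>M)"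
    unfolding PX_def using integrable_terms[of k] consensus_err_X_le[of "state k _"] by (intro integral_mono) auto
  also have "\<dots> = 4 / (4 - \<tau>) * ((1 - \<alpha> - \<tau>)\<^sup>2 / (1 - \<tau>) * EY k + \<tau> * (\<integral>\<omega>. consensus_err (upper (Ut k \<omega>)) \<partial>M))
     + 4 * \<alpha>\<^sup>2 / \<tau> * (\<integral>\<omega>. consensus_err (upper (Zt k \<omega>)) \<partial>M)"
    unfolding EY_def using integrable_terms[of k] by simp
  also have "\<dots> \<le> 4 / (4 - \<tau>) * ((1 - \<alpha> - \<tau>)\<^sup>2 / (1 - \<tau>) * EY k + \<tau> * C_U k) + 4 * \<alpha>\<^sup>2 / \<tau> * C_Z k"
    using ranges by (intro add_mono mult_left_mono expected_upper_le order_refl) auto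
  finally show ?thesis by (simp add: distrib_left)
qed

lemma EY_Suc_le: "EY (Suc k) \<le> (4 - \<tau>) / (4 - 2 * \<tau>) * PX k + (4 - \<tau>) / \<tau> * \<gamma>\<^sup>2 * (2 * C_Z (Suc k) + 2 * C_Z k)"
proof -
  have "EY (Suc k) \<le> (\<integral>\<omega>. (4 - \<tau>) / (4 - 2 * \<tau>) * consensus_err (X k \<omega>)
     + (4 - \<tau>) / \<tau> * \<gamma>\<^sup>2 * (2 * consensus_err (upper (Zt (Suc k) \<omega>)) + 2 * consensus_err (upper (Zt k \<omega>))) \<partial>M)"
    unfolding EY_def using integrable_terms[of k] integrable_terms[of "Suc k"]
    by (intro integral_mono consensus_err_Y_Suc_le) auto
  also have "\<dots> = (4 - \<tau>) / (4 - 2 * \<tau>) * PX k + (4 - \<tau>) / \<tau> * \<gamma>\<^sup>2 *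
      (2 * (\<integral>\<omega>. consensus_err (upper (Zt (Suc k) \<omega>)) \<partial>M) + 2 * (\<integral>\<omega>. consensus_err (upper (Zt k \<omega>)) \<partial>M))"
    unfolding PX_def using integrable_terms[of k] integrable_terms[of "Suc k"] by simp
  also have "\<dots> \<le> (4 - \<tau>) / (4 - 2 * \<tau>) * PX k + (4 - \<tau>) / \<tau> * \<gamma>\<^sup>2 * (2 * C_Z (Suc k) + 2 * C_Z k)"
    using ranges by (intro add_mono mult_left_mono expected_upper_le order_refl) auto
  finally show ?thesis .
qed

lemma EQ_Suc_le: "EQ (Suc k) \<le> (1 - p) * EQ k + p * PX k"
proof -
  have "(\<integral>\<omega>. consensus_err (sQ (state (Suc k) \<omega>)) \<partial>M)
    \<le> (\<integral>\<omega>. (1 - p) * consensus_err (sQ (state k \<omega>)) + p * consensus_err (sX (state k \<omega>)) \<partial>M)"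
    by (rule expectation_Suc_le[where P = "\<lambda>_. True" and \<phi> = "\<lambda>s. consensus_err (sQ s)"
          and \<psi> = "\<lambda>s. (1 - p) * consensus_err (sQ s) + p * consensus_err (sX s)"])
       (rule TrueI continuous_intros continuous_on_id | (simp add: noise_avg_def, simp add: algebra_simps))+
  also have "\<dots> = (1 - p) * EQ k + p * PX k"
    unfolding EQ_def PX_def using integrable_terms[of k] by simp
  finally show ?thesis unfolding EQ_def by simp
qed

lemma Phi_C_eq: "Phi_C k = 8 / \<tau> *
     (\<tau> / (4 * p) * EQ k + 4 * (1 - \<tau>) / (4 - \<tau>) * EY k + 16 / \<theta>w * C_U k
      + (1 - \<theta>w / 6) * (48 * (1 - \<tau>) * \<gamma>\<^sup>2 / (\<tau> * \<theta>w)) * C_Z k + 1 / (\<theta>w * L\<^sup>2) * C_G k)"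
  unfolding Phi_C_def EQ_def EY_def using integrable_terms[of k] by simp

text \<open>
  Used to show that \<open>\<delta> \<le> \<gamma> / 4\<close> implies
  \<open>1 - \<alpha> - \<tau> \<le> (1 - \<delta>) (1 - \<tau>)\<close>, the source of the
  contraction in \<open>Y\<close>.
\<close>
lemma gamma_le_alpha: "(1 - \<tau>) * \<gamma> \<le> 7 / 4 * \<alpha>"
proof -
  have "(1 - \<alpha> - \<tau>) / \<alpha> * (\<alpha> * \<gamma>) \<le> (1 / \<gamma> - 1 / 4) * (\<alpha> * \<gamma>)"
    using ranges by (intro mult_right_mono cond_descent) auto
  moreover have "(1 - \<alpha> - \<tau>) / \<alpha> * (\<alpha> * \<gamma>) = (1 - \<tau>) * \<gamma> - \<alpha> * \<gamma>"
    using ranges by (simp add: field_simps)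
  moreover have "(1 / \<gamma> - 1 / 4) * (\<alpha> * \<gamma>) = \<alpha> - \<alpha> * \<gamma> / 4"
    using ranges by (simp add: left_diff_distrib)
  ultimately have "(1 - \<tau>) * \<gamma> \<le> \<alpha> + 3 / 4 * (\<alpha> * \<gamma>)" by linarith
  moreover have "\<alpha> * \<gamma> \<le> \<alpha> * 1" using ranges by (intro mult_left_mono) auto
  ultimately show ?thesis by linarith
qed

lemma y_weight_nonneg: "0 \<le> (1 - \<alpha> - \<tau>) / \<alpha>"
proof -
  have "1 < 1 / \<gamma>" using ranges by simp
  then show ?thesis using cond_descent(3) by linarith
qed

text \<open>
  Each of the five summands of \<open>Phi_C\<close> is propagated separately. The consensus error of
  the new \<open>X\<close> then appears with total coefficient at most \<open>1 - \<tau> / 8\<close>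
  (in units of \<open>8 / \<tau>\<close>), by the first parameter condition. What is left below
  \<open>1\<close> pays for the term in \<open>PX\<close> on the left, and the coefficient
  \<open>1\<close> itself is converted back to \<open>Y\<close>, \<open>U\<close> and
  \<open>Z\<close> at time \<open>k\<close> by \<open>PX_le\<close>. The factor
  \<open>1 - theta_w / 6\<close> in front of \<open>C_Z\<close> reserves room for the new
  \<open>Z\<close> that enters through the new \<open>Y\<close>.
\<close>
lemma Phi_C_Suc_le:
  assumes \<delta>: "0 \<le> \<delta>" "\<delta> \<le> p / 2" "\<delta> \<le> \<theta>w / 2" "\<delta> \<le> \<gamma> / 4"
  shows "Phi_C (Suc k) + 3 / 4 * PX k + 1 / 2 * EQ k \<le> (1 - \<delta>) * Phi_C k + c5 * c2_tilde \<theta> L \<gamma> \<tau> p q \<eta> * D k"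
proof -
  define aQ where "aQ = \<tau> / (4 * p)"
  define aY where "aY = 4 * (1 - \<tau>) / (4 - \<tau>)"
  define aU where "aU = 16 / \<theta>w"
  define aZ where "aZ = 48 * (1 - \<tau>) * \<gamma>\<^sup>2 / (\<tau> * \<theta>w)"
  define aG where "aG = 1 / (\<theta>w * L\<^sup>2)"
  define dd where "dd = \<eta>\<^sup>2 / q + 2 * \<eta>\<^sup>2 / \<theta>w"
  define t where "t = 1 - \<tau>"
  define B where "B = (\<lambda>k. aQ * EQ k + aY * EY k + aU * C_U k + (1 - \<theta>w / 6) * aZ * C_Z k + aG * C_G k)"
  have pos: "0 \<le> aQ" "0 \<le> aY" "0 \<le> aU" "0 \<le> aZ" "0 \<le> aG"
    using ranges \<theta>w L unfolding aQ_def aY_def aU_def aZ_def aG_def by auto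
  note n = expected_nonneg[of k] C_nonneg[of k]
  \<comment> \<open>only half of the decrease of \<open>Q\<close> is spent on the rate; a quarter pays for the term in \<open>EQ\<close>\<close>
  have Q: "aQ * EQ (Suc k) + \<tau> / 16 * EQ k \<le> (1 - \<delta>) * (aQ * EQ k) + \<tau> / 4 * PX k"
  proof -
    have "aQ * EQ (Suc k) \<le> aQ * ((1 - p) * EQ k + p * PX k)" by (intro mult_left_mono EQ_Suc_le pos)
    also have "\<dots> = aQ * EQ k - \<tau> / 4 * EQ k + \<tau> / 4 * PX k"
      unfolding aQ_def using ranges by (simp add: field_simps)
    finally have 1: "aQ * EQ (Suc k) \<le> aQ * EQ k - \<tau> / 4 * EQ k + \<tau> / 4 * PX k" .
    have "\<delta> * aQ \<le> p / 2 * aQ" using \<delta> pos by (intro mult_right_mono) auto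
    also have "\<dots> = \<tau> / 8" unfolding aQ_def using ranges by simp
    finally have "\<delta> * aQ * EQ k \<le> \<tau> / 8 * EQ k" using n by (intro mult_right_mono) auto
    moreover have "0 \<le> \<tau> / 16 * EQ k" using n ranges by simp
    ultimately show ?thesis using 1 by (simp add: left_diff_distrib mult.assoc)
  qed
  have Y: "aY * EY (Suc k) \<le> 2 * (1 - \<tau>) / (2 - \<tau>) * PX k + \<theta>w / 6 * aZ * C_Z (Suc k) + \<theta>w / 6 * aZ * C_Z k"
  proof -
    have "aY * EY (Suc k) \<le> aY * ((4 - \<tau>) / (4 - 2 * \<tau>) * PX k + (4 - \<tau>) / \<tau> * \<gamma>\<^sup>2 * (2 * C_Z (Suc k) + 2 * C_Z k))"
      by (intro mult_left_mono EY_Suc_le pos)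
    also have "\<dots> = (aY * ((4 - \<tau>) / (4 - 2 * \<tau>))) * PX k + (aY * ((4 - \<tau>) / \<tau> * \<gamma>\<^sup>2 * 2)) * (C_Z (Suc k) + C_Z k)"
      by (simp add: algebra_simps)
    also have "aY * ((4 - \<tau>) / (4 - 2 * \<tau>)) = 2 * (1 - \<tau>) / (2 - \<tau>)"
      unfolding aY_def using ranges by (simp add: divide_simps) (simp add: algebra_simps)
    also have "aY * ((4 - \<tau>) / \<tau> * \<gamma>\<^sup>2 * 2) = \<theta>w / 6 * aZ"
      unfolding aY_def aZ_def t_def[symmetric] using ranges \<theta>w by simp
    finally show ?thesis by (simp add: distrib_left)
  qed
  have U: "aU * C_U (Suc k) \<le> aU * (1 - \<theta>w)\<^sup>2 * C_U k + 16 * c5 * p / \<theta>w * PX k"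
  proof -
    have "(1 - \<theta>w)\<^sup>2 * (aU * (c5 * p * PX k)) \<le> 1 * (aU * (c5 * p * PX k))"
      using \<theta>w pos n ranges by (intro mult_right_mono power_le_one) (auto simp: c5_def)
    then show ?thesis unfolding C_U_Suc aU_def by (simp add: algebra_simps)
  qed
  have U': "aU * (1 - \<theta>w)\<^sup>2 * C_U k + 4 * \<tau> / (4 - \<tau>) * C_U k \<le> (1 - \<delta>) * (aU * C_U k)"
  proof -
    have "4 * \<tau> / (4 - \<tau>) \<le> 4 / 3" using ranges by (simp add: pos_divide_le_eq)
    moreover have "aU * (1 - \<theta>w)\<^sup>2 = aU - 32 + 16 * \<theta>w"
      unfolding aU_def using \<theta>w by (simp add: power2_eq_square field_simps)
    moreover have "\<delta> * aU \<le> \<theta>w / 2 * aU" using \<delta> pos by (intro mult_right_mono) auto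
    moreover have "\<theta>w / 2 * aU = 8" unfolding aU_def using \<theta>w by simp
    moreover have "(1 - \<delta>) * aU = aU - \<delta> * aU" by (simp add: left_diff_distrib)
    ultimately have "aU * (1 - \<theta>w)\<^sup>2 + 4 * \<tau> / (4 - \<tau>) \<le> (1 - \<delta>) * aU" using \<theta>w by linarith
    then have "(aU * (1 - \<theta>w)\<^sup>2 + 4 * \<tau> / (4 - \<tau>)) * C_U k \<le> (1 - \<delta>) * aU * C_U k"
      using n by (intro mult_right_mono) auto
    then show ?thesis by (simp only: distrib_right mult.assoc)
  qed
  have Z: "aZ * C_Z (Suc k) \<le> aZ * (1 - \<theta>w) * C_Z k + 192 * c5 * (1 - \<tau>) * \<gamma>\<^sup>2 * \<beta>\<^sup>2 / (\<tau> * \<theta>w\<^sup>2) * PX k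
     + 1 / (2 * L\<^sup>2) * C_G k + aZ * c5 * dd * D k"
  proof -
    let ?e = "4 * c5 * \<beta>\<^sup>2 / \<theta>w * PX k + 4 * c5 * \<eta>\<^sup>2 / \<theta>w * C_G k + c5 * (dd * D k)"
    have "0 \<le> ?e" using n \<theta>w ranges unfolding dd_def c5_def by (intro add_nonneg_nonneg mult_nonneg_nonneg) auto
    then have "(1 - \<theta>w) * ?e \<le> 1 * ?e" using \<theta>w by (intro mult_right_mono) auto
    then have "C_Z (Suc k) \<le> (1 - \<theta>w) * C_Z k + ?e"
      unfolding C_Z_Suc dd_def[symmetric] by (simp only: distrib_left add.assoc mult_1)
    then have "aZ * C_Z (Suc k) \<le> aZ * ((1 - \<theta>w) * C_Z k + ?e)" using pos by (intro mult_left_mono)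
    also have "\<dots> = aZ * (1 - \<theta>w) * C_Z k + (aZ * (4 * c5 * \<beta>\<^sup>2 / \<theta>w)) * PX k + (aZ * (4 * c5 * \<eta>\<^sup>2 / \<theta>w)) * C_G k + aZ * c5 * dd * D k"
      by (simp only: distrib_left mult.assoc add.assoc)
    also have "aZ * (4 * c5 * \<beta>\<^sup>2 / \<theta>w) = 192 * c5 * (1 - \<tau>) * \<gamma>\<^sup>2 * \<beta>\<^sup>2 / (\<tau> * \<theta>w\<^sup>2)"
      unfolding aZ_def t_def[symmetric] by (simp add: power2_eq_square ac_simps)
    also have "aZ * (4 * c5 * \<eta>\<^sup>2 / \<theta>w) * C_G k \<le> 1 / (2 * L\<^sup>2) * C_G k"
    proof (intro mult_right_mono n)
      have "aZ * (4 * c5 * \<eta>\<^sup>2 / \<theta>w) = (192 * c5 * (1 - \<tau>) * \<gamma>\<^sup>2 * \<eta>\<^sup>2 * L\<^sup>2 / (\<tau> * \<theta>w)) / (\<theta>w * L\<^sup>2)"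
        unfolding aZ_def t_def[symmetric] using L by (simp add: power2_eq_square ac_simps)
      also have "\<dots> \<le> (\<theta>w / 2) / (\<theta>w * L\<^sup>2)"
        using \<theta>w by (intro divide_right_mono cond_contraction) auto
      finally show "aZ * (4 * c5 * \<eta>\<^sup>2 / \<theta>w) \<le> 1 / (2 * L\<^sup>2)" using \<theta>w by simp
    qed
    finally show ?thesis by simp
  qed
  have Z': "aZ * (1 - \<theta>w) * C_Z k + \<theta>w / 6 * aZ * C_Z k + 4 * \<alpha>\<^sup>2 / \<tau> * C_Z k \<le> (1 - \<delta>) * ((1 - \<theta>w / 6) * aZ * C_Z k)"
  proof -
    have "4 * \<alpha>\<^sup>2 / \<tau> \<le> \<theta>w / 12 * aZ"
    proof -
      have "\<alpha>\<^sup>2 \<le> (1 - \<tau>) * \<gamma>\<^sup>2" using cond_contraction(2) ranges by (simp add: pos_divide_le_eq)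
      then have "4 * \<alpha>\<^sup>2 / \<tau> \<le> 4 * ((1 - \<tau>) * \<gamma>\<^sup>2) / \<tau>" using ranges by (simp add: divide_right_mono)
      also have "\<dots> = \<theta>w / 12 * aZ" unfolding aZ_def t_def[symmetric] using \<theta>w by simp
      finally show ?thesis .
    qed
    moreover have "(1 - \<theta>w / 2) * ((1 - \<theta>w / 6) * aZ) \<le> (1 - \<delta>) * ((1 - \<theta>w / 6) * aZ)"
      using \<delta> \<theta>w pos by (intro mult_right_mono mult_nonneg_nonneg) auto
    moreover have "(1 - \<theta>w / 2) * ((1 - \<theta>w / 6) * aZ) = aZ * (1 - \<theta>w) + \<theta>w / 6 * aZ + \<theta>w / 12 * aZ + \<theta>w / 12 * \<theta>w * aZ + (\<theta>w / 12 * aZ)"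
      by (simp add: field_simps)
    moreover have "0 \<le> \<theta>w / 12 * \<theta>w * aZ" "0 \<le> \<theta>w / 12 * aZ" using \<theta>w pos by simp_all
    ultimately have "aZ * (1 - \<theta>w) + \<theta>w / 6 * aZ + 4 * \<alpha>\<^sup>2 / \<tau> \<le> (1 - \<delta>) * ((1 - \<theta>w / 6) * aZ)" by linarith
    then have "(aZ * (1 - \<theta>w) + \<theta>w / 6 * aZ + 4 * \<alpha>\<^sup>2 / \<tau>) * C_Z k \<le> (1 - \<delta>) * ((1 - \<theta>w / 6) * aZ) * C_Z k"
      using n by (intro mult_right_mono) auto
    then show ?thesis by (simp only: distrib_right mult.assoc)
  qed
  \<comment> \<open>half of the contraction of \<open>C_G\<close> is used up by its appearance in \<open>C_Z\<close>\<close>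
  have G: "aG * C_G (Suc k) + 1 / (2 * L\<^sup>2) * C_G k \<le> (1 - \<delta>) * (aG * C_G k) + 2 * c5 * p * aG * D k"
  proof -
    have e: "1 / (2 * L\<^sup>2) = \<theta>w / 2 * aG" unfolding aG_def using \<theta>w by simp
    have "aG * C_G (Suc k) + 1 / (2 * L\<^sup>2) * C_G k = (1 - \<theta>w / 2) * (aG * C_G k) + 2 * c5 * p * aG * D k"
      unfolding C_G_Suc e by (simp add: algebra_simps)
    also have "\<dots> \<le> (1 - \<delta>) * (aG * C_G k) + 2 * c5 * p * aG * D k"
      using \<delta> pos n by (intro add_right_mono mult_right_mono mult_nonneg_nonneg) auto
    finally show ?thesis .
  qed
  have "(2 * (1 - \<tau>) / (2 - \<tau>) + 192 * c5 * (1 - \<tau>) * \<gamma>\<^sup>2 * \<beta>\<^sup>2 / (\<tau> * \<theta>w\<^sup>2) + \<tau> / 4 + 16 * c5 * p / \<theta>w) * PX k \<le> (1 - \<tau> / 8) * PX k"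
    using n by (intro mult_right_mono cond_contraction) auto
  then have P: "2 * (1 - \<tau>) / (2 - \<tau>) * PX k + 192 * c5 * (1 - \<tau>) * \<gamma>\<^sup>2 * \<beta>\<^sup>2 / (\<tau> * \<theta>w\<^sup>2) * PX k + \<tau> / 4 * PX k + 16 * c5 * p / \<theta>w * PX k
    \<le> PX k - \<tau> / 8 * PX k"
    by (simp only: distrib_right left_diff_distrib mult_1)
  have y: "4 / (4 - \<tau>) * ((1 - \<alpha> - \<tau>)\<^sup>2 / (1 - \<tau>)) * EY k \<le> (1 - \<delta>) * (aY * EY k)"
  proof -
    have t1: "0 \<le> 1 - \<alpha> - \<tau>" using y_weight_nonneg ranges by (simp add: zero_le_divide_iff)
    have "(1 - \<tau>) * \<delta> \<le> (1 - \<tau>) * (\<gamma> / 4)" using \<delta> ranges by (intro mult_left_mono) auto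
    then have "(1 - \<tau>) * \<delta> \<le> \<alpha>" using gamma_le_alpha ranges by (simp only: times_divide_eq_right)
    then have t2: "1 - \<alpha> - \<tau> \<le> (1 - \<delta>) * (1 - \<tau>)" by (simp add: algebra_simps)
    have "(1 - \<alpha> - \<tau>)\<^sup>2 \<le> ((1 - \<delta>) * (1 - \<tau>)) * (1 - \<tau>)"
      unfolding power2_eq_square using t1 t2 ranges by (intro mult_mono) auto
    then have "(1 - \<alpha> - \<tau>)\<^sup>2 / (1 - \<tau>) \<le> (1 - \<delta>) * (1 - \<tau>)" using ranges by (simp add: pos_divide_le_eq)
    then have "4 / (4 - \<tau>) * ((1 - \<alpha> - \<tau>)\<^sup>2 / (1 - \<tau>)) \<le> 4 / (4 - \<tau>) * ((1 - \<delta>) * (1 - \<tau>))"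
      using ranges by (intro mult_left_mono) auto
    also have "\<dots> = (1 - \<delta>) * aY" unfolding aY_def by simp
    finally have "4 / (4 - \<tau>) * ((1 - \<alpha> - \<tau>)\<^sup>2 / (1 - \<tau>)) * EY k \<le> (1 - \<delta>) * aY * EY k"
      using n by (intro mult_right_mono) auto
    then show ?thesis by (simp only: mult.assoc)
  qed
  have split: "(1 - \<theta>w / 6) * aZ * C_Z (Suc k) = aZ * C_Z (Suc k) - \<theta>w / 6 * aZ * C_Z (Suc k)"
    by (simp add: algebra_simps)
  have tPX: "0 \<le> \<tau> / 32 * PX k" using n ranges by simp
  have "B (Suc k) + \<tau> / 8 * (3 / 4 * PX k + 1 / 2 * EQ k) \<le> (1 - \<delta>) * B k + (aZ * c5 * dd * D k + 2 * c5 * p * aG * D k)"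
    unfolding B_def split distrib_left[of "1 - \<delta>"]
    using Q Y U U' Z Z' G P y PX_le[of k] tPX by (simp add: distrib_left) 
  then have "8 / \<tau> * (B (Suc k) + \<tau> / 8 * (3 / 4 * PX k + 1 / 2 * EQ k)) \<le> 8 / \<tau> * ((1 - \<delta>) * B k + (aZ * c5 * dd * D k + 2 * c5 * p * aG * D k))"
    using ranges by (intro mult_left_mono) auto
  moreover have "8 / \<tau> * (aZ * c5 * dd * D k + 2 * c5 * p * aG * D k) = c5 * c2_tilde \<theta> L \<gamma> \<tau> p q \<eta> * D k"
    unfolding c2_tilde_def dd_def[symmetric] aZ_def aG_def t_def[symmetric] by (simp add: distrib_left distrib_right power2_eq_square ac_simps)
  moreover have "Phi_C j = 8 / \<tau> * B j" for j unfolding Phi_C_eq B_def aQ_def aY_def aU_def aZ_def aG_def ..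
  moreover have "8 / \<tau> * (\<tau> / 8 * (3 / 4 * PX k + 1 / 2 * EQ k)) = 3 / 4 * PX k + 1 / 2 * EQ k" using ranges by simp
  ultimately show ?thesis
    by (simp only: distrib_left[of "8 / \<tau>"] mult.left_commute[of "8 / \<tau>" "1 - \<delta>"] add.assoc)
qed

end

section \<open>Contraction of the whole potential\<close>

context ogt_run
begin

text \<open>
  The optimization part of \<open>Phi\<close>, before taking expectations.
\<close>
definition potential :: "('n, 'd) ogt_state \<Rightarrow> real" where
  "potential s = 1 / \<gamma> * (obj_avg f (row_avg (sY s)) - obj_avg f xs)
     + (2 * \<tau> + \<alpha>) / (2 * \<alpha> * p) * (obj_avg f (row_avg (upper (sU s))) - obj_avg f xs)
     + (1 + \<beta>) / (2 * \<eta>) * (norm (row_avg (upper (sZ s)) - xs))\<^sup>2"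

lemma obj_avg_minimal: "obj_avg f xs \<le> obj_avg f x"
  using minimizer unfolding unique_minimizer_def by (cases "x = xs") (auto simp: less_imp_le)

lemma continuous_on_obj_avg [continuous_intros]:
  assumes "continuous_on S g"
  shows "continuous_on S (\<lambda>x. obj_avg f (g x))"
proof -
  have "continuous_on UNIV (f i)" for i
    using f[of i] unfolding smooth_strongly_convex_def
    by (auto intro!: continuous_at_imp_continuous_on has_derivative_continuous simp: gderiv_def)
  then have "continuous_on S (\<lambda>x. f i (g x))" for i
    by (rule continuous_on_compose2[OF _ assms]) auto
  then show ?thesis unfolding obj_avg_def by (intro continuous_intros)
qed

lemma continuous_on_potential: "continuous_on UNIV potential"
  unfolding potential_def by (intro continuous_intros continuous_on_id)

lemma potential_nonneg: "0 \<le> potential s"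
  unfolding potential_def using obj_avg_minimal ranges by (intro add_nonneg_nonneg mult_nonneg_nonneg) auto

text \<open>
  Comparison of coefficients in \<open>expected_accelerated_step\<close>:
  \<open>1 / \<gamma> - 1 / 4 = (1 - \<gamma> / 4) / \<gamma>\<close> for the value at
  \<open>Y\<close>, a loss of \<open>1 / 2\<close> for the value at \<open>U\<close>, and
  \<open>1\<close> against \<open>1 + \<beta>\<close> for the distance of \<open>Z\<close>. They
  give the first three entries of the rate.
\<close>
lemma expected_potential_step:
  assumes s: "balanced s" and \<delta>: "\<delta> \<le> \<gamma> / 4" "\<delta> \<le> \<alpha> * p / (2 * \<tau> + \<alpha>)" "\<delta> \<le> \<beta> / (1 + \<beta>)"
  shows "noise_avg p q (\<lambda>a b. potential (next_state s a b)) \<le> (1 - \<delta>) * potential s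
    + L / (2 * real CARD('n) * \<alpha>) * consensus_err (sX s)
    + \<tau> / \<alpha> * (L / (2 * real CARD('n))) * consensus_err (sQ s)
    + (2 * \<eta> / (3 * q * real CARD('n)) - \<tau> / (4 * \<alpha> * L * real CARD('n))) * grad_gap s"
proof -
  define A where "A = (1 - \<alpha> - \<tau>) / \<alpha>"
  define cU where "cU = (2 * \<tau> + \<alpha>) / (2 * \<alpha> * p)"
  define z where "z = row_avg (upper (sZ s))"
  define zz where "zz = (\<lambda>b. row_avg (upper (next_Z s b)))"
  define V where "V = (\<lambda>z'. 1 / \<gamma> * (obj_avg f (row_avg (sX s) + \<gamma> *\<^sub>R (z' - z)) - obj_avg f xs) + (1 + \<beta>) / (2 * \<eta>) * (norm (z' - xs))\<^sup>2)"
  define Fy where "Fy = obj_avg f (row_avg (sY s)) - obj_avg f xs"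
  define Fu where "Fu = obj_avg f (row_avg (sQ s)) - obj_avg f xs"
  define Fx where "Fx = obj_avg f (row_avg (sX s)) - obj_avg f xs"
  have Fpos: "0 \<le> Fy" "0 \<le> Fu" unfolding Fy_def Fu_def using obj_avg_minimal by simp_all
  have uQ: "row_avg (upper (sU s)) = row_avg (sQ s)" and e: "row_avg (upper (sU s)) = row_avg (lower (sU s))"
    using s unfolding balanced_def by auto
  have X: "row_avg (sX s) = (1 - \<alpha> - \<tau>) *\<^sub>R row_avg (sY s) + \<alpha> *\<^sub>R z + \<tau> *\<^sub>R row_avg (sQ s)"
    unfolding sX_def z_def uQ[symmetric] by (simp only: linear_ops)
  have zz: "(1 + \<beta>) *\<^sub>R zz b = z + \<beta> *\<^sub>R row_avg (sX s) - \<eta> *\<^sub>R (row_avg (rowwise gradf (sQ s))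
      + b *\<^sub>R (row_avg (rowwise gradf (sX s)) - row_avg (rowwise gradf (sQ s))))" for b
    unfolding zz_def z_def gradF_def[symmetric] balanced_next_Z(1)[OF s] using ranges by simp
  have main: "q * V (zz (1 / q)) + (1 - q) * V (zz 0) + (p * (cU * Fx) + (1 - p) * (cU * Fu))
    \<le> A * Fy + (cU - 1 / 2) * Fu + 1 / (2 * \<eta>) * (norm (z - xs))\<^sup>2
      + L / (2 * real CARD('n) * \<alpha>) * consensus_err (sX s)
      + \<tau> / \<alpha> * (L / (2 * real CARD('n))) * consensus_err (sQ s)
      + (2 * \<eta> / (3 * q * real CARD('n)) - \<tau> / (4 * \<alpha> * L * real CARD('n))) * grad_gap s"
    unfolding V_def cU_def Fy_def Fu_def Fx_def consensus_err_def grad_gap_def gradF_def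
    by (rule expected_accelerated_step[OF f \<mu> L _ _ _ _ _ A_def _ _ _ X _ _ _ zz])
       (use ranges cond_descent y_weight_nonneg obj_avg_minimal in \<open>auto simp: A_def\<close>)
  have potential: "potential (next_state s a b) = V (zz b) + cU * (if a = 1 then Fx else Fu)" if "a \<in> {0, 1}" for a b
  proof -
    have "row_avg (upper (W_tilde \<theta> W ** ((1 - a) *\<^sub>R sU s + a *\<^sub>R stack2 (sX s)))) = (if a = 1 then row_avg (sX s) else row_avg (sQ s))"
      using that e uQ by (subst row_avg_W_tilde(1)) (auto simp: linear_ops)
    then show ?thesis
      unfolding potential_def V_def cU_def Fx_def Fu_def zz_def z_def using that by (auto simp: linear_ops)
  qed
  have "noise_avg p q (\<lambda>a b. potential (next_state s a b)) = q * V (zz (1 / q)) + (1 - q) * V (zz 0) + (p * (cU * Fx) + (1 - p) * (cU * Fu))"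
    unfolding noise_avg_def by (simp add: potential) (simp add: algebra_simps)
  moreover have "A * Fy \<le> (1 - \<delta>) * (1 / \<gamma> * Fy)"
  proof -
    have "A \<le> 1 / \<gamma> - 1 / 4" unfolding A_def by (rule cond_descent)
    also have "\<dots> = (1 - \<gamma> / 4) * (1 / \<gamma>)" using ranges by (simp add: field_simps)
    also have "\<dots> \<le> (1 - \<delta>) * (1 / \<gamma>)" using \<delta> ranges by (intro mult_right_mono) auto
    finally have "A * Fy \<le> (1 - \<delta>) * (1 / \<gamma>) * Fy" using Fpos by (intro mult_right_mono)
    then show ?thesis by (simp only: mult.assoc)
  qed
  moreover have "(cU - 1 / 2) * Fu \<le> (1 - \<delta>) * (cU * Fu)"
  proof -
    have "\<alpha> * p / (2 * \<tau> + \<alpha>) * cU = 1 / 2"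
      unfolding cU_def using ranges add_pos_pos[of "2 * \<tau>" \<alpha>] by simp
    then have "cU - 1 / 2 = (1 - \<alpha> * p / (2 * \<tau> + \<alpha>)) * cU" by (simp only: left_diff_distrib mult_1)
    also have "\<dots> \<le> (1 - \<delta>) * cU" using \<delta> ranges unfolding cU_def by (intro mult_right_mono) auto
    finally have "(cU - 1 / 2) * Fu \<le> (1 - \<delta>) * cU * Fu" using Fpos by (intro mult_right_mono)
    then show ?thesis by (simp only: mult.assoc)
  qed
  moreover have "1 / (2 * \<eta>) * (norm (z - xs))\<^sup>2 \<le> (1 - \<delta>) * ((1 + \<beta>) / (2 * \<eta>) * (norm (z - xs))\<^sup>2)"
  proof -
    have "1 / (2 * \<eta>) = (1 - \<beta> / (1 + \<beta>)) * ((1 + \<beta>) / (2 * \<eta>))" using ranges by (simp add: field_simps)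
    also have "\<dots> \<le> (1 - \<delta>) * ((1 + \<beta>) / (2 * \<eta>))" using \<delta> ranges by (intro mult_right_mono) auto
    finally have "1 / (2 * \<eta>) * (norm (z - xs))\<^sup>2 \<le> (1 - \<delta>) * ((1 + \<beta>) / (2 * \<eta>)) * (norm (z - xs))\<^sup>2" by (intro mult_right_mono) auto
    then show ?thesis by (simp only: mult.assoc)
  qed
  moreover have "(1 - \<delta>) * potential s = (1 - \<delta>) * (1 / \<gamma> * Fy) + (1 - \<delta>) * (cU * Fu) + (1 - \<delta>) * ((1 + \<beta>) / (2 * \<eta>) * (norm (z - xs))\<^sup>2)"
    unfolding potential_def Fy_def Fu_def cU_def z_def uQ by (simp only: distrib_left)
  ultimately show ?thesis using main by linarith
qed

abbreviation rate where "rate \<equiv> ogt_rate \<theta> \<alpha> \<beta> \<gamma> \<tau> p"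

lemma rate_le:
  "rate \<le> \<gamma> / 4" "rate \<le> \<alpha> * p / (2 * \<tau> + \<alpha>)"
  "rate \<le> \<beta> / (1 + \<beta>)" "rate \<le> p / 2"
  "rate \<le> \<tau>" "rate \<le> \<theta>w / 2"
  unfolding ogt_rate_def by (rule Min_le; simp)+

lemma rate_nonneg: "0 \<le> rate"
  unfolding ogt_rate_def using ranges \<theta>w by (subst Min_ge_iff) auto

lemma Phi_eq: "Phi k = (\<integral>\<omega>. potential (state k \<omega>) \<partial>M) + c4 CARD('n) L \<alpha> \<gamma> \<tau> q \<eta> * Phi_C k"
proof -
  have "Phi k = (\<integral>\<omega>. potential (state k \<omega>) + c4 CARD('n) L \<alpha> \<gamma> \<tau> q \<eta> * Phi_C k \<partial>M)"
    unfolding Phi_def Phi_U_def potential_def Z_def U_def by (simp add: add.assoc)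
  also have "\<dots> = (\<integral>\<omega>. potential (state k \<omega>) \<partial>M) + c4 CARD('n) L \<alpha> \<gamma> \<tau> q \<eta> * Phi_C k"
    using integrable_state[OF continuous_on_potential, of k] by (simp add: prob_space)
  finally show ?thesis .
qed

text \<open>
  With \<open>c = c3\<close>, \<open>r = \<tau> / \<alpha>\<close> and
  \<open>h = q / (4 \<eta> L)\<close> one has \<open>c4 = c r h\<close>, and the coupling conditions
  say \<open>r h \<ge> 2\<close> and \<open>c h \<ge> L / n\<close>. So \<open>c4\<close> is at
  least \<open>2 c3\<close> and at least \<open>(\<tau> / \<alpha>) L / n\<close>, whichever of the
  two is larger; both are needed, as \<open>\<tau> / \<alpha>\<close> is not controlled by
  \<open>c3\<close>.
\<close>
lemma coefficient_bounds:
  shows "0 \<le> c4 CARD('n) L \<alpha> \<gamma> \<tau> q \<eta>" "L / (2 * real CARD('n) * \<alpha>) \<le> 3 / 4 * c4 CARD('n) L \<alpha> \<gamma> \<tau> q \<eta>"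
    "\<tau> / \<alpha> * (L / (2 * real CARD('n))) \<le> 1 / 2 * c4 CARD('n) L \<alpha> \<gamma> \<tau> q \<eta>"
    "2 * \<eta> / (3 * q * real CARD('n)) + c4 CARD('n) L \<alpha> \<gamma> \<tau> q \<eta> * (c5 * c2_tilde \<theta> L \<gamma> \<tau> p q \<eta>) \<le> \<tau> / (4 * \<alpha> * L * real CARD('n))"
proof -
  let ?c4 = "c4 CARD('n) L \<alpha> \<gamma> \<tau> q \<eta>"
  define n where "n = real CARD('n)"
  have n: "0 < n" unfolding n_def by simp
  define c where "c = c3 CARD('n) L \<alpha> \<gamma> \<tau>"
  define r where "r = \<tau> / \<alpha>"
  define h where "h = q / (4 * \<eta> * L)"
  define A where "A = (1 - \<alpha> - \<tau>) / \<alpha>"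
  have A: "0 \<le> A" unfolding A_def by (rule y_weight_nonneg)
  have r: "0 < r" unfolding r_def using ranges by simp
  have h: "0 < h" unfolding h_def using ranges L by simp
  have c_eq: "c = (A + 1 / \<gamma> + 1) * (L / n)"
    unfolding c_def c3_def n_def[symmetric] A_def using n ranges by (simp add: field_simps)
  have c0: "0 < c" unfolding c_eq using A ranges L n by (intro mult_pos_pos) (auto intro: add_nonneg_pos)
  have c4: "?c4 = c * r * h" unfolding c4_def c_def[symmetric] r_def h_def by simp
  have rh: "2 \<le> r * h"
  proof -
    have "8 * \<eta> * L / q * h \<le> r * h" unfolding r_def using h by (intro mult_right_mono cond_coupling) auto
    moreover have "8 * \<eta> * L / q * h = 2" unfolding h_def using ranges L by simp
    ultimately show ?thesis by linarith
  qed
  have ch: "L / n \<le> c * h"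
  proof -
    have "4 * (\<eta> * L\<^sup>2 / (q * n)) \<le> c" using cond_coupling(1) unfolding n_def[symmetric] c_def[symmetric] by simp
    then have "4 * (\<eta> * L\<^sup>2 / (q * n)) * h \<le> c * h" using h by (intro mult_right_mono) auto
    moreover have "4 * (\<eta> * L\<^sup>2 / (q * n)) * h = L / n" unfolding h_def using ranges L n by (simp add: power2_eq_square)
    ultimately show ?thesis by simp
  qed
  show "0 \<le> ?c4" unfolding c4 using c0 r h by simp
  have "c * 2 \<le> c * (r * h)" using rh c0 by (intro mult_left_mono) auto
  then have 1: "2 * c \<le> ?c4" unfolding c4 by (simp add: mult.assoc)
  have "r * (L / n) \<le> r * (c * h)" using ch r by (intro mult_left_mono) auto
  then have 2: "r * (L / n) \<le> ?c4" unfolding c4 by (simp add: ac_simps)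
  then show "\<tau> / \<alpha> * (L / (2 * real CARD('n))) \<le> 1 / 2 * ?c4"
    unfolding r_def n_def by simp
  define u where "u = (A + 1) * (L / n)"
  have "1 / \<alpha> = (A + 1) + r" unfolding A_def r_def using ranges by (simp add: field_simps)
  then have "L / (2 * n * \<alpha>) = 1 / 2 * (((A + 1) + r) * (L / n))"
    by (simp flip: \<open>1 / \<alpha> = (A + 1) + r\<close>)
  then have "L / (2 * n * \<alpha>) = 1 / 2 * (u + r * (L / n))"
    unfolding u_def by (simp only: distrib_right)
  moreover have "u \<le> c"
    unfolding c_eq u_def using ranges L n by (intro mult_right_mono) auto
  moreover have "1 / 2 * (u + w) \<le> 3 / 4 * ?c4" if "u \<le> c" "w \<le> ?c4" for w
    using that 1 by argo
  ultimately show "L / (2 * real CARD('n) * \<alpha>) \<le> 3 / 4 * ?c4"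
    using 2 unfolding n_def[symmetric] by (simp only:)
  have "r * h * (c5 * c * c2_tilde \<theta> L \<gamma> \<tau> p q \<eta>) \<le> r * h * (\<eta> / (2 * q * n))"
    using r h unfolding c_def n_def by (intro mult_left_mono cond_coupling) auto
  moreover have "r * h * (c5 * c * c2_tilde \<theta> L \<gamma> \<tau> p q \<eta>) = ?c4 * (c5 * c2_tilde \<theta> L \<gamma> \<tau> p q \<eta>)"
    unfolding c4 by simp
  moreover have "r * h * (\<eta> / (2 * q * n)) = r / (8 * L * n)" unfolding h_def using ranges L n by simp
  moreover have "2 * \<eta> / (3 * q * n) \<le> r / (12 * L * n)"
  proof -
    have "8 * \<eta> * L / q * (1 / (12 * L * n)) \<le> r * (1 / (12 * L * n))"
      unfolding r_def using L n by (intro mult_right_mono cond_coupling) auto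
    then show ?thesis using L by (simp add: ac_simps)
  qed
  moreover have "\<tau> / (4 * \<alpha> * L * n) = r / (8 * L * n) + r / (12 * L * n) + r / (24 * L * n)"
    unfolding r_def using ranges L n by (simp add: field_simps)
  moreover have "0 \<le> r / (24 * L * n)" using r L n by simp
  ultimately show "2 * \<eta> / (3 * q * real CARD('n)) + ?c4 * (c5 * c2_tilde \<theta> L \<gamma> \<tau> p q \<eta>) \<le> \<tau> / (4 * \<alpha> * L * real CARD('n))"
    unfolding n_def[symmetric] by linarith
qed

text \<open>
  The consensus errors produced by the optimization part are covered by what
  \<open>Phi_C_Suc_le\<close> leaves to spare, and the gradient gap that \<open>Phi_C\<close>
  produces by the negative term of the optimization part.
\<close>
theorem Phi_Suc_le: "Phi (Suc k) \<le> (1 - rate) * Phi k"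
proof -
  let ?c4 = "c4 CARD('n) L \<alpha> \<gamma> \<tau> q \<eta>"
  define \<delta> where "\<delta> = rate"
  define b1 where "b1 = L / (2 * real CARD('n) * \<alpha>)"
  define b2 where "b2 = \<tau> / \<alpha> * (L / (2 * real CARD('n)))"
  define b3 where "b3 = 2 * \<eta> / (3 * q * real CARD('n)) - \<tau> / (4 * \<alpha> * L * real CARD('n))"
  define e where "e = c5 * c2_tilde \<theta> L \<gamma> \<tau> p q \<eta>"
  have "(\<integral>\<omega>. potential (state (Suc k) \<omega>) \<partial>M) \<le> (\<integral>\<omega>. (1 - \<delta>) * potential (state k \<omega>) + b1 * consensus_err (sX (state k \<omega>))
      + b2 * consensus_err (sQ (state k \<omega>)) + b3 * grad_gap (state k \<omega>) \<partial>M)"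
  proof (rule expectation_Suc_le[where P = balanced and \<phi> = potential and \<psi> = "\<lambda>s. (1 - \<delta>) * potential s + b1 * consensus_err (sX s)
      + b2 * consensus_err (sQ s) + b3 * grad_gap s"])
    show "continuous_on UNIV (\<lambda>s. (1 - \<delta>) * potential s + b1 * consensus_err (sX s) + b2 * consensus_err (sQ s) + b3 * grad_gap s)"
      by (intro continuous_intros continuous_on_id continuous_on_potential)
    show "noise_avg p q (\<lambda>a b. potential (next_state s a b)) \<le> (1 - \<delta>) * potential s + b1 * consensus_err (sX s) + b2 * consensus_err (sQ s) + b3 * grad_gap s"
      if "balanced s" for s
      unfolding b1_def b2_def b3_def \<delta>_def by (rule expected_potential_step[OF that rate_le(1-3)])
  qed (rule continuous_on_potential, rule balanced_state)
  also have "\<dots> = (1 - \<delta>) * (\<integral>\<omega>. potential (state k \<omega>) \<partial>M) + b1 * PX k + b2 * EQ k + b3 * D k"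
    unfolding PX_state D_state EQ_def using integrable_terms[of k] integrable_state[OF continuous_on_potential, of k]
    by (simp add: grad_gap_def)
  finally have 1: "(\<integral>\<omega>. potential (state (Suc k) \<omega>) \<partial>M) \<le> (1 - \<delta>) * (\<integral>\<omega>. potential (state k \<omega>) \<partial>M) + b1 * PX k + b2 * EQ k + b3 * D k" .
  have "?c4 * (Phi_C (Suc k) + 3 / 4 * PX k + 1 / 2 * EQ k) \<le> ?c4 * ((1 - \<delta>) * Phi_C k + e * D k)"
    unfolding \<delta>_def e_def using coefficient_bounds(1) rate_nonneg rate_le by (intro mult_left_mono Phi_C_Suc_le) auto
  then have 2: "?c4 * Phi_C (Suc k) + 3 / 4 * ?c4 * PX k + 1 / 2 * ?c4 * EQ k \<le> (1 - \<delta>) * (?c4 * Phi_C k) + ?c4 * e * D k"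
    by (simp add: distrib_left ac_simps)
  have "b1 * PX k \<le> 3 / 4 * ?c4 * PX k" "b2 * EQ k \<le> 1 / 2 * ?c4 * EQ k"
    unfolding b1_def b2_def by (intro mult_right_mono coefficient_bounds expected_nonneg)+
  moreover have "(b3 + ?c4 * e) * D k \<le> 0 * D k"
    using coefficient_bounds(4) unfolding b3_def e_def by (intro mult_right_mono expected_nonneg) linarith
  then have "b3 * D k + ?c4 * e * D k \<le> 0" by (simp only: distrib_right mult_zero_left)
  moreover have "(1 - \<delta>) * Phi k = (1 - \<delta>) * (\<integral>\<omega>. potential (state k \<omega>) \<partial>M) + (1 - \<delta>) * (?c4 * Phi_C k)"
    unfolding Phi_eq by (simp only: distrib_left)
  ultimately show ?thesis unfolding \<delta>_def[symmetric] Phi_eq[of "Suc k"] using 1 2 by linarith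
qed

lemma Phi_nonneg: "0 \<le> Phi k"
proof -
  have "0 \<le> Phi_C k" unfolding Phi_C_eq using expected_nonneg C_nonneg ranges \<theta>w
    by (intro mult_nonneg_nonneg add_nonneg_nonneg) auto
  then show ?thesis unfolding Phi_eq using coefficient_bounds(1) potential_nonneg by (intro add_nonneg_nonneg mult_nonneg_nonneg) auto
qed

lemma Phi_le_power: "Phi k \<le> (1 - rate) ^ k * Phi 0"
proof (induction k)
  case (Suc k)
  have "Phi (Suc k) \<le> (1 - rate) * Phi k" by (rule Phi_Suc_le)
  also have "\<dots> \<le> (1 - rate) * ((1 - rate) ^ k * Phi 0)"
    using Suc rate_le(5) ranges by (intro mult_left_mono) auto
  finally show ?case by (simp add: mult.assoc)
qed simp

text \<open>
  A gradient is needed with probability at most \<open>p + q\<close> per iteration, by the union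
  bound.
\<close>
lemma expected_gradients_le: "expected_gradients M \<xi> \<zeta> K \<le> 1 + real K * (p + q)"
proof -
  let ?I = "\<lambda>k \<omega>. indicator {\<omega> \<in> space M. \<xi> k \<omega> = 1} \<omega> + indicator {\<omega> \<in> space M. \<zeta> k \<omega> = 1 / q} \<omega> :: real"
  let ?C = "\<lambda>\<omega>. card {k. k < K \<and> (\<xi> k \<omega> \<noteq> 0 \<or> \<zeta> k \<omega> \<noteq> 0)}"
  have "expected_gradients M \<xi> \<zeta> K \<le> (\<integral>\<omega>. 1 + (\<Sum>k<K. ?I k \<omega>) \<partial>M)"
    unfolding expected_gradients_def
  proof (rule integral_mono_AE)
    have card: "real (card {k. k < K \<and> P k}) = (\<Sum>k<K. if P k then 1 else 0)" for P
    proof -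
      have "{k. k < K \<and> P k} = {..<K} \<inter> Collect P" by auto
      then show ?thesis by (simp add: sum.If_cases)
    qed
    show "integrable M (\<lambda>\<omega>. real (1 + ?C \<omega>))"
    proof (rule integrable_const_bound[of _ "1 + real K"])
      show "AE \<omega> in M. norm (real (1 + ?C \<omega>)) \<le> 1 + real K"
        by (intro always_eventually allI) (auto intro: order_trans[OF card_mono[of "{..<K}"]])
      show "(\<lambda>\<omega>. real (1 + ?C \<omega>)) \<in> borel_measurable M"
        unfolding of_nat_add card by measurable
    qed
    show "integrable M (\<lambda>\<omega>. 1 + (\<Sum>k<K. ?I k \<omega>) :: real)"
      by (intro Bochner_Integration.integrable_add Bochner_Integration.integrable_sum) (auto simp: emeasure_eq_measure)
    show "AE \<omega> in M. real (1 + ?C \<omega>)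
      \<le> 1 + (\<Sum>k<K. ?I k \<omega>)"
      using AE_regular AE_space
    proof eventually_elim
      case (elim \<omega>)
      then have v: "\<xi> k \<omega> \<in> {0, 1}" "\<zeta> k \<omega> \<in> {0, 1 / q}" for k unfolding regular_def by blast+
      have "(\<Sum>k<K. if \<xi> k \<omega> \<noteq> 0 \<or> \<zeta> k \<omega> \<noteq> 0 then 1 else 0)
        \<le> (\<Sum>k<K. ?I k \<omega>)"
        using v elim(2) by (intro sum_mono) (auto simp: indicator_def)
      then show ?case unfolding of_nat_add card by simp
    qed
  qed
  also have "\<dots> = 1 + (\<Sum>k<K. p + q)"
  proof -
    have i: "integrable M (\<lambda>\<omega>. indicator {\<omega> \<in> space M. \<xi> k \<omega> = 1} \<omega> :: real)" "integrable M (\<lambda>\<omega>. indicator {\<omega> \<in> space M. \<zeta> k \<omega> = 1 / q} \<omega> :: real)" for k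
      by (auto simp: emeasure_eq_measure)
    then have "(\<integral>\<omega>. 1 + (\<Sum>k<K. ?I k \<omega>) \<partial>M)
      = 1 + (\<Sum>k<K. prob {\<omega> \<in> space M. \<xi> k \<omega> = 1} + prob {\<omega> \<in> space M. \<zeta> k \<omega> = 1 / q})"
      by (simp add: prob_space Bochner_Integration.integral_sum)
    then show ?thesis by (simp add: prob_noise)
  qed
  finally show ?thesis by simp
qed

end

section \<open>The explicit parameters\<close>

text \<open>
  Everything is expressed through \<open>r = sqrt \<kappa> \<ge> 1\<close> and
  \<open>t = theta_w \<theta>\<close>, which makes the conditions numerical inequalities that hold
  with room to spare.
\<close>
locale chosen_parameters =
  fixes \<mu> L \<theta> \<kappa> \<alpha> \<beta> \<gamma> \<tau> p q \<eta> :: real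
  assumes \<mu>: "0 < \<mu>" and \<mu>L: "\<mu> \<le> L" and \<theta>: "0 < \<theta>" "\<theta> \<le> 1"
    and \<kappa>: "\<kappa> = L / \<mu>" and \<tau>: "\<tau> = 1 / 2"
    and p: "p = theta_w \<theta> / 60750" and q: "q = theta_w \<theta> / 60750"
    and \<alpha>: "\<alpha> = 1 / (45 * sqrt \<kappa>)"
    and \<gamma>: "\<gamma> = 4 * \<alpha> / (4 - 4 * \<tau> - 3 * \<alpha>)"
    and \<eta>: "\<eta> = theta_w \<theta> * sqrt \<kappa> / (50000 * L)"
    and \<beta>: "\<beta> = \<mu> * \<eta> / 2"
begin

definition r where "r = sqrt \<kappa>"
definition t where "t = theta_w \<theta>"

lemma L: "0 < L" using \<mu> \<mu>L by simp

lemma t: "0 < t" "t < 1" "sqrt \<theta> / 4 \<le> t"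
  using theta_w_bounds[OF \<theta>] unfolding t_def by auto

lemma r: "1 \<le> r" "L = \<mu> * r\<^sup>2"
proof -
  have "1 \<le> \<kappa>" using \<mu> \<mu>L unfolding \<kappa> by simp
  moreover have "L = \<mu> * \<kappa>" unfolding \<kappa> using \<mu> by simp
  ultimately show "1 \<le> r" "L = \<mu> * r\<^sup>2" by (simp_all add: r_def)
qed

lemma param_eqs: "p = t / 60750" "q = t / 60750" "\<alpha> = 1 / (45 * r)" "\<gamma> = 4 / (90 * r - 3)"
  "\<eta> = t * r / (50000 * L)" "\<beta> = t / (100000 * r)"
proof -
  show "p = t / 60750" "q = t / 60750" "\<alpha> = 1 / (45 * r)" "\<eta> = t * r / (50000 * L)"
    using p q \<alpha> \<eta> unfolding t_def r_def by auto
  have "\<gamma> = 4 * \<alpha> / (2 - 3 * \<alpha>)" unfolding \<gamma> \<tau> by simp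
  then show "\<gamma> = 4 / (90 * r - 3)" using r unfolding \<open>\<alpha> = 1 / (45 * r)\<close> by (simp add: divide_simps)
  show "\<beta> = t / (100000 * r)" unfolding \<beta> \<open>\<eta> = t * r / (50000 * L)\<close> r(2) using \<mu> r(1)
    by (simp add: field_simps power2_eq_square)
qed

lemma \<gamma>_bounds: "2 * \<alpha> \<le> \<gamma>" "0 < \<gamma>" "\<gamma> \<le> 4 / (87 * r)" "\<gamma> < 1" "1 / \<gamma> = 45 / 2 * r - 3 / 4"
  unfolding param_eqs using r(1) by (auto simp: divide_simps)

lemma ratio: "(1 - \<alpha> - \<tau>) / \<alpha> = 45 / 2 * r - 1"
  unfolding param_eqs \<tau> using r(1) by (simp add: field_simps)

lemma c3_value: "c3 n L \<alpha> \<gamma> \<tau> = (45 * r - 3 / 4) * (L / real n)"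
proof -
  have "c3 n L \<alpha> \<gamma> \<tau> = ((1 - \<alpha> - \<tau>) / \<alpha> + 1 / \<gamma> + 1) * (L / real n)"
    unfolding c3_def by (simp add: add_divide_distrib[symmetric] divide_divide_eq_left[symmetric] mult.commute[of "real n"] del: divide_divide_eq_left)
  then show ?thesis unfolding ratio \<gamma>_bounds(5) by (simp add: algebra_simps)
qed

lemma \<gamma>_\<eta>: "\<gamma> * (\<eta> * L) \<le> t / 1000000" "0 \<le> \<gamma> * (\<eta> * L)"
proof -
  have "\<gamma> * (\<eta> * L) = \<gamma> * r * (t / 50000)" unfolding param_eqs(5) using L by simp
  also have "\<dots> \<le> 4 / 87 * (t / 50000)"
  proof (rule mult_right_mono)
    have "\<gamma> * r \<le> 4 / (87 * r) * r" using \<gamma>_bounds r by (intro mult_right_mono) auto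
    then show "\<gamma> * r \<le> 4 / 87" using r(1) by simp
  qed (use t in auto)
  also have "\<dots> \<le> t / 1000000" using t by simp
  finally show "\<gamma> * (\<eta> * L) \<le> t / 1000000" .
  show "0 \<le> \<gamma> * (\<eta> * L)" unfolding param_eqs(5) using \<gamma>_bounds t r L by simp
qed

lemma params_range: "ogt_params_range \<alpha> \<beta> \<gamma> \<tau> p q \<eta>"
proof -
  have "0 < \<alpha>" "\<alpha> < 1" "0 < \<beta>" unfolding param_eqs using r(1) t by auto
  moreover have "\<beta> < 1" 
  proof -
    have "\<beta> \<le> t / 100000" unfolding param_eqs using r(1) t by (intro divide_left_mono) auto
    then show ?thesis using t by simp
  qed
  moreover have "0 < \<eta>" unfolding param_eqs using t r L by simp
  ultimately show ?thesis unfolding ogt_params_range_def using \<gamma>_bounds \<tau> param_eqs(1,2) t by auto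
qed

lemma conditions:
  assumes n: "0 < n"
  shows "ogt_conditions n \<mu> L \<theta> \<alpha> \<beta> \<gamma> \<tau> p q \<eta>"
  unfolding ogt_conditions_def t_def[symmetric]
proof (intro conjI)
  have n: "0 < real n" using n by simp
  have \<eta>0: "0 < \<eta>" unfolding param_eqs using t r L by simp
  have \<gamma>\<beta>: "\<gamma> * \<beta> / t \<le> 1 / 100000" "0 \<le> \<gamma> * \<beta> / t"
  proof -
    have "\<gamma> * \<beta> / t = \<gamma> * (1 / (100000 * r))" unfolding param_eqs(6) using t by simp
    also have "\<dots> \<le> 1 * (1 / 100000)" using \<gamma>_bounds r by (intro mult_mono divide_left_mono) auto
    finally show "\<gamma> * \<beta> / t \<le> 1 / 100000" by simp
    show "0 \<le> \<gamma> * \<beta> / t" unfolding param_eqs(6) using \<gamma>_bounds t r by simp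
  qed
  have "192 * c5 * (1 - \<tau>) * \<gamma>\<^sup>2 * \<beta>\<^sup>2 / (\<tau> * t\<^sup>2) = 2688 * (\<gamma> * \<beta> / t)\<^sup>2"
    unfolding \<tau> c5_def by (simp add: power_mult_distrib power_divide)
  also have "\<dots> \<le> 2688 * (1 / 100000)\<^sup>2" using \<gamma>\<beta> by (intro mult_left_mono power_mono) auto
  finally have "192 * c5 * (1 - \<tau>) * \<gamma>\<^sup>2 * \<beta>\<^sup>2 / (\<tau> * t\<^sup>2) \<le> 1 / 1000"
    by (rule order_trans) (simp add: power2_eq_square)
  moreover have "16 * c5 * p / t = 224 / 60750" unfolding param_eqs(1) c5_def using t by simp
  ultimately show "2 * (1 - \<tau>) / (2 - \<tau>) + 192 * c5 * (1 - \<tau>) * \<gamma>\<^sup>2 * \<beta>\<^sup>2 / (\<tau> * t\<^sup>2) + \<tau> / 4 + 16 * c5 * p / t \<le> 1 - \<tau> / 8"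
    unfolding \<tau> by simp
  have "(2 * \<alpha>)\<^sup>2 \<le> \<gamma>\<^sup>2" using \<gamma>_bounds r(1) unfolding param_eqs(3) by (intro power_mono) auto
  then have "4 * \<alpha>\<^sup>2 \<le> \<gamma>\<^sup>2" by (simp add: power_mult_distrib)
  then have "2 * \<alpha>\<^sup>2 \<le> \<gamma>\<^sup>2" using zero_le_power2[of \<alpha>] by linarith
  then show "\<alpha>\<^sup>2 / ((1 - \<tau>) * \<gamma>\<^sup>2) \<le> 1"
    unfolding \<tau> using \<gamma>_bounds by (simp add: divide_le_eq)
  have sq: "(\<gamma> * (\<eta> * L))\<^sup>2 \<le> (t / 1000000)\<^sup>2" using \<gamma>_\<eta> by (intro power_mono) auto
  have "192 * c5 * (1 - \<tau>) * \<gamma>\<^sup>2 * \<eta>\<^sup>2 * L\<^sup>2 / (\<tau> * t) = 2688 / t * (\<gamma> * (\<eta> * L))\<^sup>2"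
    unfolding \<tau> c5_def by (simp add: power_mult_distrib)
  also have "\<dots> \<le> 2688 / t * (t / 1000000)\<^sup>2" using t sq by (intro mult_left_mono) auto
  also have "\<dots> \<le> t / 2" using t by (simp add: power2_eq_square)
  finally show "192 * c5 * (1 - \<tau>) * \<gamma>\<^sup>2 * \<eta>\<^sup>2 * L\<^sup>2 / (\<tau> * t) \<le> t / 2" .
  have "2 * \<eta> * L\<^sup>2 / (q * real n) = 243 / 100 * r * (L / real n)"
    unfolding param_eqs using t L by (simp add: power2_eq_square)
  also have "\<dots> \<le> (45 * r - 3 / 4) / 2 * (L / real n)" using r(1) L n by (intro mult_right_mono) auto
  finally show "2 * \<eta> * L\<^sup>2 / (q * real n) \<le> c3 n L \<alpha> \<gamma> \<tau> / 2" unfolding c3_value by (simp add: mult.commute)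
  have "\<eta>\<^sup>2 / (t / 60750) + 2 * \<eta>\<^sup>2 / t = 60752 * (\<eta>\<^sup>2 / t)" using t by simp
  then have "c2_tilde \<theta> L \<gamma> \<tau> p q \<eta> = 768 * \<gamma>\<^sup>2 / t * (60752 * (\<eta>\<^sup>2 / t)) + 32 / 60750 / L\<^sup>2"
    unfolding c2_tilde_def t_def[symmetric] param_eqs(1,2) \<tau> using t by (simp add: power_divide)
  also have "768 * \<gamma>\<^sup>2 / t * (60752 * (\<eta>\<^sup>2 / t)) = 46657536 * (\<gamma> * (\<eta> * L) / t)\<^sup>2 / L\<^sup>2"
    using L by (simp add: power_mult_distrib power_divide power2_eq_square)
  also have "\<dots> + 32 / 60750 / L\<^sup>2 = (46657536 * (\<gamma> * (\<eta> * L) / t)\<^sup>2 + 32 / 60750) / L\<^sup>2"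
    by (simp only: add_divide_distrib)
  also have "\<dots> \<le> (46657536 * (1 / 1000000)\<^sup>2 + 32 / 60750) / L\<^sup>2"
    using \<gamma>_\<eta> t by (intro divide_right_mono add_right_mono mult_left_mono power_mono) (auto simp: pos_divide_le_eq)
  also have "\<dots> \<le> 6 / 10000 / L\<^sup>2" by (intro divide_right_mono) (auto simp: power2_eq_square)
  finally have c2: "c2_tilde \<theta> L \<gamma> \<tau> p q \<eta> \<le> 6 / 10000 / L\<^sup>2" .
  have "c5 * c3 n L \<alpha> \<gamma> \<tau> * c2_tilde \<theta> L \<gamma> \<tau> p q \<eta> \<le> 14 * (45 * r * (L / real n)) * (6 / 10000 / L\<^sup>2)"
    unfolding c3_value c5_def using c2 r(1) L n
    by (intro order_trans[OF mult_left_mono[OF c2] mult_right_mono] mult_left_mono mult_right_mono mult_nonneg_nonneg) auto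
  also have "\<dots> = 378 / 1000 * r * (1 / (L * real n))" using L by (simp add: power2_eq_square)
  also have "\<dots> \<le> 6075 / 10000 * r * (1 / (L * real n))" using r(1) L n by (intro mult_right_mono) auto
  also have "\<dots> = \<eta> / (2 * q * real n)" unfolding param_eqs using t L n by simp
  finally show "c5 * c3 n L \<alpha> \<gamma> \<tau> * c2_tilde \<theta> L \<gamma> \<tau> p q \<eta> \<le> \<eta> / (2 * q * real n)" .
  show "8 * \<eta> * L / q \<le> \<tau> / \<alpha>" unfolding param_eqs \<tau> using t L r(1) by simp
  have "\<gamma> * (\<eta> * L) \<le> 1 / 4" using \<gamma>_\<eta> t by linarith
  then show "L * \<gamma> \<le> 1 / (4 * \<eta>)" using \<eta>0 by (simp add: pos_le_divide_eq ac_simps)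
  show "\<beta> / (2 * \<eta>) \<le> \<mu> / 4" unfolding \<beta> using \<eta>0 by simp
  show "1 / \<gamma> - (1 - \<alpha> - \<tau>) / \<alpha> - 1 / 2 \<le> 0" "(1 - \<alpha> - \<tau>) / \<alpha> \<le> 1 / \<gamma> - 1 / 4"
    unfolding ratio \<gamma>_bounds(5) by simp_all
qed

text \<open>
  The smallest entry of the rate is \<open>\<alpha> p / (2 \<tau> + \<alpha>)\<close>, of size about
  \<open>t / (45 * 60750 r)\<close>, hence the constant \<open>3000000\<close>.
\<close>
lemma rate_lower: "t / (3000000 * r) \<le> ogt_rate \<theta> \<alpha> \<beta> \<gamma> \<tau> p"
proof -
  have tr: "t / (c * r) \<le> t / c" if "0 < c" for c
    using that t r(1) by (intro divide_left_mono) auto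
  have \<alpha>0: "0 < \<alpha>" "\<alpha> \<le> 1 / 45" unfolding param_eqs(3) using r(1) by (auto simp: field_simps)
  have "t / (3000000 * r) \<le> 1 / (90 * r)" using t r(1) by (simp add: divide_simps)
  also have "\<dots> \<le> \<gamma> / 4" using \<gamma>_bounds(1) unfolding param_eqs(3) by simp
  finally have 1: "t / (3000000 * r) \<le> \<gamma> / 4" .
  have "t / (3000000 * r) \<le> \<alpha> * p / (46 / 45)" unfolding param_eqs using t r(1) by (simp add: divide_simps)
  also have "\<dots> \<le> \<alpha> * p / (2 * \<tau> + \<alpha>)"
    unfolding \<tau> using \<alpha>0 t unfolding param_eqs(1) by (intro divide_left_mono) auto
  finally have 2: "t / (3000000 * r) \<le> \<alpha> * p / (2 * \<tau> + \<alpha>)" .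
  have \<beta>0: "0 < \<beta>" "\<beta> \<le> 1" using params_range unfolding ogt_params_range_def by auto
  have "t / (3000000 * r) \<le> \<beta> / 2" unfolding param_eqs(6) using t r(1) by (simp add: divide_simps)
  also have "\<dots> \<le> \<beta> / (1 + \<beta>)" using \<beta>0 by (intro divide_left_mono) auto
  finally have 3: "t / (3000000 * r) \<le> \<beta> / (1 + \<beta>)" .
  have 4: "t / (3000000 * r) \<le> p / 2" "t / (3000000 * r) \<le> \<tau>" "t / (3000000 * r) \<le> t / 2"
    unfolding param_eqs(1) \<tau> using tr[of 3000000] t by auto
  show ?thesis unfolding ogt_rate_def t_def[symmetric] using 1 2 3 4 by (subst Min_ge_iff) auto
qed

text \<open>
  About \<open>ln (1 / \<epsilon>) / \<delta>\<close> iterations suffice, that is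
  \<open>O (r / t * ln (1 / \<epsilon>))\<close>. Each costs \<open>p + q\<close> gradients in
  expectation, which cancels \<open>t\<close>, and one communication round, where
  \<open>t \<ge> sqrt \<theta> / 4\<close> applies. Additive constants are absorbed because
  \<open>\<epsilon> \<le> 1 / 2\<close> gives \<open>ln (1 / \<epsilon>) \<ge> 1 / 2\<close>.
\<close>
lemma iteration_bound:
  assumes \<epsilon>: "0 < \<epsilon>" "\<epsilon> \<le> 1 / 2"
  obtains K where "(1 - ogt_rate \<theta> \<alpha> \<beta> \<gamma> \<tau> p) ^ K \<le> \<epsilon>"
    "1 + real K * (p + q) \<le> O_const * (sqrt \<kappa> * ln (1 / \<epsilon>))"
    "real K \<le> O_const * (sqrt (\<kappa> / \<theta>) * ln (1 / \<epsilon>))"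
proof -
  define \<delta> where "\<delta> = ogt_rate \<theta> \<alpha> \<beta> \<gamma> \<tau> p"
  define l where "l = ln (1 / \<epsilon>)"
  have \<delta>: "t / (3000000 * r) \<le> \<delta>" "\<delta> \<le> 1"
  proof -
    show "t / (3000000 * r) \<le> \<delta>" unfolding \<delta>_def by (rule rate_lower)
    have "\<delta> \<le> \<tau>" unfolding \<delta>_def ogt_rate_def by (rule Min_le) auto
    then show "\<delta> \<le> 1" unfolding \<tau> by simp
  qed
  have tr: "0 < t / (3000000 * r)" using t r by simp
  then have \<delta>0: "0 < \<delta>" using \<delta> by linarith
  have l: "1 / 2 \<le> l"
  proof -
    have "ln \<epsilon> \<le> \<epsilon> - 1" using \<epsilon> by (intro ln_le_minus_one)
    then show ?thesis unfolding l_def using \<epsilon> by (simp add: ln_div)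
  qed
  define K where "K = nat \<lceil>l / \<delta>\<rceil>"
  have K: "l / \<delta> \<le> real K" "real K \<le> l / \<delta> + 1"
    unfolding K_def using l \<delta>0 by (auto simp: of_nat_ceiling)
  have "(1 - \<delta>) ^ K \<le> exp (- \<delta>) ^ K"
    using \<delta> exp_ge_add_one_self[of "- \<delta>"] by (intro power_mono) auto
  also have "\<dots> = exp (- (real K * \<delta>))" by (simp flip: exp_of_nat_mult)
  also have "\<dots> \<le> exp (- l)" using K(1) \<delta>0 by (simp add: pos_divide_le_eq)
  also have "\<dots> = \<epsilon>" unfolding l_def using \<epsilon> by (simp add: ln_div)
  finally have 1: "(1 - \<delta>) ^ K \<le> \<epsilon>" .
  have "l / \<delta> \<le> l / (t / (3000000 * r))"
    using \<delta> tr l by (intro divide_left_mono mult_pos_pos) auto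
  also have "\<dots> = 3000000 * (l * (r / t))" by simp
  finally have K': "real K \<le> 3000000 * (l * (r / t)) + 2 * l" using K(2) l by linarith
  have lr: "l \<le> l * r" using l r(1) by simp
  have "real K * (p + q) \<le> (3000000 * (l * (r / t)) + 2 * l) * (p + q)"
    using K' t unfolding param_eqs(1,2) by (intro mult_right_mono) auto
  also have "\<dots> = 6000000 / 60750 * (l * r) + 4 / 60750 * (l * t)"
    unfolding param_eqs(1,2) using t by (simp add: field_simps)
  also have "l * t \<le> l * r" using l t r by (intro mult_left_mono) auto
  finally have "1 + real K * (p + q) \<le> 100000000 * (l * r)" using lr l by linarith
  then have 2: "1 + real K * (p + q) \<le> O_const * (r * l)" unfolding O_const_def by (simp add: mult.commute[of r])
  have s\<theta>: "0 < sqrt \<theta>" "sqrt \<theta> \<le> 1" using \<theta> by auto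
  have rs: "r / t \<le> 4 * (r / sqrt \<theta>)"
  proof -
    have "0 < t * (sqrt \<theta> / 4)" using mult_pos_pos[OF t(1)] s\<theta>(1) by simp
    then have "r / t \<le> r / (sqrt \<theta> / 4)" using t(3) r(1) by (intro divide_left_mono) simp_all
    then show ?thesis by (simp add: mult.commute)
  qed
  have "1 \<le> r / sqrt \<theta>" using s\<theta> r(1) unfolding pos_le_divide_eq[OF s\<theta>(1)] by linarith
  then have "l * 1 \<le> l * (r / sqrt \<theta>)" using l by (intro mult_left_mono) auto
  moreover have "l * (r / t) \<le> l * (4 * (r / sqrt \<theta>))" using rs l by (intro mult_left_mono) auto
  moreover have "l * (4 * (r / sqrt \<theta>)) = 4 * (l * (r / sqrt \<theta>))" by simp
  moreover have "0 \<le> l * (r / sqrt \<theta>)" using l r(1) s\<theta> by simp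
  ultimately have "real K \<le> 100000000 * (l * (r / sqrt \<theta>))" using K' by argo
  then have 3: "real K \<le> O_const * (sqrt (\<kappa> / \<theta>) * l)"
    unfolding O_const_def real_sqrt_divide r_def[symmetric] by (simp add: mult.commute)
  show ?thesis using that[of K] 1 2 3 unfolding \<delta>_def l_def r_def by simp
qed

end

theorem theorem2:
  fixes f :: "'n::finite \<Rightarrow> real^'d::finite \<Rightarrow> real"
    and gradf :: "'n \<Rightarrow> real^'d \<Rightarrow> real^'d"
    and Edges :: "('n \<times> 'n) set"
    and W :: "real^'n^'n"
    and \<mu> L \<theta> :: real
    and xs :: "real^'d"
    and X0 :: "real^'d^'n"
  assumes "0 < \<mu>" and "\<mu> \<le> L"
    and "\<And>i. smooth_strongly_convex \<mu> L (f i) (gradf i)"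
    and "unique_minimizer (obj_avg f) xs"
    and "gossip_matrix Edges W \<theta>"
  shows
    "(\<forall>\<alpha> \<beta> \<gamma> \<tau> p q \<eta> (M :: 'w measure) \<xi> \<zeta>.
        ogt_params_range \<alpha> \<beta> \<gamma> \<tau> p q \<eta> \<and>
        ogt_noise p q M \<xi> \<zeta> \<and>
        ogt_conditions CARD('n) \<mu> L \<theta> \<alpha> \<beta> \<gamma> \<tau> p q \<eta> \<longrightarrow>
        (\<forall>k. ogt.Phi f gradf W L \<theta> xs X0 \<alpha> \<beta> \<gamma> \<tau> p q \<eta> M \<xi> \<zeta> (Suc k)
             \<le> (1 - ogt_rate \<theta> \<alpha> \<beta> \<gamma> \<tau> p)
                * ogt.Phi f gradf W L \<theta> xs X0 \<alpha> \<beta> \<gamma> \<tau> p q \<eta> M \<xi> \<zeta> k)) \<and>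
     (\<forall>\<kappa> \<alpha> \<beta> \<gamma> \<tau> p q \<eta>.
        \<kappa> = L / \<mu> \<and>
        \<tau> = 1 / 2 \<and>
        p = theta_w \<theta> / 60750 \<and> q = theta_w \<theta> / 60750 \<and>
        \<alpha> = 1 / (45 * sqrt \<kappa>) \<and>
        \<gamma> = 4 * \<alpha> / (4 - 4 * \<tau> - 3 * \<alpha>) \<and>
        \<eta> = theta_w \<theta> * sqrt \<kappa> / (50000 * L) \<and>
        \<beta> = \<mu> * \<eta> / 2 \<longrightarrow>
        ogt_params_range \<alpha> \<beta> \<gamma> \<tau> p q \<eta> \<and>
        ogt_conditions CARD('n) \<mu> L \<theta> \<alpha> \<beta> \<gamma> \<tau> p q \<eta> \<and>
        (\<forall>(M :: 'w measure) \<xi> \<zeta> \<epsilon>.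
           ogt_noise p q M \<xi> \<zeta> \<and> 0 < \<epsilon> \<and> \<epsilon> \<le> 1 / 2 \<longrightarrow>
           (\<exists>K. ogt.Phi f gradf W L \<theta> xs X0 \<alpha> \<beta> \<gamma> \<tau> p q \<eta> M \<xi> \<zeta> K
                  \<le> \<epsilon> * ogt.Phi f gradf W L \<theta> xs X0 \<alpha> \<beta> \<gamma> \<tau> p q \<eta> M \<xi> \<zeta> 0 \<and>
                expected_gradients M \<xi> \<zeta> K \<le> O_const * (sqrt \<kappa> * ln (1 / \<epsilon>)) \<and>
                communication_rounds K \<le> O_const * (sqrt (\<kappa> / \<theta>) * ln (1 / \<epsilon>)))))"
proof (intro conjI allI impI, goal_cases)
  case (1 \<alpha> \<beta> \<gamma> \<tau> p q \<eta> M \<xi> \<zeta> k)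
  then interpret ogt_run f gradf W L \<theta> xs X0 \<alpha> \<beta> \<gamma> \<tau> p q \<eta> M \<xi> \<zeta> \<mu> Edges
    using assms by unfold_locales auto
  show ?case by (rule Phi_Suc_le)
next
  case (2 \<kappa> \<alpha> \<beta> \<gamma> \<tau> p q \<eta>)
  then interpret chosen_parameters \<mu> L \<theta> \<kappa> \<alpha> \<beta> \<gamma> \<tau> p q \<eta>
    using assms by unfold_locales (auto simp: gossip_matrix_def)
  show ?case by (rule params_range)
next
  case (3 \<kappa> \<alpha> \<beta> \<gamma> \<tau> p q \<eta>)
  then interpret chosen_parameters \<mu> L \<theta> \<kappa> \<alpha> \<beta> \<gamma> \<tau> p q \<eta>
    using assms by unfold_locales (auto simp: gossip_matrix_def)
  show ?case by (rule conditions) simp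
next
  case (4 \<kappa> \<alpha> \<beta> \<gamma> \<tau> p q \<eta> M \<xi> \<zeta> \<epsilon>)
  then interpret C: chosen_parameters \<mu> L \<theta> \<kappa> \<alpha> \<beta> \<gamma> \<tau> p q \<eta>
    using assms by unfold_locales (auto simp: gossip_matrix_def)
  interpret ogt_run f gradf W L \<theta> xs X0 \<alpha> \<beta> \<gamma> \<tau> p q \<eta> M \<xi> \<zeta> \<mu> Edges
    using assms 4 C.params_range C.conditions[of "CARD('n)"] by unfold_locales auto
  obtain K where K: "(1 - rate) ^ K \<le> \<epsilon>"
    "1 + real K * (p + q) \<le> O_const * (sqrt \<kappa> * ln (1 / \<epsilon>))"
    "real K \<le> O_const * (sqrt (\<kappa> / \<theta>) * ln (1 / \<epsilon>))"
    using C.iteration_bound 4 by blast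
  have "Phi K \<le> \<epsilon> * Phi 0"
    using Phi_le_power[of K] mult_right_mono[OF K(1) Phi_nonneg[of 0]] by linarith
  moreover have "expected_gradients M \<xi> \<zeta> K \<le> O_const * (sqrt \<kappa> * ln (1 / \<epsilon>))"
    using expected_gradients_le[of K] K(2) by linarith
  ultimately show ?case using K(3) unfolding communication_rounds_def by blast
qed

end
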